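(* Let $V$ be a separable infinite-dimensional right quaternionic Hilbert space, let $T\in\mathcal{B}(V)$ and let $q\in\sigma_{pS}(T)$. Then $q$ is a right eigenvalue of $T$ of finite type if and only if $\{q\}$ is an isolated part in $E_T$ and $\dim R(P_{[q]})<\infty$, where $E_T$ is the set of representatives of $\sigma_S(T)/\!\sim$ (with $p\sim q$ if and only if $p\in[q]$) and $P_{[q]}$ is the quaternionic Riesz projection of $T$ associated with $[q]$.
   Context: $\mathbb{H}$ is the skew field of quaternions, $\mathbb{S}=\{I\in\mathbb{H}: I^2=-1\}$, $\mathbb{C}_I=\mathbb{R}+I\mathbb{R}$ for $I\in\mathbb{S}$, and $[q]=\{\operatorname{Re}(q)+I|\operatorname{Im}(q)|: I\in\mathbb{S}\}$. A right quaternionic Hilbert space $V$ is a right $\mathbb{H}$-vector space with an $\mathbb{H}$-valued inner product satisfying $\langle f,gq+h\rangle=\langle f,g\rangle q+\langle f,h\rangle$, $\langle f,g\rangle=\overline{\langle g,f\rangle}$, $\langle f,f\rangle\ge 0$ with equality only for $f=0$, and complete for $\|f\|=\sqrt{\langle f,f\rangle}$. $\mathcal{B}(V)$ is the set of bounded right $\mathbb{H}$-linear operators on $V$, $\mathbb{I}_V$ is the identity; $R(\cdot)$ and $N(\cdot)$ denote range and null space. For $T\in\mathcal{B}(V)$ and $q\in\mathbb{H}$, $Q_q(T):=T^2-2\operatorname{Re}(q)T+|q|^2\mathbb{I}_V$; $\rho_S(T)$ is the set of $q$ such that $N(Q_q(T))=\{0\}$, $R(Q_q(T))$ is dense in $V$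 and $Q_q(T)^{-1}\in\mathcal{B}(V)$; $\sigma_S(T)=\mathbb{H}\setminus\rho_S(T)$ is the $S$-spectrum (same definition for operators on closed subspaces), and $\sigma_{pS}(T)=\{q: N(Q_q(T))\ne\{0\}\}$ is the point $S$-spectrum (which equals the set of right eigenvalues, i.e. of $q$ with $Tv=vq$ for some $v\neq0$). If $q\in\sigma_S(T)$ then $[q]\subset\sigma_S(T)$. $E_T$ denotes a set of representatives of the classes of $\sigma_S(T)/\!\sim$, with $q$ the representative of its own class; "$\{q\}$ is an isolated part in $E_T$" means that $q$ is an isolated point of $E_T$. A set $\sigma\subset\sigma_S(T)$ is an isolated part of $\sigma_S(T)$ if both $\sigma$ and $\sigma_S(T)\setminus\sigma$ are closed subsets of $\sigma_S(T)$. A point $q\in\sigma_S(T)$ is a (right) eigenvalue of finite type of $T$ if $V$ is a direct sum $V=V_1\oplus V_2$ of $T$-invariant (closed) subspaces such that $\dim V_1<\infty$, $\sigma_S(T|_{V_1})\cap\sigma_S(T|_{V_2})=\emptyset$ and $\sigma_S(T|_{V_1})=[q]$. A set $U\subset\mathbb{H}$ is axially symmetric if $[x]\subset U$ for all $x\in U$; it is an $s$-domain (slice domain) if $U$ is open, $U\cap\mathbb{R}\neq\emptyset$ and $U\cap\mathbb{C}_I$ is a domain in $\mathbb{C}_I$ for every $I\in\mathbb{S}$. Fix a Hilbert basis $\mathcal{N}$ of $V$; it induces a left scalar multiplication $qf=\sum_{g\in\mathcal{N}}g\,q\langle g,f\rangle$ on $V$, and $\mathcal{B}(V)$ becomes a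 two-sided $\mathbb{H}$-module by $(qT)f=q(Tf)$, $(Tq)f=T(qf)$. For $q\in\rho_S(T)$ the left $S$-resolvent operator is $S_L^{-1}(q,T):=-Q_q(T)^{-1}(T-\overline{q}\,\mathbb{I}_V)$. For an axially symmetric isolated part $\sigma$ of $\sigma_S(T)$, let $U_\sigma$ be an axially symmetric $s$-domain that contains $\sigma$ but no other point of $\sigma_S(T)$, and suppose that the Jordan curves $\partial(U_\sigma\cap\mathbb{C}_I)$ lie in $\rho_S(T)$ for every $I\in\mathbb{S}$. The quaternionic Riesz projection of $T$ associated with $\sigma$ is $$P_\sigma=\frac{1}{2\pi}\int_{\partial(U_\sigma\cap\mathbb{C}_I)}S_L^{-1}(q,T)\,dq_I,\qquad dq_I=-dq\,I,\quad I\in\mathbb{S};$$ it is a projection that commutes with $T$. *)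

theory Defs
  imports "HOL-Complex_Analysis.Complex_Analysis"
begin

section \<open>Quaternions\<close>

datatype quat = Quat (qRe: real) (qI: real) (qJ: real) (qK: real)

lemma quat_eq_iff: "p = q \<longleftrightarrow> qRe p = qRe q \<and> qI p = qI q \<and> qJ p = qJ q \<and> qK p = qK q"
  by (auto intro: quat.expand)

instantiation quat :: real_vector
begin

definition "0 = Quat 0 0 0 0"
definition "p + q = Quat (qRe p + qRe q) (qI p + qI q) (qJ p + qJ q) (qK p + qK q)"
definition "p - q = Quat (qRe p - qRe q) (qI p - qI q) (qJ p - qJ q) (qK p - qK q)"
definition "- q = Quat (- qRe q) (- qI q) (- qJ q) (- qK q)"
definition "r *\<^sub>R q = Quat (r * qRe q) (r * qI q) (r * qJ q) (r * qK q)"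

instance
  by standard
    (simp_all add: quat_eq_iff zero_quat_def plus_quat_def minus_quat_def uminus_quat_def
      scaleR_quat_def algebra_simps)

end

instantiation quat :: real_inner
begin

definition "inner p q = qRe p * qRe q + qI p * qI q + qJ p * qJ q + qK p * qK q"
definition "norm q = sqrt ((qRe q)\<^sup>2 + (qI q)\<^sup>2 + (qJ q)\<^sup>2 + (qK q)\<^sup>2)"
definition "sgn q = inverse (norm q) *\<^sub>R (q :: quat)"
definition "dist p q = norm (p - q :: quat)"
definition "uniformity = (INF e\<in>{0 <..}. principal {(x :: quat, y). dist x y < e})"
definition "open (U :: quat set) \<longleftrightarrow>
  (\<forall>x\<in>U. eventually (\<lambda>(x', y). x' = x \<longrightarrow> y \<in> U) uniformity)"

instance
proof
  fix x y z :: quat and r :: real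
  show "inner x y = inner y x"
    by (simp add: inner_quat_def algebra_simps)
  show "inner (x + y) z = inner x z + inner y z" "inner (r *\<^sub>R x) y = r * inner x y"
    by (simp_all add: inner_quat_def plus_quat_def scaleR_quat_def algebra_simps)
  show "0 \<le> inner x x"
    by (simp add: inner_quat_def)
  show "inner x x = 0 \<longleftrightarrow> x = 0"
  proof
    assume "inner x x = 0"
    then have "(qRe x)\<^sup>2 + ((qI x)\<^sup>2 + ((qJ x)\<^sup>2 + (qK x)\<^sup>2)) = 0"
      by (simp add: inner_quat_def power2_eq_square)
    then show "x = 0"
      by (simp add: add_nonneg_eq_0_iff quat_eq_iff zero_quat_def)
  qed (simp add: inner_quat_def zero_quat_def)
  show "norm x = sqrt (inner x x)"
    by (simp add: norm_quat_def inner_quat_def power2_eq_square)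
qed (rule sgn_quat_def dist_quat_def uniformity_quat_def open_quat_def)+

end

instantiation quat :: euclidean_space
begin

definition "Basis = {Quat 1 0 0 0, Quat 0 1 0 0, Quat 0 0 1 0, Quat 0 0 0 1}"

instance
proof
  fix u v x :: quat
  show "inner u v = (if u = v then 1 else 0)" if "u \<in> Basis" "v \<in> Basis"
    using that unfolding Basis_quat_def by (elim insertE emptyE) (simp_all add: inner_quat_def)
  show "(\<forall>u\<in>Basis. inner x u = 0) \<longleftrightarrow> x = 0"
    by (simp add: Basis_quat_def inner_quat_def) (simp add: zero_quat_def quat_eq_iff)
qed (simp_all add: Basis_quat_def)

end

instantiation quat :: real_normed_div_algebra
begin

definition "1 = Quat 1 0 0 0"
definition "p * q = Quat
  (qRe p * qRe q - qI p * qI q - qJ p * qJ q - qK p * qK q)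
  (qRe p * qI q + qI p * qRe q + qJ p * qK q - qK p * qJ q)
  (qRe p * qJ q - qI p * qK q + qJ p * qRe q + qK p * qI q)
  (qRe p * qK q + qI p * qJ q - qJ p * qI q + qK p * qRe q)"
definition "inverse q = inverse ((norm q)\<^sup>2) *\<^sub>R Quat (qRe q) (- qI q) (- qJ q) (- qK q)"
definition "p div q = p * inverse (q :: quat)"

instance
proof
  fix p q r :: quat and a :: real
  show "p * q * r = p * (q * r)" "(p + q) * r = p * r + q * r" "p * (q + r) = p * q + p * r"
    "1 * p = p" "p * 1 = p" "(0 :: quat) \<noteq> 1" "a *\<^sub>R p * q = a *\<^sub>R (p * q)" "p * a *\<^sub>R q = a *\<^sub>R (p * q)"
    by (simp_all add: quat_eq_iff zero_quat_def one_quat_def plus_quat_def times_quat_def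
        scaleR_quat_def algebra_simps)
  have norm2: "(norm p)\<^sup>2 = (qRe p)\<^sup>2 + (qI p)\<^sup>2 + (qJ p)\<^sup>2 + (qK p)\<^sup>2" for p :: quat
    by (simp add: norm_quat_def)
  define c where "c p = Quat (qRe p) (- qI p) (- qJ p) (- qK p)" for p
  have c: "c p * p = (norm p)\<^sup>2 *\<^sub>R 1" "p * c p = (norm p)\<^sup>2 *\<^sub>R 1" for p
    unfolding norm2
    by (simp_all add: c_def quat_eq_iff one_quat_def times_quat_def scaleR_quat_def
        power2_eq_square algebra_simps)
  have inv: "inverse p = inverse ((norm p)\<^sup>2) *\<^sub>R c p" for p
    by (simp add: inverse_quat_def c_def)
  have sl: "a *\<^sub>R p * q = a *\<^sub>R (p * q)" "p * a *\<^sub>R q = a *\<^sub>R (p * q)" for a and p q :: quat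
    by (simp_all add: quat_eq_iff times_quat_def scaleR_quat_def algebra_simps)
  show "inverse p * p = 1" "p * inverse p = 1" if "p \<noteq> 0"
    using that by (simp_all add: inv sl c)
  show "p div q = p * inverse q"
    by (rule divide_quat_def)
  show "inverse (0 :: quat) = 0"
    by (simp add: inverse_quat_def)
  have "(norm (p * q))\<^sup>2 = (norm p * norm q)\<^sup>2"
    by (simp add: norm2 power_mult_distrib)
       (simp add: times_quat_def power2_eq_square algebra_simps)
  then show "norm (p * q) = norm p * norm q"
    by (rule power2_eq_imp_eq) simp_all
qed

end

definition qcnj :: "quat \<Rightarrow> quat" where
  "qcnj q = Quat (qRe q) (- qI q) (- qJ q) (- qK q)"

definition imag_units :: "quat set"  (\<open>\<S>\<close>) where
  "\<S> = {I. I\<^sup>2 = -1}"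

definition qclass :: "quat \<Rightarrow> quat set" where
  "qclass q = {of_real (qRe q) + I * of_real (norm (q - of_real (qRe q))) | I. I \<in> \<S>}"

definition axially_symmetric :: "quat set \<Rightarrow> bool" where
  "axially_symmetric U \<longleftrightarrow> (\<forall>x\<in>U. qclass x \<subseteq> U)"

text \<open>The slice \<open>\<complex>\<^sub>I = \<real> + I\<real>\<close> is identified with \<^typ>\<open>complex\<close> through the isometric isomorphism
  \<open>x + \<i>y \<mapsto> x + I y\<close>; \<open>slice I U\<close> is \<open>U \<inter> \<complex>\<^sub>I\<close> under this identification, so that topological
  notions relative to \<open>\<complex>\<^sub>I\<close> and the orientation of \<open>\<complex>\<^sub>I\<close> given by \<open>I\<close> become those of
  \<^typ>\<open>complex\<close>.\<close>

definition slice_emb :: "quat \<Rightarrow> complex \<Rightarrow> quat" where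
  "slice_emb I z = of_real (Re z) + I * of_real (Im z)"

definition slice :: "quat \<Rightarrow> quat set \<Rightarrow> complex set" where
  "slice I U = {z. slice_emb I z \<in> U}"

definition s_domain :: "quat set \<Rightarrow> bool" where
  "s_domain U \<longleftrightarrow> open U \<and> U \<inter> \<real> \<noteq> {} \<and>
     (\<forall>I\<in>\<S>. open (slice I U) \<and> connected (slice I U) \<and> slice I U \<noteq> {})"


section \<open>Right quaternionic Hilbert spaces\<close>

text \<open>The real Banach space structure of the class is the one induced by the quaternionic
  structure: \<open>scaleQ_of_real\<close> and \<open>norm_eq_sqrt_qinner\<close> tie real scalars and norm to it, and
  completeness is part of \<^class>\<open>banach\<close>.\<close>

class quat_hilbert = banach +
  fixes scaleQ :: "'a \<Rightarrow> quat \<Rightarrow> 'a"  (infixl \<open>*\<^sub>Q\<close> 75)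
    and qinner :: "'a \<Rightarrow> 'a \<Rightarrow> quat"
  assumes scaleQ_add_left: "(f + g) *\<^sub>Q p = f *\<^sub>Q p + g *\<^sub>Q p"
    and scaleQ_add_right: "f *\<^sub>Q (p + q) = f *\<^sub>Q p + f *\<^sub>Q q"
    and scaleQ_scaleQ: "f *\<^sub>Q p *\<^sub>Q q = f *\<^sub>Q (p * q)"
    and scaleQ_one: "f *\<^sub>Q 1 = f"
    and scaleQ_of_real: "f *\<^sub>Q of_real r = r *\<^sub>R f"
    and qinner_right: "qinner f (g *\<^sub>Q q + h) = qinner f g * q + qinner f h"
    and qinner_cnj: "qinner f g = qcnj (qinner g f)"
    and qinner_nonneg: "qinner f f \<in> \<real> \<and> 0 \<le> qRe (qinner f f)"
    and qinner_eq_zero: "qinner f f = 0 \<Longrightarrow> f = 0"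
    and norm_eq_sqrt_qinner: "norm f = sqrt (qRe (qinner f f))"

definition qspan :: "'v::quat_hilbert set \<Rightarrow> 'v set" where
  "qspan B = {(\<Sum>b\<in>F. b *\<^sub>Q c b) | F c. finite F \<and> F \<subseteq> B}"

definition qsubspace :: "'v::quat_hilbert set \<Rightarrow> bool" where
  "qsubspace W \<longleftrightarrow> 0 \<in> W \<and> (\<forall>v\<in>W. \<forall>w\<in>W. v + w \<in> W) \<and> (\<forall>v\<in>W. \<forall>q. v *\<^sub>Q q \<in> W)"

definition qfinite_dim :: "'v::quat_hilbert set \<Rightarrow> bool" where
  "qfinite_dim W \<longleftrightarrow> (\<exists>B. finite B \<and> W = qspan B)"

definition hilbert_basis :: "'v::quat_hilbert set \<Rightarrow> bool" where
  "hilbert_basis N \<longleftrightarrow>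
     (\<forall>f\<in>N. \<forall>g\<in>N. qinner f g = (if f = g then 1 else 0)) \<and> closure (qspan N) = UNIV"


section \<open>Operators and S-spectrum\<close>

text \<open>\<open>\<B>(V)\<close> is the subset \<open>{T. qlinear T}\<close> of the real Banach space \<open>'v \<Rightarrow>\<^sub>L 'v\<close>.\<close>

definition qlinear :: "('v::quat_hilbert \<Rightarrow>\<^sub>L 'v) \<Rightarrow> bool" where
  "qlinear T \<longleftrightarrow> (\<forall>v q. T (v *\<^sub>Q q) = T v *\<^sub>Q q)"

definition qbounded_on :: "'v::quat_hilbert set \<Rightarrow> ('v \<Rightarrow> 'v) \<Rightarrow> bool" where
  "qbounded_on W A \<longleftrightarrow> A ` W \<subseteq> W \<and> (\<forall>v\<in>W. \<forall>w\<in>W. A (v + w) = A v + A w) \<and>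
     (\<forall>v\<in>W. \<forall>q. A (v *\<^sub>Q q) = A v *\<^sub>Q q) \<and> (\<exists>K. \<forall>v\<in>W. norm (A v) \<le> K * norm v)"

definition Qop :: "quat \<Rightarrow> ('v::quat_hilbert \<Rightarrow>\<^sub>L 'v) \<Rightarrow> ('v \<Rightarrow>\<^sub>L 'v)" where
  "Qop q T = (T o\<^sub>L T) - (2 * qRe q) *\<^sub>R T + (norm q)\<^sup>2 *\<^sub>R id_blinfun"

text \<open>\<open>S_resolvent_on W T\<close> is \<open>\<rho>\<^sub>S(T|\<^sub>W)\<close> for a closed \<open>T\<close>-invariant subspace \<open>W\<close>.\<close>

definition S_resolvent_on :: "'v::quat_hilbert set \<Rightarrow> ('v \<Rightarrow>\<^sub>L 'v) \<Rightarrow> quat set" where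
  "S_resolvent_on W T = {q.
     {v \<in> W. Qop q T v = 0} = {0} \<and> W \<subseteq> closure (Qop q T ` W) \<and>
     (\<exists>R. qbounded_on W R \<and> (\<forall>v\<in>W. R (Qop q T v) = v \<and> Qop q T (R v) = v))}"

definition S_spectrum_on :: "'v::quat_hilbert set \<Rightarrow> ('v \<Rightarrow>\<^sub>L 'v) \<Rightarrow> quat set" where
  "S_spectrum_on W T = - S_resolvent_on W T"

abbreviation S_resolvent :: "('v::quat_hilbert \<Rightarrow>\<^sub>L 'v) \<Rightarrow> quat set"  (\<open>\<rho>\<^sub>S\<close>) where
  "\<rho>\<^sub>S T \<equiv> S_resolvent_on UNIV T"

abbreviation S_spectrum :: "('v::quat_hilbert \<Rightarrow>\<^sub>L 'v) \<Rightarrow> quat set"  (\<open>\<sigma>\<^sub>S\<close>) where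
  "\<sigma>\<^sub>S T \<equiv> S_spectrum_on UNIV T"

definition point_S_spectrum :: "('v::quat_hilbert \<Rightarrow>\<^sub>L 'v) \<Rightarrow> quat set"  (\<open>\<sigma>\<^sub>p\<^sub>S\<close>) where
  "\<sigma>\<^sub>p\<^sub>S T = {q. {v. Qop q T v = 0} \<noteq> {0}}"

definition spectrum_representatives :: "('v::quat_hilbert \<Rightarrow>\<^sub>L 'v) \<Rightarrow> quat set \<Rightarrow> bool" where
  "spectrum_representatives T E \<longleftrightarrow> E \<subseteq> \<sigma>\<^sub>S T \<and> (\<forall>p\<in>\<sigma>\<^sub>S T. \<exists>!e. e \<in> E \<and> e \<in> qclass p)"

definition isolated_part :: "('v::quat_hilbert \<Rightarrow>\<^sub>L 'v) \<Rightarrow> quat set \<Rightarrow> bool" where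
  "isolated_part T \<sigma> \<longleftrightarrow> \<sigma> \<subseteq> \<sigma>\<^sub>S T \<and> closedin (top_of_set (\<sigma>\<^sub>S T)) \<sigma> \<and>
     closedin (top_of_set (\<sigma>\<^sub>S T)) (\<sigma>\<^sub>S T - \<sigma>)"

definition finite_type_eigenvalue :: "('v::quat_hilbert \<Rightarrow>\<^sub>L 'v) \<Rightarrow> quat \<Rightarrow> bool" where
  "finite_type_eigenvalue T q \<longleftrightarrow> q \<in> \<sigma>\<^sub>S T \<and>
     (\<exists>V1 V2. qsubspace V1 \<and> closed V1 \<and> T ` V1 \<subseteq> V1 \<and>
        qsubspace V2 \<and> closed V2 \<and> T ` V2 \<subseteq> V2 \<and>
        V1 \<inter> V2 = {0} \<and> {v + w | v w. v \<in> V1 \<and> w \<in> V2} = UNIV \<and>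
        qfinite_dim V1 \<and> S_spectrum_on V1 T \<inter> S_spectrum_on V2 T = {} \<and>
        S_spectrum_on V1 T = qclass q)"


section \<open>Riesz projections\<close>

text \<open>Left multiplication \<open>f \<mapsto> q f\<close> induced by a Hilbert basis \<open>N\<close>. The two-sided module
  structure of \<open>\<B>(V)\<close> is then \<open>q T = lmult N q o\<^sub>L T\<close> and \<open>T q = T o\<^sub>L lmult N q\<close>.\<close>

definition lmult :: "'v::quat_hilbert set \<Rightarrow> quat \<Rightarrow> ('v \<Rightarrow>\<^sub>L 'v)" where
  "lmult N q = Blinfun (\<lambda>f. \<Sum>\<^sub>\<infinity>g\<in>N. g *\<^sub>Q (q * qinner g f))"

definition blinfun_inv :: "('v::real_normed_vector \<Rightarrow>\<^sub>L 'v) \<Rightarrow> ('v \<Rightarrow>\<^sub>L 'v)" where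
  "blinfun_inv A = (THE B. B o\<^sub>L A = id_blinfun \<and> A o\<^sub>L B = id_blinfun)"

definition SL_resolvent_op ::
  "'v::quat_hilbert set \<Rightarrow> ('v \<Rightarrow>\<^sub>L 'v) \<Rightarrow> quat \<Rightarrow> ('v \<Rightarrow>\<^sub>L 'v)" where
  "SL_resolvent_op N T q =
     - (blinfun_inv (Qop q T) o\<^sub>L (T - (lmult N (qcnj q) o\<^sub>L id_blinfun)))"

text \<open>\<open>SL_path_integral N T I \<gamma>\<close> is the integral of \<open>S\<^sub>L\<^sup>-\<^sup>1(q,T) dq\<^sub>I\<close> with \<open>dq\<^sub>I = - dq I\<close> along the
  path \<open>q = slice_emb I \<circ> \<gamma>\<close>, taken in the operator norm.\<close>

definition SL_path_integral ::
  "'v::quat_hilbert set \<Rightarrow> ('v \<Rightarrow>\<^sub>L 'v) \<Rightarrow> quat \<Rightarrow> (real \<Rightarrow> complex) \<Rightarrow> ('v \<Rightarrow>\<^sub>L 'v)" where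
  "SL_path_integral N T I \<gamma> = integral {0..1} (\<lambda>t.
     SL_resolvent_op N T (slice_emb I (\<gamma> t)) o\<^sub>L
     lmult N (- slice_emb I (vector_derivative \<gamma> (at t within {0..1})) * I))"

text \<open>The boundary of \<open>D\<close> consists of finitely many disjoint piecewise \<open>C\<^sup>1\<close> Jordan curves
  \<open>\<gamma>s\<close>, positively oriented with respect to \<open>D\<close>: in total they wind once around the points of \<open>D\<close>
  and zero times around the points off the closure of \<open>D\<close>. In particular \<open>D\<close> is bounded.\<close>

definition boundary_curves :: "complex set \<Rightarrow> (real \<Rightarrow> complex) list \<Rightarrow> bool" where
  "boundary_curves D \<gamma>s \<longleftrightarrow>
     (\<forall>\<gamma>\<in>set \<gamma>s. valid_path \<gamma> \<and> simple_path \<gamma> \<and> pathfinish \<gamma> = pathstart \<gamma>) \<and>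
     disjoint_family_on (\<lambda>i. path_image (\<gamma>s ! i)) {..<length \<gamma>s} \<and>
     (\<Union>\<gamma>\<in>set \<gamma>s. path_image \<gamma>) = frontier D \<and>
     (\<forall>z\<in>D. (\<Sum>\<gamma>\<leftarrow>\<gamma>s. winding_number \<gamma> z) = 1) \<and>
     (\<forall>z. z \<notin> closure D \<longrightarrow> (\<Sum>\<gamma>\<leftarrow>\<gamma>s. winding_number \<gamma> z) = 0)"

definition riesz_domain :: "('v::quat_hilbert \<Rightarrow>\<^sub>L 'v) \<Rightarrow> quat set \<Rightarrow> quat set \<Rightarrow> bool" where
  "riesz_domain T \<sigma> U \<longleftrightarrow> axially_symmetric U \<and> s_domain U \<and> U \<inter> \<sigma>\<^sub>S T = \<sigma> \<and>
     (\<forall>I\<in>\<S>. (\<exists>\<gamma>s. boundary_curves (slice I U) \<gamma>s) \<and>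
        slice_emb I ` frontier (slice I U) \<subseteq> \<rho>\<^sub>S T)"

text \<open>\<open>riesz_projection N T \<sigma> P\<close>: the Riesz projection associated with \<open>\<sigma>\<close> is defined, and equals
  \<open>P\<close>. A relation is used because an isolated part need not have any neighbourhood \<open>U\<close> of the
  required kind: such a \<open>U\<close> meets the real axis, and the rest of the spectrum may separate
  \<open>\<sigma>\<close> from it.\<close>

definition riesz_projection ::
  "'v::quat_hilbert set \<Rightarrow> ('v \<Rightarrow>\<^sub>L 'v) \<Rightarrow> quat set \<Rightarrow> ('v \<Rightarrow>\<^sub>L 'v) \<Rightarrow> bool" where
  "riesz_projection N T \<sigma> P \<longleftrightarrow> axially_symmetric \<sigma> \<and> isolated_part T \<sigma> \<and>
     (\<exists>U. riesz_domain T \<sigma> U \<and> (\<exists>I\<in>\<S>. \<exists>\<gamma>s. boundary_curves (slice I U) \<gamma>s \<and>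
        P = (1 / (2 * pi)) *\<^sub>R (\<Sum>\<gamma>\<leftarrow>\<gamma>s. SL_path_integral N T I \<gamma>)))"

end

theory Submission
  imports Defs
begin

text \<open>Right multiplication by \<open>\<complex>\<^sub>i\<close> makes \<open>V\<close> a complex space on which \<open>T\<close> acts linearly, and
  \<open>Q\<^sub>z(T) = (z - T)(cnj z - T)\<close>, so the \<open>S\<close>-spectrum becomes the ordinary spectrum together with its
  mirror image. Splitting the \<open>S\<close>-resolvent integrand into the real and imaginary parts of \<open>(z - T)\<^sup>-\<^sup>1 dz\<close>
  gives \<open>2\<pi>P = B - A I\<close> with \<open>A + B i = \<integral> (z - T)\<^sup>-\<^sup>1 dz\<close>; right multiplication by \<open>j\<close> turns this integral
  into the one over the conjugate curves, so \<open>A = 0\<close>, and \<open>P\<close> is the classical Riesz projection of the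
  pair \<open>z, cnj z\<close> representing \<open>[q]\<close>. By the residue theorem every complex functional \<open>\<Psi>\<close> then satisfies
  \<open>\<Psi>(P v) = \<Sum> Res \<Psi>((z - T)\<^sup>-\<^sup>1 v)\<close> over this pair.

  If \<open>V = V\<^sub>1 \<oplus> V\<^sub>2\<close> exhibits \<open>q\<close> as an eigenvalue of finite type, the resolvent stays bounded on \<open>V\<^sub>2\<close> near
  the pair, so \<open>P\<close> kills \<open>V\<^sub>2\<close> and its range is the image of \<open>V\<^sub>1\<close>. Conversely,
  \<open>(w - T)\<^sup>-\<^sup>1(v - P v)\<close> is the resolvent without its principal part and hence bounded near the pair;
  this makes \<open>P\<close> idempotent and \<open>q\<close> a regular point of \<open>T\<close> on the kernel of \<open>P\<close>, while an eigenvector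
  in the finite-dimensional range of \<open>P\<close> can only belong to \<open>[q]\<close>.\<close>

section \<open>Quaternionic Hilbert spaces\<close>

text \<open>Three scalar structures meet in the integrand of P and do not fit together: T is linear
  over the right quaternions, \<open>(z - T)^-1\<close> only over the right action of C_i, and the
  S-resolvent also carries the left action induced by N, which need not commute with T. The left
  action enters P only through the term A I, so once A = 0 the choices of N and I drop out, and
  right linearity of P can be read off from what is left. Operator identities are tested against
  complex functionals instead of being derived in an operator-valued contour calculus: the inner
  product supplies enough functionals to separate points and recover norms, and the scalar residue
  theorem does the rest. Accordingly, idempotence does not come from multiplying integrals over
  nested curves: boundedness of \<open>(w - T)^-1 (v - P v)\<close> makes all residues vanish,
  whence P (v - P v) = 0. The same bound, uniform in w, allows invertibility on the kernel of P to
  be carried from nearby points w to the spectral point itself.\<close>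

lemma of_real_quat: "of_real r = Quat r 0 0 0"
  by (simp add: of_real_def one_quat_def scaleR_quat_def)

lemma norm_quat_sq: "(norm q)\<^sup>2 = (qRe q)\<^sup>2 + (qI q)\<^sup>2 + (qJ q)\<^sup>2 + (qK q)\<^sup>2"
  by (simp add: norm_quat_def)

lemma qcnj_mult: "qcnj (p * q) = qcnj q * qcnj p"
  by (simp add: qcnj_def times_quat_def algebra_simps)

lemma qcnj_mult_self: "qcnj q * q = of_real ((norm q)\<^sup>2)"
  unfolding norm_quat_sq
  by (simp add: qcnj_def times_quat_def of_real_quat power2_eq_square algebra_simps)

lemma imag_unit:
  assumes "I \<in> \<S>"
  shows "qRe I = 0" "norm I = 1" "I * I = -1"
proof -
  have I: "I * I = -1"
    using assms by (simp add: imag_units_def power2_eq_square)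
  then show "I * I = -1" .
  have e: "qRe I * qRe I - qI I * qI I - qJ I * qJ I - qK I * qK I = -1"
    "qRe I * qI I = 0" "qRe I * qJ I = 0" "qRe I * qK I = 0"
    using I by (auto simp: times_quat_def one_quat_def uminus_quat_def)
  show 0: "qRe I = 0"
  proof (rule ccontr)
    assume "qRe I \<noteq> 0"
    \<comment> \<open>The mixed components of I * I are multiples of \<open>qRe I\<close>, so a
      nonzero real part kills the imaginary part and leaves a real square root of -1.\<close>
    then have "(qRe I)\<^sup>2 = -1"
      using e by (simp add: power2_eq_square)
    then show False
      using zero_le_power2[of "qRe I"] by linarith
  qed
  have "(norm I)\<^sup>2 = 1"
    using e(1) 0 unfolding norm_quat_sq by (simp add: power2_eq_square)
  then show "norm I = 1"
    by (simp add: power2_eq_1_iff) (use norm_ge_zero[of I] in linarith)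
qed

section \<open>The slice C_i and the classes [q]\<close>

definition emb :: "complex \<Rightarrow> quat" where
  "emb z = Quat (Re z) (Im z) 0 0"

lemma emb_simps: "emb (z + w) = emb z + emb w" "emb (z - w) = emb z - emb w" "emb (- z) = - emb z"
  "emb (z * w) = emb z * emb w" "emb 0 = 0" "emb 1 = 1" "emb (of_real r) = of_real r"
  "emb (r *\<^sub>R z) = r *\<^sub>R emb z" "qRe (emb z) = Re z"
  by (simp_all add: emb_def plus_quat_def minus_quat_def uminus_quat_def times_quat_def zero_quat_def
      one_quat_def of_real_quat scaleR_quat_def algebra_simps)

lemma norm_emb [simp]: "norm (emb z) = norm z"
  by (simp add: emb_def norm_quat_def cmod_def)

lemma emb_cnj_mult: "emb (cnj z) * emb z = of_real ((norm z)\<^sup>2)"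
  by (metis complex_norm_square emb_simps(4,7) mult.commute)

lemma slice_emb_simps:
  assumes "I \<in> \<S>"
  shows "qRe (slice_emb I z) = Re z" "norm (slice_emb I z) = norm z"
    "norm (slice_emb I z - of_real (Re z)) = \<bar>Im z\<bar>"
proof -
  have c: "slice_emb I z = Quat (Re z) (Im z * qI I) (Im z * qJ I) (Im z * qK I)"
    using imag_unit(1)[OF assms]
    by (simp add: slice_emb_def of_real_quat times_quat_def plus_quat_def algebra_simps)
  then show "qRe (slice_emb I z) = Re z" by simp
  have s: "(qI I)\<^sup>2 + (qJ I)\<^sup>2 + (qK I)\<^sup>2 = 1"
    using imag_unit[OF assms] norm_quat_sq[of I] by simp
  have "(norm (slice_emb I z))\<^sup>2 = (Re z)\<^sup>2 + (Im z)\<^sup>2 * ((qI I)\<^sup>2 + (qJ I)\<^sup>2 + (qK I)\<^sup>2)"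
    unfolding norm_quat_sq c by (simp add: power_mult_distrib algebra_simps)
  then have "(norm (slice_emb I z))\<^sup>2 = (norm z)\<^sup>2"
    by (simp add: s cmod_power2)
  then show "norm (slice_emb I z) = norm z"
    by (rule power2_eq_imp_eq) simp_all
  show "norm (slice_emb I z - of_real (Re z)) = \<bar>Im z\<bar>"
    by (simp add: slice_emb_def norm_mult imag_unit[OF assms])
qed

lemma imag_units_i: "Quat 0 1 0 0 \<in> \<S>"
  by (simp add: imag_units_def power2_eq_square times_quat_def one_quat_def uminus_quat_def)

lemma slice_emb_i: "slice_emb (Quat 0 1 0 0) = emb"
  by (auto simp: slice_emb_def emb_def of_real_quat times_quat_def plus_quat_def)

text \<open>Real part and norm together determine the size of the imaginary part, and its direction
  is free. These are also the only data of q that \<open>Qop\<close> sees, which makes this the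
  working form of the class.\<close>

lemma qclass_iff:
  "p \<in> qclass q \<longleftrightarrow> qRe p = qRe q \<and> norm p = norm q"
proof -
  define a where "a = qRe q"
  define r where "r = norm (q - of_real a)"
  have n2: "(norm p)\<^sup>2 = (qRe p)\<^sup>2 + (norm (p - of_real (qRe p)))\<^sup>2" for p :: quat
    unfolding norm_quat_sq by (simp add: minus_quat_def of_real_quat)
  show ?thesis
  proof
    assume "p \<in> qclass q"
    then obtain I where I: "I \<in> \<S>" and p: "p = of_real a + I * of_real r"
      by (auto simp: qclass_def a_def r_def)
    have "p = slice_emb I (Complex a r)"
      by (simp add: p slice_emb_def)
    then have "qRe p = a" "norm p = norm (Complex a r)"
      using slice_emb_simps[OF I] by simp_all
    moreover have "norm (Complex a r) = norm q"
      by (rule power2_eq_imp_eq) (simp_all add: cmod_power2 n2[of q] a_def r_def)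
    ultimately show "qRe p = qRe q \<and> norm p = norm q"
      by (simp add: a_def)
  next
    assume pq: "qRe p = qRe q \<and> norm p = norm q"
    then have "(norm (p - of_real a))\<^sup>2 = r\<^sup>2"
      using n2[of p] n2[of q] by (simp add: a_def r_def)
    then have pr: "norm (p - of_real a) = r"
      by (rule power2_eq_imp_eq) (simp_all add: r_def)
    \<comment> \<open>For r = 0 the class is one real point and any unit serves; otherwise I is the
      normalised imaginary part of p.\<close>
    show "p \<in> qclass q"
    proof (cases "r = 0")
      case True
      then have "p = of_real a" using pr by simp
      then show ?thesis
        using imag_units_i True unfolding qclass_def a_def r_def by auto
    next
      case False
      define I where "I = (1 / r) *\<^sub>R (p - of_real a)"
      have "qRe I = 0"
        using pq by (simp add: I_def scaleR_quat_def minus_quat_def of_real_quat a_def)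
      moreover have "norm I = 1"
        using False pr by (simp add: I_def r_def)
      then have "(norm I)\<^sup>2 = 1" by simp
      ultimately have "I \<in> \<S>"
        unfolding norm_quat_sq
        by (simp add: imag_units_def power2_eq_square times_quat_def one_quat_def uminus_quat_def)
      moreover have "p = of_real a + I * of_real r"
        using False by (simp add: I_def of_real_def)
      ultimately show ?thesis
        unfolding qclass_def a_def r_def by auto
    qed
  qed
qed

lemma qclass_self: "q \<in> qclass q"
  by (simp add: qclass_iff)

lemma Qop_cong: "p \<in> qclass q \<Longrightarrow> Qop p = Qop q"
  by (auto simp: qclass_iff Qop_def fun_eq_iff)

lemma Qop_slice_emb: "I \<in> \<S> \<Longrightarrow> Qop (slice_emb I z) = Qop (emb z)"
  by (rule Qop_cong) (simp add: qclass_iff slice_emb_simps emb_simps)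

lemma S_resolvent_on_cong: "p \<in> qclass q \<Longrightarrow> p \<in> S_resolvent_on W T \<longleftrightarrow> q \<in> S_resolvent_on W T"
  by (simp add: S_resolvent_on_def Qop_cong)

section \<open>Inner product, norm and the Cauchy-Schwarz inequality\<close>

lemma qinner_0_right [simp]: "qinner (f::'v::quat_hilbert) 0 = 0"
  using qinner_right[of f 0 1 0] by (simp add: scaleQ_one)

lemma qinner_add_right: "qinner (f::'v::quat_hilbert) (g + h) = qinner f g + qinner f h"
  using qinner_right[of f g 1 h] by (simp add: scaleQ_one)

lemma qinner_scale_right: "qinner (f::'v::quat_hilbert) (g *\<^sub>Q q) = qinner f g * q"
  using qinner_right[of f g q 0] by simp

lemma qcnj_add: "qcnj (p + q) = qcnj p + qcnj q"
  by (simp add: qcnj_def plus_quat_def)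

lemma qinner_add_left: "qinner (f + g) (h::'v::quat_hilbert) = qinner f h + qinner g h"
  by (metis qinner_cnj qinner_add_right qcnj_add)

lemma qinner_scale_left: "qinner (f *\<^sub>Q q) (h::'v::quat_hilbert) = qcnj q * qinner f h"
  by (metis qinner_cnj qinner_scale_right qcnj_mult)

lemma qinner_self: "qinner f f = of_real ((norm (f::'v::quat_hilbert))\<^sup>2)"
proof -
  have "qinner f f = of_real (qRe (qinner f f))"
    using qinner_nonneg[of f] by (auto simp: Reals_def of_real_quat)
  then show ?thesis
    using qinner_nonneg[of f] by (simp add: norm_eq_sqrt_qinner)
qed

lemma norm_scaleQ: "norm (f *\<^sub>Q q) = norm (f::'v::quat_hilbert) * norm q"
proof -
  have "qinner (f *\<^sub>Q q) (f *\<^sub>Q q) = qcnj q * ((norm f)\<^sup>2 *\<^sub>R q)"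
    unfolding qinner_scale_left qinner_scale_right by (simp add: qinner_self scaleR_conv_of_real mult.assoc)
  also have "\<dots> = of_real ((norm f)\<^sup>2 * (norm q)\<^sup>2)"
    by (simp add: qcnj_mult_self of_real_def)
  finally have "of_real ((norm (f *\<^sub>Q q))\<^sup>2) = (of_real ((norm f)\<^sup>2 * (norm q)\<^sup>2) :: quat)"
    by (simp only: qinner_self)
  then have "(norm (f *\<^sub>Q q))\<^sup>2 = (norm f * norm q)\<^sup>2"
    by (simp only: of_real_eq_iff power_mult_distrib)
  then show ?thesis
    by (rule power2_eq_imp_eq) simp_all
qed

lemma bounded_bilinear_scaleQ: "bounded_bilinear (scaleQ :: 'v::quat_hilbert \<Rightarrow> quat \<Rightarrow> 'v)"
proof
  fix a a' :: 'v and b b' :: quat and r :: real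
  show "(a + a') *\<^sub>Q b = a *\<^sub>Q b + a' *\<^sub>Q b" by (rule scaleQ_add_left)
  show "a *\<^sub>Q (b + b') = a *\<^sub>Q b + a *\<^sub>Q b'" by (rule scaleQ_add_right)
  have c: "of_real r * b = b * of_real r"
    by (simp add: of_real_def)
  show "(r *\<^sub>R a) *\<^sub>Q b = r *\<^sub>R (a *\<^sub>Q b)"
    by (simp add: scaleQ_scaleQ c flip: scaleQ_of_real)
  show "a *\<^sub>Q (r *\<^sub>R b) = r *\<^sub>R (a *\<^sub>Q b)"
    by (simp add: scaleR_conv_of_real c scaleQ_scaleQ flip: scaleQ_of_real)
  show "\<exists>K. \<forall>(a::'v) b. norm (a *\<^sub>Q b) \<le> norm a * norm b * K"
    by (rule exI[of _ 1]) (simp add: norm_scaleQ)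
qed

lemmas scaleQ_simps =
  bounded_bilinear.zero_left[OF bounded_bilinear_scaleQ] bounded_bilinear.zero_right[OF bounded_bilinear_scaleQ]
  bounded_bilinear.minus_left[OF bounded_bilinear_scaleQ] bounded_bilinear.minus_right[OF bounded_bilinear_scaleQ]
  bounded_bilinear.diff_left[OF bounded_bilinear_scaleQ] bounded_bilinear.diff_right[OF bounded_bilinear_scaleQ]
  bounded_bilinear.scaleR_left[OF bounded_bilinear_scaleQ] bounded_bilinear.scaleR_right[OF bounded_bilinear_scaleQ]
  scaleQ_add_left scaleQ_add_right scaleQ_scaleQ scaleQ_one scaleQ_of_real

lemma norm_add_sq:
  "(norm (f + g))\<^sup>2 = (norm f)\<^sup>2 + 2 * qRe (qinner f g) + (norm (g::'v::quat_hilbert))\<^sup>2"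
proof -
  have "qRe (qinner g f) = qRe (qinner f g)"
    by (subst qinner_cnj) (simp add: qcnj_def)
  then show ?thesis
    using arg_cong[OF qinner_self, of qRe "f + g"] arg_cong[OF qinner_self, of qRe f]
      arg_cong[OF qinner_self, of qRe g]
    by (simp add: qinner_add_left qinner_add_right plus_quat_def of_real_quat)
qed

text \<open>Polarization turns the triangle inequality into the Cauchy-Schwarz inequality.\<close>

lemma qRe_qinner_le: "qRe (qinner f g) \<le> norm f * norm (g::'v::quat_hilbert)"
proof -
  have "(norm (f + g))\<^sup>2 \<le> (norm f + norm g)\<^sup>2"
    by (intro power_mono norm_triangle_ineq norm_ge_zero)
  then show ?thesis
    by (simp add: power2_sum norm_add_sq)
qed

text \<open>Scaling g on the right by the conjugate of s = <f,g> makes the inner product real and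
  equal to the squared norm of s, so the bound on real parts gives the full inequality.\<close>

lemma norm_qinner_le: "norm (qinner f g) \<le> norm f * norm (g::'v::quat_hilbert)"
proof (cases "qinner f g = 0")
  case False
  define s where "s = qinner f g"
  have "s * qcnj s = of_real ((norm s)\<^sup>2)"
    unfolding norm_quat_sq
    by (simp add: qcnj_def times_quat_def of_real_quat power2_eq_square algebra_simps)
  then have "qRe (qinner f (g *\<^sub>Q qcnj s)) = (norm s)\<^sup>2"
    by (simp add: qinner_scale_right s_def of_real_quat)
  moreover have "norm (g *\<^sub>Q qcnj s) = norm g * norm s"
    by (simp add: norm_scaleQ qcnj_def norm_quat_def)
  ultimately have "norm s * norm s \<le> norm f * norm g * norm s"
    using qRe_qinner_le[of f "g *\<^sub>Q qcnj s"] by (simp add: power2_eq_square mult.assoc)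
  then show ?thesis
    using False by (simp add: s_def)
qed simp

lemma quat_zero_sel [simp]: "qRe 0 = 0" "qI 0 = 0" "qJ 0 = 0" "qK 0 = 0"
  by (simp_all add: zero_quat_def)

lemma qcnj_zero [simp]: "qcnj 0 = 0"
  by (simp add: qcnj_def zero_quat_def)

lemma qinner_sum_right: "qinner (f::'v::quat_hilbert) (sum h F) = (\<Sum>g\<in>F. qinner f (h g))"
  by (induction F rule: infinite_finite_induct) (simp_all add: qinner_add_right)

lemma bounded_linear_qinner: "bounded_linear (qinner (f::'v::quat_hilbert))"
proof (rule bounded_linear_intro)
  show "qinner f (r *\<^sub>R g) = r *\<^sub>R qinner f g" for r g
    by (simp add: qinner_scale_right of_real_def flip: scaleQ_of_real)
  show "norm (qinner f g) \<le> norm g * norm f" for g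
    using norm_qinner_le[of f g] by (simp add: mult.commute)
qed (rule qinner_add_right)

section \<open>Complex functionals on V\<close>

definition rmul :: "quat \<Rightarrow> ('v::quat_hilbert \<Rightarrow>\<^sub>L 'v)" where
  "rmul q = Blinfun (\<lambda>v. v *\<^sub>Q q)"

lemma rmul_apply [simp]: "blinfun_apply (rmul q) v = v *\<^sub>Q q"
  unfolding rmul_def
  by (simp add: bounded_linear_Blinfun_apply bounded_bilinear.bounded_linear_left[OF bounded_bilinear_scaleQ])

text \<open>The C_i component of \<open>qinner u x\<close>. Projecting a quaternion to this
  component respects right multiplication by C_i, so the result is complex linear in x.\<close>

definition cin :: "'v::quat_hilbert \<Rightarrow> 'v \<Rightarrow> complex" where
  "cin u x = Complex (qRe (qinner u x)) (qI (qinner u x))"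

text \<open>\<open>clin \<Psi>\<close>: \<open>\<Psi>\<close> is a bounded functional on \<open>V\<close>, regarded as a complex space through right
  multiplication by \<open>\<complex>\<^sub>i\<close>.\<close>

definition clin :: "('v::quat_hilbert \<Rightarrow> complex) \<Rightarrow> bool" where
  "clin \<Psi> \<longleftrightarrow> bounded_linear \<Psi> \<and> (\<forall>x z. \<Psi> (x *\<^sub>Q emb z) = \<Psi> x * z)"

lemma norm_cin_le: "norm (cin u x) \<le> norm u * norm x"
proof -
  have "(norm (cin u x))\<^sup>2 \<le> (norm (qinner u x))\<^sup>2"
    unfolding norm_quat_sq by (simp add: cin_def cmod_power2)
  then have "norm (cin u x) \<le> norm (qinner u x)"
    by (rule power2_le_imp_le) simp
  then show ?thesis
    using norm_qinner_le[of u x] by simp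
qed

lemma clin_cin: "clin (cin u)"
  unfolding clin_def
proof safe
  show "bounded_linear (cin u)"
  proof (rule bounded_linear_intro)
    show "cin u (x + y) = cin u x + cin u y" for x y
      by (simp add: cin_def qinner_add_right plus_quat_def complex_eq_iff)
    show "cin u (r *\<^sub>R x) = r *\<^sub>R cin u x" for r x
      by (simp add: cin_def linear_simps(5)[OF bounded_linear_qinner] scaleR_quat_def complex_eq_iff)
    show "norm (cin u x) \<le> norm x * norm u" for x
      using norm_cin_le[of u x] by (simp add: mult.commute)
  qed
  show "cin u (x *\<^sub>Q emb z) = cin u x * z" for x z
    by (simp add: cin_def qinner_scale_right emb_def times_quat_def complex_eq_iff)
qed

lemma cin_self: "cin u u = of_real ((norm u)\<^sup>2)"
  by (simp only: cin_def qinner_self) (simp add: of_real_quat complex_eq_iff flip: of_real_power)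

text \<open>These functionals separate points: test with u = x - y.\<close>

lemma eq_if_cin_eq:
  assumes "\<And>u. cin u x = cin u y"
  shows "x = y"
proof -
  interpret bounded_linear "cin (x - y)"
    using clin_cin[of "x - y"] by (simp add: clin_def)
  have "cin (x - y) (x - y) = 0"
    using assms by (simp add: diff)
  then show ?thesis
    by (simp add: cin_self)
qed

text \<open>Testing with u = x recovers the norm; estimates of scalar holomorphic functions become
  estimates of vectors in this way.\<close>

lemma norm_le_if_cin_le:
  assumes "\<And>u. norm (cin u x) \<le> norm u * M" and "0 \<le> M"
  shows "norm x \<le> M"
proof (cases "x = 0")
  case False
  have "norm x * norm x \<le> norm x * M"
    using assms(1)[of x] by (simp add: cin_self power2_eq_square norm_mult)
  then show ?thesis
    using False by simp
qed (use assms in simp)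

section \<open>Left multiplication induced by a Hilbert basis\<close>

text \<open>The finite partial sums of the series behind \<open>lmult\<close>.\<close>

definition lpart :: "quat \<Rightarrow> 'v::quat_hilbert \<Rightarrow> 'v set \<Rightarrow> 'v" where
  "lpart q f F = (\<Sum>g\<in>F. g *\<^sub>Q (q * qinner g f))"

lemma lpart_diff: "lpart q (f - g) F = lpart q f F - lpart q g F"
  by (simp add: lpart_def linear_simps(2)[OF bounded_linear_qinner] right_diff_distrib scaleQ_simps sum_subtractf)

context
  fixes N :: "'v::quat_hilbert set"
  assumes N: "hilbert_basis N"
begin

lemma hilbert_basis_qinner: "f \<in> N \<Longrightarrow> g \<in> N \<Longrightarrow> qinner f g = (if f = g then 1 else 0)"
  using N by (simp add: hilbert_basis_def)

lemma norm_hilbert_basis: "f \<in> N \<Longrightarrow> norm f = 1"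
  using hilbert_basis_qinner[of f f] by (simp add: norm_eq_sqrt_qinner one_quat_def)

lemma qinner_basis_sum:
  assumes "finite F" "F \<subseteq> N" "h \<in> N"
  shows "qinner h (\<Sum>g\<in>F. g *\<^sub>Q c g) = (if h \<in> F then c h else 0)"
proof -
  have "qinner h (\<Sum>g\<in>F. g *\<^sub>Q c g) = (\<Sum>g\<in>F. if g = h then c h else 0)"
    unfolding qinner_sum_right qinner_scale_right
    by (rule sum.cong) (use assms hilbert_basis_qinner in auto)
  then show ?thesis
    using assms by simp
qed

lemma norm_basis_sum:
  assumes "finite F" "F \<subseteq> N"
  shows "(norm (\<Sum>g\<in>F. g *\<^sub>Q c g))\<^sup>2 = (\<Sum>g\<in>F. (norm (c g))\<^sup>2)"
  using assms
proof (induction F)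
  case (insert h F)
  have "qinner (h *\<^sub>Q c h) (\<Sum>g\<in>F. g *\<^sub>Q c g) = 0"
    using insert qinner_basis_sum[of F h c] by (simp add: qinner_scale_left)
  then show ?case
    using insert by (simp add: norm_add_sq norm_scaleQ norm_hilbert_basis zero_quat_def)
qed simp

text \<open>Bessel's inequality: s is the orthogonal projection of f, so its norm is at most that of
  f, and left multiplication by q scales every coefficient by exactly the norm of q.\<close>

lemma norm_lpart_le:
  assumes "finite F" "F \<subseteq> N"
  shows "norm (lpart q f F) \<le> norm q * norm f"
proof -
  define s where "s = (\<Sum>g\<in>F. g *\<^sub>Q qinner g f)"
  have orth: "qinner (f - s) s = 0"
  proof -
    have "qinner (f - s) (g *\<^sub>Q qinner g f) = 0" if "g \<in> F" for g
    proof -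
      have "qinner g (f - s) = 0"
        using that assms qinner_basis_sum[of F g "\<lambda>g. qinner g f"]
        by (auto simp: s_def linear_simps(2)[OF bounded_linear_qinner])
      then show ?thesis
        by (subst qinner_scale_right, subst qinner_cnj) simp
    qed
    then show ?thesis
      unfolding s_def qinner_sum_right by simp
  qed
  have "(norm f)\<^sup>2 = (norm (f - s))\<^sup>2 + (norm s)\<^sup>2"
    using norm_add_sq[of "f - s" s] orth by (simp add: zero_quat_def)
  then have s: "(norm s)\<^sup>2 \<le> (norm f)\<^sup>2"
    by simp
  have "(norm (lpart q f F))\<^sup>2 = (norm q)\<^sup>2 * (norm s)\<^sup>2"
    unfolding lpart_def s_def norm_basis_sum[OF assms]
    by (simp add: norm_mult power_mult_distrib sum_distrib_left)
  also have "\<dots> \<le> (norm q * norm f)\<^sup>2"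
    using s by (simp add: power_mult_distrib mult_left_mono)
  finally show ?thesis
    by (rule power2_le_imp_le) simp
qed

text \<open>By orthonormality the coefficients of a finite combination vanish off F, so enlarging F
  only adds zero terms.\<close>

lemma lpart_eventually_const:
  assumes "finite F" "F \<subseteq> N" "f = (\<Sum>g\<in>F. g *\<^sub>Q c g)" "finite G" "F \<subseteq> G" "G \<subseteq> N"
  shows "lpart q f G = lpart q f F"
  unfolding lpart_def
  using assms by (intro sum.mono_neutral_right) (auto simp: qinner_basis_sum scaleQ_simps)

lemma lpart_one:
  assumes "finite F" "F \<subseteq> N" "f = (\<Sum>g\<in>F. g *\<^sub>Q c g)"
  shows "lpart 1 f F = f"
proof -
  have "lpart 1 f F = (\<Sum>g\<in>F. g *\<^sub>Q c g)"
    unfolding lpart_def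
    by (intro sum.cong refl)
      (simp add: assms(3) qinner_basis_sum[OF assms(1,2)] subsetD[OF assms(2)])
  then show ?thesis
    using assms by simp
qed

text \<open>On the dense span the series is a finite sum, and Bessel's bound is uniform in the index
  set. Approximants s n of f therefore have a Cauchy sequence of sums t n, whose limit is the sum
  for f. For q = 1 each t n equals s n, which gives the Fourier expansion of f.\<close>

lemma lpart_limit:
  obtains l where "((\<lambda>g. g *\<^sub>Q (q * qinner g f)) has_sum l) N" "norm l \<le> norm q * norm f"
    "q = 1 \<Longrightarrow> l = f"
proof -
  have "f \<in> closure (qspan N)"
    using N by (simp add: hilbert_basis_def)
  then obtain s where s: "\<And>n. s n \<in> qspan N" "s \<longlonglongrightarrow> f"
    unfolding closure_sequential by blast
  then have "\<forall>n. \<exists>F c. finite F \<and> F \<subseteq> N \<and> s n = (\<Sum>g\<in>F. g *\<^sub>Q c g)"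
    unfolding qspan_def by blast
  then have "\<exists>F c. \<forall>n. finite (F n) \<and> F n \<subseteq> N \<and> s n = (\<Sum>g\<in>F n. g *\<^sub>Q c n g)"
    unfolding choice_iff .
  then obtain F c where F: "\<And>n. finite (F n)" "\<And>n. F n \<subseteq> N" "\<And>n. s n = (\<Sum>g\<in>F n. g *\<^sub>Q c n g)"
    by blast
  define t where "t n = lpart q (s n) (F n)" for n
  have tG: "t n = lpart q (s n) G" if "finite G" "F n \<subseteq> G" "G \<subseteq> N" for n G
    unfolding t_def by (rule lpart_eventually_const[symmetric]) (use F that in auto)
  have t_diff: "norm (t m - t n) \<le> norm q * norm (s m - s n)" for m n
  proof -
    have "t m - t n = lpart q (s m - s n) (F m \<union> F n)"
      unfolding lpart_diff by (subst (1 2) tG[of "F m \<union> F n"]) (use F in auto)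
    then show ?thesis
      using norm_lpart_le[of "F m \<union> F n"] F by auto
  qed
  have "Cauchy t"
  proof (rule metric_CauchyI)
    fix e :: real assume "e > 0"
    \<comment> \<open>The summand 1 covers q = 0.\<close>
    then have "e / (norm q + 1) > 0"
      by (simp add: add_nonneg_pos)
    then obtain M where M: "\<And>m n. m \<ge> M \<Longrightarrow> n \<ge> M \<Longrightarrow> norm (s m - s n) < e / (norm q + 1)"
      using LIMSEQ_imp_Cauchy[OF s(2)] by (metis CauchyD)
    have "dist (t m) (t n) < e" if "m \<ge> M" "n \<ge> M" for m n
    proof -
      have "dist (t m) (t n) \<le> (norm q + 1) * norm (s m - s n)"
        using t_diff[of m n] norm_ge_zero[of "s m - s n"] unfolding dist_norm distrib_right by linarith
      also have "\<dots> < e"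
        using M[OF that] by (simp add: pos_less_divide_eq add_nonneg_pos mult.commute)
      finally show ?thesis .
    qed
    then show "\<exists>M. \<forall>m\<ge>M. \<forall>n\<ge>M. dist (t m) (t n) < e" by blast
  qed
  then obtain l where l: "t \<longlonglongrightarrow> l"
    using Cauchy_convergent convergent_def by blast
  have "((\<lambda>g. g *\<^sub>Q (q * qinner g f)) has_sum l) N"
    unfolding has_sum_def
  proof (rule tendstoI)
    fix e :: real assume e: "e > 0"
    have "((\<lambda>n. norm q * norm (f - s n) + norm (t n - l)) \<longlongrightarrow> norm q * norm (f - f) + norm (l - l)) sequentially"
      by (intro tendsto_intros s l)
    then have "eventually (\<lambda>n. norm q * norm (f - s n) + norm (t n - l) < e) sequentially"
      using e by (simp add: order_tendsto_iff)
    then obtain n where n: "norm q * norm (f - s n) + norm (t n - l) < e"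
      using eventually_happens' sequentially_bot by blast
    have "dist (lpart q f G) l < e" if "finite G" "F n \<subseteq> G" "G \<subseteq> N" for G
    proof -
      have "lpart q f G - l = lpart q (f - s n) G + (t n - l)"
        by (simp add: lpart_diff tG[OF that])
      then have "dist (lpart q f G) l \<le> norm (lpart q (f - s n) G) + norm (t n - l)"
        unfolding dist_norm by (simp only: norm_triangle_ineq)
      then show ?thesis
        using n norm_lpart_le[OF that(1,3), of q "f - s n"] by linarith
    qed
    then show "eventually (\<lambda>G. dist (\<Sum>g\<in>G. g *\<^sub>Q (q * qinner g f)) l < e) (finite_subsets_at_top N)"
      unfolding eventually_finite_subsets_at_top lpart_def using F by (intro exI[of _ "F n"]) auto
  qed
  moreover have "norm l \<le> norm q * norm f"
  proof (rule LIMSEQ_le)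
    show "(\<lambda>n. norm (t n)) \<longlonglongrightarrow> norm l" "(\<lambda>n. norm q * norm (s n)) \<longlonglongrightarrow> norm q * norm f"
      by (intro tendsto_intros s l)+
    show "\<exists>n0. \<forall>n\<ge>n0. norm (t n) \<le> norm q * norm (s n)"
      unfolding t_def using norm_lpart_le F by blast
  qed
  moreover have "l = f" if "q = 1"
  proof -
    have "t = s"
      unfolding t_def that by (rule ext, rule lpart_one) (use F in auto)
    then show ?thesis
      using l s(2) LIMSEQ_unique by blast
  qed
  ultimately show ?thesis
    using that by blast
qed

text \<open>\<open>Blinfun\<close> returns the intended map only when the series is bounded and
  linear in f; once this is settled, \<open>lmult\<close> can be handled through its series.\<close>

lemma lmult_has_sum: "((\<lambda>g. g *\<^sub>Q (q * qinner g f)) has_sum lmult N q f) N"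
proof -
  define L where "L f = (\<Sum>\<^sub>\<infinity>g\<in>N. g *\<^sub>Q (q * qinner g f))" for f
  have L: "((\<lambda>g. g *\<^sub>Q (q * qinner g f)) has_sum L f) N" "norm (L f) \<le> norm q * norm f" for f
    unfolding L_def by (metis lpart_limit infsumI)+
  have "bounded_linear L"
  proof (rule bounded_linear_intro)
    fix f h :: 'v and r :: real
    have "((\<lambda>g. g *\<^sub>Q (q * qinner g (f + h))) has_sum (L f + L h)) N"
      using has_sum_add[OF L(1)[of f] L(1)[of h]] by (simp add: qinner_add_right distrib_left scaleQ_simps)
    then show "L (f + h) = L f + L h"
      using L(1) has_sum_unique by blast
    have "((\<lambda>g. g *\<^sub>Q (q * qinner g (r *\<^sub>R f))) has_sum (r *\<^sub>R L f)) N"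
      using has_sum_scaleR[OF L(1)[of f], of r]
      by (simp add: linear_simps(5)[OF bounded_linear_qinner] scaleQ_simps)
    then show "L (r *\<^sub>R f) = r *\<^sub>R L f"
      using L(1) has_sum_unique by blast
    show "norm (L f) \<le> norm f * norm q"
      using L(2)[of f] by (simp add: mult.commute)
  qed
  then have "blinfun_apply (lmult N q) = L"
    unfolding lmult_def L_def by (rule bounded_linear_Blinfun_apply)
  then show ?thesis
    using L by simp
qed

lemma lmult_eqI: "((\<lambda>g. g *\<^sub>Q (q * qinner g f)) has_sum l) N \<Longrightarrow> lmult N q f = l"
  using lmult_has_sum has_sum_unique by blast

lemma lmult_add: "lmult N (p + q) = lmult N p + lmult N q"
proof (rule blinfun_eqI, rule lmult_eqI)
  fix f
  show "((\<lambda>g. g *\<^sub>Q ((p + q) * qinner g f)) has_sum (lmult N p + lmult N q) f) N"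
    using has_sum_add[OF lmult_has_sum lmult_has_sum, of p f q f]
    by (simp add: distrib_right scaleQ_simps blinfun.add_left)
qed

lemma lmult_scaleR: "lmult N (r *\<^sub>R q) = r *\<^sub>R lmult N q"
proof (rule blinfun_eqI, rule lmult_eqI)
  fix f
  show "((\<lambda>g. g *\<^sub>Q (r *\<^sub>R q * qinner g f)) has_sum (r *\<^sub>R lmult N q) f) N"
    using has_sum_scaleR[OF lmult_has_sum, of r q f]
    by (simp add: scaleQ_simps blinfun.scaleR_left)
qed

lemma lmult_one: "lmult N 1 = id_blinfun"
proof (rule blinfun_eqI)
  fix f
  show "lmult N 1 f = id_blinfun f"
    by (metis lpart_limit lmult_eqI id_blinfun.rep_eq)
qed

text \<open>Continuity of the inner product allows it to be taken term by term, and only the term at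
  h survives. Coordinates are thus multiplied from the left, which makes \<open>lmult\<close>
  multiplicative.\<close>

lemma qinner_lmult:
  assumes "h \<in> N"
  shows "qinner h (lmult N q f) = q * qinner h f"
proof -
  have "((\<lambda>g. qinner h (g *\<^sub>Q (q * qinner g f))) has_sum qinner h (lmult N q f)) N"
    using has_sum_bounded_linear[OF bounded_linear_qinner lmult_has_sum] by (simp add: o_def)
  moreover have "((\<lambda>g. qinner h (g *\<^sub>Q (q * qinner g f))) has_sum (q * qinner h f)) N"
  proof -
    have "((\<lambda>g. qinner h (g *\<^sub>Q (q * qinner g f))) has_sum (q * qinner h f)) {h}"
      using has_sum_finite[of "{h}" "\<lambda>g. qinner h (g *\<^sub>Q (q * qinner g f))"] assms
      by (simp add: qinner_scale_right hilbert_basis_qinner)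
    then show ?thesis
      by (rule has_sum_cong_neutral[THEN iffD1, rotated -1])
        (use assms in \<open>auto simp: qinner_scale_right hilbert_basis_qinner\<close>)
  qed
  ultimately show ?thesis
    using has_sum_unique by blast
qed

lemma lmult_mult: "lmult N p o\<^sub>L lmult N q = lmult N (p * q)"
proof (rule blinfun_eqI, simp, rule lmult_eqI)
  fix f
  have "((\<lambda>g. g *\<^sub>Q (p * q * qinner g f)) has_sum lmult N (p * q) f) N"
    by (rule lmult_has_sum)
  then show "((\<lambda>g. g *\<^sub>Q (p * qinner g (lmult N q f))) has_sum lmult N (p * q) f) N"
    by (rule has_sum_cong[THEN iffD1, rotated]) (simp add: qinner_lmult mult.assoc)
qed

text \<open>On a slice, left multiplication reduces to real scalars and the single operator
  \<open>lmult N I\<close>.\<close>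

lemma lmult_slice_emb: "lmult N (slice_emb I z) = Re z *\<^sub>R id_blinfun + Im z *\<^sub>R lmult N I"
  by (simp add: slice_emb_def lmult_add of_real_def lmult_scaleR lmult_one)

end

section \<open>Invertibility on invariant subspaces\<close>

definition qinv_on :: "'v::quat_hilbert set \<Rightarrow> ('v \<Rightarrow>\<^sub>L 'v) \<Rightarrow> bool" where
  "qinv_on W A \<longleftrightarrow> (\<exists>R. qbounded_on W R \<and> (\<forall>v\<in>W. R (A v) = v \<and> A (R v) = v))"

lemma qsubspace_simps:
  assumes "qsubspace W"
  shows "0 \<in> W" "v \<in> W \<Longrightarrow> w \<in> W \<Longrightarrow> v + w \<in> W" "v \<in> W \<Longrightarrow> v *\<^sub>Q q \<in> W" "v \<in> W \<Longrightarrow> r *\<^sub>R v \<in> W"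
    "v \<in> W \<Longrightarrow> - v \<in> W" "v \<in> W \<Longrightarrow> w \<in> W \<Longrightarrow> v - w \<in> W"
proof -
  show *: "0 \<in> W" "\<And>v w. v \<in> W \<Longrightarrow> w \<in> W \<Longrightarrow> v + w \<in> W" "\<And>v q. v \<in> W \<Longrightarrow> v *\<^sub>Q q \<in> W"
    using assms by (auto simp: qsubspace_def)
  show r: "\<And>r v. v \<in> W \<Longrightarrow> r *\<^sub>R v \<in> W"
    using *(3) scaleQ_of_real by metis
  show m: "\<And>v. v \<in> W \<Longrightarrow> - v \<in> W"
    using r[of _ "-1"] by simp
  show "v \<in> W \<Longrightarrow> w \<in> W \<Longrightarrow> v - w \<in> W"
    using *(2)[of v "- w"] m by simp
qed

lemma subspace_if_qsubspace: "qsubspace W \<Longrightarrow> subspace W"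
  by (simp add: subspace_def qsubspace_simps)

lemma qlinear_Qop: "qlinear T \<Longrightarrow> qlinear (Qop q T)"
  by (simp add: qlinear_def Qop_def blinfun.diff_left blinfun.add_left blinfun.scaleR_left scaleQ_simps)

lemma Qop_apply: "Qop q T v = T (T v) - (2 * qRe q) *\<^sub>R T v + (norm q)\<^sup>2 *\<^sub>R v"
  by (simp add: Qop_def blinfun.diff_left blinfun.add_left blinfun.scaleR_left)

lemma Qop_invariant: "qsubspace W \<Longrightarrow> blinfun_apply T ` W \<subseteq> W \<Longrightarrow> Qop q T ` W \<subseteq> W"
  by (auto simp: Qop_apply image_subset_iff intro!: qsubspace_simps)

lemma qbounded_onD:
  assumes "qbounded_on W R"
  shows "v \<in> W \<Longrightarrow> R v \<in> W" "v \<in> W \<Longrightarrow> w \<in> W \<Longrightarrow> R (v + w) = R v + R w"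
    "\<exists>K. \<forall>v\<in>W. norm (R v) \<le> K * norm v"
  using assms by (auto simp: qbounded_on_def image_subset_iff)

text \<open>The quantitative form of invertibility, surjective and bounded below; injectivity makes
  the set-theoretic inverse quaternion-linear, and the lower bound makes it bounded.\<close>

lemma qinv_on_iff:
  assumes W: "qsubspace W" and A: "qlinear A" "A ` W \<subseteq> W"
  shows "qinv_on W A \<longleftrightarrow> W \<subseteq> A ` W \<and> (\<exists>C>0. \<forall>v\<in>W. norm v \<le> C * norm (A v))"
proof
  assume "qinv_on W A"
  then obtain R where R': "qbounded_on W R" and "\<forall>v\<in>W. R (A v) = v \<and> A (R v) = v"
    unfolding qinv_on_def by blast
  then have R: "\<And>v. v \<in> W \<Longrightarrow> R v \<in> W" "\<And>v. v \<in> W \<Longrightarrow> R (A v) = v" "\<And>v. v \<in> W \<Longrightarrow> A (R v) = v"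
    using qbounded_onD(1)[OF R'] by auto
  obtain K where K: "\<And>v. v \<in> W \<Longrightarrow> norm (R v) \<le> K * norm v"
    using qbounded_onD(3)[OF R'] by blast
  have "W \<subseteq> A ` W"
  proof
    fix v assume "v \<in> W"
    then show "v \<in> A ` W"
      using R by (intro image_eqI[of _ _ "R v"]) auto
  qed
  \<comment> \<open>K may be zero or negative when W is trivial; the enlarged constant is
    positive.\<close>
  moreover have "norm v \<le> (\<bar>K\<bar> + 1) * norm (A v)" if "v \<in> W" for v
  proof -
    have "norm v \<le> K * norm (A v)"
      using K[of "A v"] R(2)[OF that] A(2) that by (auto simp: image_subset_iff)
    also have "\<dots> \<le> (\<bar>K\<bar> + 1) * norm (A v)"
      by (rule mult_right_mono) auto
    finally show ?thesis .
  qed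
  moreover have "\<bar>K\<bar> + 1 > 0" by linarith
  ultimately show "W \<subseteq> A ` W \<and> (\<exists>C>0. \<forall>v\<in>W. norm v \<le> C * norm (A v))"
    by blast
next
  assume "W \<subseteq> A ` W \<and> (\<exists>C>0. \<forall>v\<in>W. norm v \<le> C * norm (A v))"
  then obtain C where sur: "W \<subseteq> A ` W" and C: "\<And>v. v \<in> W \<Longrightarrow> norm v \<le> C * norm (A v)"
    by blast
  have inj: "v = w" if "v \<in> W" "w \<in> W" "A v = A w" for v w
    using C[of "v - w"] that qsubspace_simps[OF W] by (simp add: blinfun.diff_right)
  define R where "R = inv_into W A"
  have R: "R v \<in> W" "A (R v) = v" if "v \<in> W" for v
    using that sur unfolding R_def by (auto intro: inv_into_into f_inv_into_f)
  have RA: "R (A v) = v" if "v \<in> W" for v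
    using inj R that A(2) by (meson image_subset_iff)
  have "qbounded_on W R"
    unfolding qbounded_on_def
  proof (intro conjI ballI allI exI)
    show "R ` W \<subseteq> W" using R by blast
    fix v assume v: "v \<in> W"
    show "R (v + w) = R v + R w" if "w \<in> W" for w
      by (rule inj) (use R v that qsubspace_simps[OF W] in \<open>auto simp: blinfun.add_right\<close>)
    show "R (v *\<^sub>Q q) = R v *\<^sub>Q q" for q
      by (rule inj) (use R v A qsubspace_simps[OF W] in \<open>auto simp: qlinear_def\<close>)
    show "norm (R v) \<le> C * norm v"
      using C[of "R v"] R v by simp
  qed
  then show "qinv_on W A"
    unfolding qinv_on_def using R RA by blast
qed

text \<open>A two-sided inverse on W forces a trivial kernel and range all of W, in particular dense
  range; the resolvent set becomes plain bounded invertibility of \<open>Qop\<close>.\<close>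

lemma S_resolvent_on_iff:
  fixes T :: "'v::quat_hilbert \<Rightarrow>\<^sub>L 'v"
  assumes "qsubspace W" "T ` W \<subseteq> W"
  shows "q \<in> S_resolvent_on W T \<longleftrightarrow> qinv_on W (Qop q T)"
proof
  assume inv: "qinv_on W (Qop q T)"
  then obtain R where R: "qbounded_on W R" "\<And>v. v \<in> W \<Longrightarrow> R (Qop q T v) = v \<and> Qop q T (R v) = v"
    unfolding qinv_on_def by blast
  have "v = 0" if "v \<in> W" "Qop q T v = 0" for v
    using R(2)[OF that(1)] R(2)[OF qsubspace_simps(1)[OF assms(1)]] that by (simp add: blinfun.zero_right)
  then have "{v \<in> W. Qop q T v = 0} = {0}"
    using qsubspace_simps(1)[OF assms(1)] by (auto simp: blinfun.zero_right)
  moreover have "W \<subseteq> Qop q T ` W"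
  proof
    fix v assume "v \<in> W"
    then show "v \<in> Qop q T ` W"
      using R qbounded_onD(1) by (intro image_eqI[of _ _ "R v"]) auto
  qed
  then have "W \<subseteq> closure (Qop q T ` W)"
    using closure_subset by blast
  ultimately show "q \<in> S_resolvent_on W T"
    using inv unfolding S_resolvent_on_def qinv_on_def by blast
qed (auto simp: S_resolvent_on_def qinv_on_def)

text \<open>B x = y is the fixed point equation x = R (y - (B - A) x) with R inverse to A, a
  contraction of the complete set W with constant c = C * norm (B - A). The lower bound for B
  follows by absorbing c * norm v on the left. Only C and the size of B - A matter, so the lemma can
  be used with an A that varies while C stays fixed.\<close>

lemma qinv_on_perturb:
  assumes W: "qsubspace W" "closed W" and A: "qlinear A" "A ` W \<subseteq> W" and B: "qlinear B" "B ` W \<subseteq> W"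
    and C: "C > 0" "\<And>v. v \<in> W \<Longrightarrow> norm v \<le> C * norm (A v)" and inv: "qinv_on W A"
    and small: "C * norm (B - A) < 1"
  shows "qinv_on W B"
proof -
  note Ws = qsubspace_simps[OF W(1)]
  obtain R where R: "qbounded_on W R" "\<And>v. v \<in> W \<Longrightarrow> R (A v) = v \<and> A (R v) = v"
    using inv unfolding qinv_on_def by blast
  define c where "c = C * norm (B - A)"
  have c: "0 \<le> c" "c < 1" using C small by (simp_all add: c_def)
  have Rn: "R v \<in> W \<and> norm (R v) \<le> C * norm v" if "v \<in> W" for v
    using R(2)[OF that] qbounded_onD(1)[OF R(1) that] C(2)[of "R v"] by simp
  have R_diff: "R v - R w = R (v - w)" if "v \<in> W" "w \<in> W" for v w
  proof -
    have "R v = R ((v - w) + w)" by simp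
    also have "\<dots> = R (v - w) + R w"
      using that Ws by (intro qbounded_onD(2)[OF R(1)])
    finally show ?thesis by simp
  qed
  have D: "(B - A) v \<in> W" if "v \<in> W" for v
    using A(2) B(2) that Ws by (auto simp: blinfun.diff_left image_subset_iff)
  have "y \<in> B ` W" if y: "y \<in> W" for y
  proof -
    define f where "f x = R (y - (B - A) x)" for x
    have "\<exists>!x. x \<in> W \<and> f x = x"
    proof (rule Banach_fix[of W c f])
      show "complete W" using W by (simp add: complete_eq_closed)
      show "W \<noteq> {}" using Ws by blast
      show "f ` W \<subseteq> W" using y D Rn Ws(6) by (auto simp: f_def)
      show "dist (f x) (f x') \<le> c * dist x x'" if "x \<in> W" "x' \<in> W" for x x'
      proof -
        have "f x - f x' = R ((B - A) (x' - x))"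
          unfolding f_def by (subst R_diff) (use y D that Ws in \<open>auto simp: blinfun.diff_right\<close>)
        then have "norm (f x - f x') \<le> C * norm ((B - A) (x' - x))"
          using Rn[of "(B - A) (x' - x)"] D Ws that by simp
        also have "\<dots> \<le> C * (norm (B - A) * norm (x' - x))"
          using C by (intro mult_left_mono norm_blinfun) auto
        finally show ?thesis
          by (simp add: c_def dist_norm norm_minus_commute mult.assoc)
      qed
    qed (use c in auto)
    then obtain x where x: "x \<in> W" "R (y - (B - A) x) = x"
      unfolding f_def by (elim ex1E conjE)
    have "A x = y - (B - A) x"
      using R(2)[of "y - (B - A) x"] x D Ws y by auto
    then have "B x = y"
      by (simp add: blinfun.diff_left)
    then show ?thesis using x(1) by (intro image_eqI[of _ _ x]) auto
  qed
  moreover have "norm v \<le> (C / (1 - c)) * norm (B v)" if "v \<in> W" for v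
  proof -
    have "norm (A v) \<le> norm (B v) + norm ((B - A) v)"
      using norm_triangle_ineq4[of "B v" "(B - A) v"] by (simp add: blinfun.diff_left)
    also have "\<dots> \<le> norm (B v) + norm (B - A) * norm v"
      using norm_blinfun[of "B - A" v] by simp
    finally have "C * norm (A v) \<le> C * (norm (B v) + norm (B - A) * norm v)"
      using C(1) by simp
    then have "norm v \<le> C * (norm (B v) + norm (B - A) * norm v)"
      using C(2)[OF that] by linarith
    then have "(1 - c) * norm v \<le> C * norm (B v)"
      by (simp add: c_def algebra_simps)
    then show ?thesis
      using c by (simp add: field_simps)
  qed
  moreover have "C / (1 - c) > 0" using c C by simp
  ultimately show ?thesis
    unfolding qinv_on_iff[OF W(1) B] by blast
qed

lemma tendsto_norm_Qop_diff: "((\<lambda>p. norm (Qop p T - Qop q T)) \<longlongrightarrow> 0) (at q)"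
proof -
  \<comment> \<open>The real part is the inner product with 1, hence continuous.\<close>
  have "((\<lambda>p. inner p 1) \<longlongrightarrow> inner q (1::quat)) (at q)"
    by (intro tendsto_intros)
  then have Re: "(qRe \<longlongrightarrow> qRe q) (at q)"
    by (simp add: inner_quat_def one_quat_def)
  have "((\<lambda>p. norm (Qop p T - Qop q T)) \<longlongrightarrow> norm (Qop q T - Qop q T)) (at q)"
    unfolding Qop_def by (intro tendsto_intros Re)
  then show ?thesis by simp
qed

lemma open_S_resolvent_on:
  fixes T :: "'v::quat_hilbert \<Rightarrow>\<^sub>L 'v"
  assumes W: "qsubspace W" "closed W" and T: "qlinear T" "T ` W \<subseteq> W"
  shows "open (S_resolvent_on W T)"
proof (subst open_subopen, intro ballI)
  fix q assume "q \<in> S_resolvent_on W T"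
  then have q: "qinv_on W (Qop q T)"
    using S_resolvent_on_iff W T by blast
  then obtain C where C: "C > 0" "\<And>v. v \<in> W \<Longrightarrow> norm v \<le> C * norm (Qop q T v)"
    using qinv_on_iff[OF W(1) qlinear_Qop Qop_invariant] W T by metis
  have "eventually (\<lambda>p. norm (Qop p T - Qop q T) < 1 / C) (at q)"
    using tendsto_norm_Qop_diff[of T q] C(1) by (simp add: order_tendsto_iff)
  then obtain S where S: "open S" "q \<in> S" "\<And>p. p \<in> S \<Longrightarrow> p \<noteq> q \<Longrightarrow> norm (Qop p T - Qop q T) < 1 / C"
    unfolding eventually_at_topological by blast
  have "p \<in> S_resolvent_on W T" if "p \<in> S" for p
  proof (cases "p = q")
    case True
    then show ?thesis using q S_resolvent_on_iff W T by blast
  next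
    case False
    then have "C * norm (Qop p T - Qop q T) < 1"
      using S(3)[OF that] C(1) by (simp add: field_simps)
    then have "qinv_on W (Qop p T)"
      using qinv_on_perturb[OF W _ _ _ _ C q] qlinear_Qop Qop_invariant W T by blast
    then show ?thesis
      using S_resolvent_on_iff W T by blast
  qed
  then show "\<exists>S. open S \<and> q \<in> S \<and> S \<subseteq> S_resolvent_on W T"
    using S by blast
qed

section \<open>Finite-dimensional subspaces\<close>

text \<open>A ball of radius d about a misses W. For r nonzero, -(1/r) w lies in W and so at
  distance at least d from a; rescaling bounds r by norm (r a + w) / d. This bound makes the
  coefficients of a convergent sequence Cauchy, hence the sum closed.\<close>

lemma closed_add_line:
  fixes W :: "'a::real_normed_vector set"
  assumes W: "closed W" "subspace W" and a: "a \<notin> W"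
  shows "\<exists>C. \<forall>r. \<forall>w\<in>W. \<bar>r\<bar> \<le> C * norm (r *\<^sub>R a + w)" "closed {r *\<^sub>R a + w | r w. w \<in> W}"
proof -
  obtain d where d: "d > 0" "ball a d \<subseteq> - W"
    using W(1) a by (metis ComplI closed_def openE)
  have bound: "\<bar>r\<bar> \<le> (1 / d) * norm (r *\<^sub>R a + w)" if "w \<in> W" for r w
  proof (cases "r = 0")
    case False
    have "- (1 / r) *\<^sub>R w \<in> W"
      using W(2) that by (simp add: subspace_scale subspace_neg)
    then have "d \<le> norm (a + (1 / r) *\<^sub>R w)"
      using d(2) by (force simp: dist_norm)
    then have "\<bar>r\<bar> * d \<le> \<bar>r\<bar> * norm (a + (1 / r) *\<^sub>R w)"
      by (simp add: mult_left_mono)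
    also have "\<dots> = norm (r *\<^sub>R (a + (1 / r) *\<^sub>R w))"
      by simp
    also have "r *\<^sub>R (a + (1 / r) *\<^sub>R w) = r *\<^sub>R a + w"
      using False by (simp add: scaleR_add_right)
    finally show ?thesis
      using d(1) by (simp add: field_simps)
  qed (use d in simp)
  then show "\<exists>C. \<forall>r. \<forall>w\<in>W. \<bar>r\<bar> \<le> C * norm (r *\<^sub>R a + w)"
    by blast
  show "closed {r *\<^sub>R a + w | r w. w \<in> W}"
    unfolding closed_sequential_limits
  proof (intro allI impI, elim conjE)
    fix x l assume "\<forall>n. x n \<in> {r *\<^sub>R a + w | r w. w \<in> W}" and l: "x \<longlonglongrightarrow> l"
    then have "\<forall>n. \<exists>r w. x n = r *\<^sub>R a + w \<and> w \<in> W" by auto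
    then obtain r w where rw: "\<And>n. x n = r n *\<^sub>R a + w n" "\<And>n. w n \<in> W"
      unfolding choice_iff by blast
    have "Cauchy r"
    proof (rule metric_CauchyI)
      fix e :: real assume "e > 0"
      then have "d * e > 0" using d by simp
      then obtain M where M: "\<And>m n. m \<ge> M \<Longrightarrow> n \<ge> M \<Longrightarrow> norm (x m - x n) < d * e"
        using LIMSEQ_imp_Cauchy[OF l] by (metis CauchyD)
      have "dist (r m) (r n) < e" if "m \<ge> M" "n \<ge> M" for m n
      proof -
        have "x m - x n = (r m - r n) *\<^sub>R a + (w m - w n)"
          by (simp add: rw(1) algebra_simps)
        moreover have "w m - w n \<in> W"
          using rw(2) W(2) by (simp add: subspace_diff)
        ultimately have "\<bar>r m - r n\<bar> \<le> (1 / d) * norm (x m - x n)"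
          using bound by metis
        also have "\<dots> < e"
          using M[OF that] d(1) by (simp add: field_simps)
        finally show ?thesis by (simp add: dist_real_def)
      qed
      then show "\<exists>M. \<forall>m\<ge>M. \<forall>n\<ge>M. dist (r m) (r n) < e" by blast
    qed
    then obtain s where s: "r \<longlonglongrightarrow> s"
      using Cauchy_convergent convergent_def by blast
    have "(\<lambda>n. x n - r n *\<^sub>R a) \<longlonglongrightarrow> l - s *\<^sub>R a"
      by (intro tendsto_intros l s)
    then have "w \<longlonglongrightarrow> l - s *\<^sub>R a"
      by (simp add: rw(1))
    then have "l - s *\<^sub>R a \<in> W"
      using W(1) rw(2) unfolding closed_sequential_limits by blast
    then show "l \<in> {r *\<^sub>R a + w | r w. w \<in> W}"
      by (intro CollectI exI[of _ s] exI[of _ "l - s *\<^sub>R a"]) auto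
  qed
qed

text \<open>With f = id this bounds the projection onto \<open>span B\<close> along W; with W = {0}
  it bounds f on \<open>span B\<close>. Carrying \<open>norm v\<close> beside
  \<open>norm (f v)\<close> is what controls the new coefficient r in the induction step.\<close>

lemma linear_bounded_on_span_mod:
  fixes f :: "'a::real_normed_vector \<Rightarrow> 'b::real_normed_vector"
  assumes "finite B" "independent B" "linear f" "closed W" "subspace W" "span B \<inter> W = {0}"
  shows "\<exists>C. \<forall>v\<in>span B. \<forall>w\<in>W. norm (f v) + norm v \<le> C * norm (v + w)"
  using assms
proof (induction B arbitrary: W)
  case empty
  then show ?case
    by (intro exI[of _ 0]) (auto simp: linear_0)
next
  case (insert a B)
  have a: "a \<notin> span B" and B: "independent B"
    using insert.prems(1) insert.hyps independent_insert by metis+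
  have aW: "a \<notin> W"
  proof
    assume "a \<in> W"
    then have "a \<in> span (insert a B) \<inter> W"
      by (simp add: span_base)
    then have "a = 0"
      unfolding insert.prems(5) by simp
    then show False
      using a span_zero[of B] by blast
  qed
  \<comment> \<open>The induction moves one basis vector at a time from the span into the closed
    complement, which is why W is arbitrary in the induction hypothesis.\<close>
  define W' where "W' = {r *\<^sub>R a + w | r w. w \<in> W}"
  obtain C where C: "\<And>r w. w \<in> W \<Longrightarrow> \<bar>r\<bar> \<le> C * norm (r *\<^sub>R a + w)"
    using closed_add_line(1)[OF insert.prems(3,4) aW] by blast
  have "closed W'"
    unfolding W'_def by (rule closed_add_line(2)[OF insert.prems(3,4) aW])
  moreover have "W' = {x + y | x y. x \<in> span {a} \<and> y \<in> W}"
    unfolding W'_def span_singleton by blast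
  then have "subspace W'"
    using subspace_sums[OF subspace_span[of "{a}"] insert.prems(4)] by simp
  moreover have "span B \<inter> W' = {0}"
  proof -
    have "v = 0" if v: "v \<in> span B" and rw: "v = r *\<^sub>R a + w" "w \<in> W" for v r w
    proof -
      have "v \<in> span (insert a B)" "r *\<^sub>R a \<in> span (insert a B)"
        using v span_mono[of B "insert a B"] by (auto intro: span_scale span_base)
      then have "w \<in> span (insert a B)"
        using rw(1) span_diff by fastforce
      then have "w = 0"
        using insert.prems(5) rw(2) by blast
      then have "r *\<^sub>R a \<in> span B"
        using v rw by simp
      then have "r = 0"
        using a span_scale[of "r *\<^sub>R a" B "1 / r"] by (cases "r = 0") auto
      then show ?thesis using rw \<open>w = 0\<close> by simp
    qed
    moreover have "0 \<in> W'"
      using \<open>subspace W'\<close> by (rule subspace_0)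
    ultimately show ?thesis
      using span_zero[of B] unfolding W'_def by (intro equalityI subsetI) (simp_all, blast)
  qed
  ultimately have "\<exists>D. \<forall>v\<in>span B. \<forall>w\<in>W'. norm (f v) + norm v \<le> D * norm (v + w)"
    by (intro insert.IH B insert.prems(2))
  then obtain D where D: "\<And>v w. v \<in> span B \<Longrightarrow> w \<in> W' \<Longrightarrow> norm (f v) + norm v \<le> D * norm (v + w)"
    by blast
  have "norm (f v) + norm v \<le> ((norm (f a) + norm a) * (\<bar>C\<bar> * (1 + \<bar>D\<bar>)) + D) * norm (v + w)"
    if v: "v \<in> span (insert a B)" and w: "w \<in> W" for v w
  proof -
    obtain r where "v - r *\<^sub>R a \<in> span B"
      using v span_insert by blast
    then obtain v' where v': "v' \<in> span B" "v = r *\<^sub>R a + v'"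
      by (metis add.commute diff_add_cancel)
    define x where "x = v + w"
    have x: "v' + (r *\<^sub>R a + w) = x"
      by (simp add: x_def v')
    have "r *\<^sub>R a + w \<in> W'"
      using w W'_def by blast
    then have *: "norm (f v') + norm v' \<le> D * norm x"
      using D[OF v'(1)] x by metis
    have "\<bar>r\<bar> \<le> C * norm (r *\<^sub>R a + w)"
      using C w by blast
    also have "\<dots> \<le> \<bar>C\<bar> * norm (x - v')"
      using x by (metis abs_ge_self add_diff_cancel_left' mult_right_mono norm_ge_zero)
    also have "\<dots> \<le> \<bar>C\<bar> * (norm x + norm v')"
      by (intro mult_left_mono norm_triangle_ineq4) simp
    also have "\<dots> \<le> \<bar>C\<bar> * (norm x + \<bar>D\<bar> * norm x)"
    proof -
      have "D * norm x \<le> \<bar>D\<bar> * norm x" by (intro mult_right_mono) auto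
      then have "norm v' \<le> \<bar>D\<bar> * norm x" using * norm_ge_zero[of "f v'"] by linarith
      then show ?thesis by (intro mult_left_mono) auto
    qed
    finally have r: "\<bar>r\<bar> \<le> \<bar>C\<bar> * (1 + \<bar>D\<bar>) * norm x"
      by (simp add: algebra_simps)
    have "norm (f v) \<le> \<bar>r\<bar> * norm (f a) + norm (f v')"
      using norm_triangle_ineq[of "r *\<^sub>R f a" "f v'"] insert.prems(2)
      by (simp add: v' linear_add linear_scale)
    moreover have "norm v \<le> \<bar>r\<bar> * norm a + norm v'"
      using norm_triangle_ineq[of "r *\<^sub>R a" "v'"] by (simp add: v')
    ultimately have "norm (f v) + norm v \<le> (norm (f a) + norm a) * \<bar>r\<bar> + D * norm x"
      using * by (simp add: algebra_simps)
    also have "\<dots> \<le> (norm (f a) + norm a) * (\<bar>C\<bar> * (1 + \<bar>D\<bar>) * norm x) + D * norm x"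
      using r by (intro add_right_mono mult_left_mono) auto
    finally show ?thesis
      by (simp add: x_def algebra_simps)
  qed
  then show ?case by blast
qed

text \<open>A quaternionic span is the real span of the products of its generators with the four
  basis quaternions, so real linear algebra applies to finite-dimensional quaternionic
  subspaces.\<close>

lemma qspan_eq_span:
  fixes B :: "'v::quat_hilbert set"
  assumes "finite B"
  shows "qspan B = span ((\<lambda>(b, u). b *\<^sub>Q u) ` (B \<times> Basis))"
proof
  have "b *\<^sub>Q c \<in> span ((\<lambda>(b, u). b *\<^sub>Q u) ` (B \<times> Basis))" if "b \<in> B" for b and c :: quat
  proof -
    have "b *\<^sub>Q c = b *\<^sub>Q (\<Sum>u\<in>Basis. (c \<bullet> u) *\<^sub>R u)"
      by (simp add: euclidean_representation)
    also have "\<dots> = (\<Sum>u\<in>Basis. (c \<bullet> u) *\<^sub>R (b *\<^sub>Q u))"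
      by (simp add: bounded_bilinear.sum_right[OF bounded_bilinear_scaleQ] scaleQ_simps)
    also have "\<dots> \<in> span ((\<lambda>(b, u). b *\<^sub>Q u) ` (B \<times> Basis))"
      using that by (intro span_sum span_scale span_base) auto
    finally show ?thesis .
  qed
  then show "qspan B \<subseteq> span ((\<lambda>(b, u). b *\<^sub>Q u) ` (B \<times> Basis))"
    unfolding qspan_def by (auto intro!: span_sum)
next
  show "span ((\<lambda>(b, u). b *\<^sub>Q u) ` (B \<times> Basis)) \<subseteq> qspan B"
  proof (rule span_minimal)
    show "(\<lambda>(b, u). b *\<^sub>Q u) ` (B \<times> Basis) \<subseteq> qspan B"
    proof (clarify)
      fix b and u :: quat assume "b \<in> B"
      then show "b *\<^sub>Q u \<in> qspan B"
        unfolding qspan_def by (intro CollectI exI[of _ "{b}"] exI[of _ "\<lambda>_. u"]) auto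
    qed
    \<comment> \<open>Padding with zero coefficients puts all combinations over the same index set
      B.\<close>
    have eq: "qspan B = {(\<Sum>b\<in>B. b *\<^sub>Q c b) | c. True}"
    proof -
      have "\<exists>c'. (\<Sum>b\<in>F. b *\<^sub>Q c b) = (\<Sum>b\<in>B. b *\<^sub>Q c' b)" if "F \<subseteq> B" for F c
      proof (intro exI)
        show "(\<Sum>b\<in>F. b *\<^sub>Q c b) = (\<Sum>b\<in>B. b *\<^sub>Q (if b \<in> F then c b else 0))"
          using that assms by (intro sum.mono_neutral_cong_left) (auto simp: scaleQ_simps)
      qed
      then show ?thesis
        unfolding qspan_def using assms by blast
    qed
    show "subspace (qspan B)"
      unfolding subspace_def eq
    proof (safe, goal_cases)
      case 1
      show ?case by (intro exI[of _ "\<lambda>_. 0"]) (simp add: scaleQ_simps)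
    next
      case (2 _ _ c c')
      show ?case by (intro exI[of _ "\<lambda>b. c b + c' b"]) (simp add: scaleQ_simps sum.distrib)
    next
      case (3 r _ c)
      show ?case by (intro exI[of _ "\<lambda>b. r *\<^sub>R c b"]) (simp add: scaleQ_simps scaleR_sum_right)
    qed
  qed
qed

lemma qfinite_dim_span:
  assumes "qfinite_dim W"
  obtains B where "finite B" "independent B" "W = span B"
proof -
  obtain F where "finite F" "W = qspan F"
    using assms unfolding qfinite_dim_def by blast
  then obtain G where G: "finite G" "W = span G"
    using qspan_eq_span by (metis finite_Basis finite_cartesian_product finite_imageI)
  obtain B where "B \<subseteq> G" "independent B" "G \<subseteq> span B"
    by (metis maximal_independent_subset)
  then have "span B = span G"
    by (metis span_minimal span_mono span_span subset_antisym)
  then show ?thesis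
    using that[of B] G \<open>B \<subseteq> G\<close> \<open>independent B\<close> finite_subset by blast
qed

text \<open>The image of a basis is independent of the same cardinality inside
  \<open>span B\<close>; if it failed to span, one more vector would exceed the dimension. So
  injectivity gives surjectivity, and the inverse is bounded because the space is
  finite-dimensional.\<close>

lemma qinv_on_finite_dim:
  assumes W: "qsubspace W" "qfinite_dim W" and A: "qlinear A" "A ` W \<subseteq> W"
    and inj: "\<And>v. v \<in> W \<Longrightarrow> A v = 0 \<Longrightarrow> v = 0"
  shows "qinv_on W A"
proof -
  obtain B where B: "finite B" "independent B" "W = span B"
    using qfinite_dim_span[OF W(2)] by blast
  have lin: "linear A"
    by (simp add: linearI blinfun.add_right blinfun.scaleR_right)
  have inj_W: "inj_on A W"
    using inj qsubspace_simps(6)[OF W(1)] by (intro inj_onI) (metis blinfun.diff_right eq_iff_diff_eq_0)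
  have BW: "B \<subseteq> W"
    using B(3) span_superset by blast
  have indep: "independent (A ` B)"
    using linear_independent_injective_image[OF lin B(2)] inj_W B(3) by blast
  have card: "card (A ` B) = card B"
    using inj_W BW by (meson card_image inj_on_subset)
  have "W \<subseteq> span (A ` B)"
  proof (rule ccontr)
    assume "\<not> W \<subseteq> span (A ` B)"
    then obtain x where x: "x \<in> W" "x \<notin> span (A ` B)" by blast
    then have "independent (insert x (A ` B))"
      using indep independent_insert by (metis span_base)
    moreover have "insert x (A ` B) \<subseteq> span B"
      using x(1) A(2) BW unfolding B(3)[symmetric] by (auto simp: image_subset_iff)
    ultimately have "card (insert x (A ` B)) \<le> card B"
      using independent_span_bound[OF B(1)] by blast
    moreover have "x \<notin> A ` B"
      using x(2) span_base[of x "A ` B"] by (rule contrapos_nn)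
    ultimately show False
      using B(1) card by simp
  qed
  then have "W \<subseteq> A ` W"
    using linear_span_image[OF lin, of B] B(3) by simp
  moreover obtain g where g: "linear g" "\<And>v. v \<in> W \<Longrightarrow> g (A v) = v"
    using linear_exists_left_inverse_on[OF lin subspace_if_qsubspace[OF W(1)] inj_W] by blast
  \<comment> \<open>The complement {0} turns the estimate into boundedness of the left inverse
    g.\<close>
  obtain C where C: "\<And>v w. v \<in> span B \<Longrightarrow> w \<in> {0} \<Longrightarrow> norm (g v) + norm v \<le> C * norm (v + w)"
    using linear_bounded_on_span_mod[OF B(1,2) g(1), of "{0}"] span_zero by (auto simp: subspace_0)
  have "norm v \<le> (\<bar>C\<bar> + 1) * norm (A v)" if "v \<in> W" for v
  proof -
    have "A v \<in> span B"
      using A(2) B(3) that by blast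
    then have "norm v + norm (A v) \<le> C * norm (A v)"
      using C[of "A v" 0] g(2)[OF that] by simp
    also have "\<dots> \<le> \<bar>C\<bar> * norm (A v)"
      by (intro mult_right_mono) auto
    finally show ?thesis
      using norm_ge_zero[of "A v"] unfolding distrib_right by linarith
  qed
  moreover have "\<bar>C\<bar> + 1 > 0" by linarith
  ultimately show ?thesis
    unfolding qinv_on_iff[OF W(1) A] by blast
qed

text \<open>Finite-dimensionality of \<open>V\<^sub>1\<close> gives a bounded projection onto \<open>V\<^sub>1\<close> along \<open>V\<^sub>2\<close>.\<close>

lemma S_resolvent_direct_sum:
  fixes T :: "'v::quat_hilbert \<Rightarrow>\<^sub>L 'v"
  assumes T: "qlinear T" and V1: "qsubspace V1" "T ` V1 \<subseteq> V1" "qfinite_dim V1"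
    and V2: "qsubspace V2" "T ` V2 \<subseteq> V2" "closed V2"
    and sum: "V1 \<inter> V2 = {0}" "{v + w | v w. v \<in> V1 \<and> w \<in> V2} = UNIV"
  shows "S_resolvent_on V1 T \<inter> S_resolvent_on V2 T \<subseteq> \<rho>\<^sub>S T"
proof
  fix q assume q: "q \<in> S_resolvent_on V1 T \<inter> S_resolvent_on V2 T"
  define A where "A = Qop q T"
  have A: "qlinear A" "A ` V1 \<subseteq> V1" "A ` V2 \<subseteq> V2"
    unfolding A_def using qlinear_Qop[OF T] Qop_invariant[OF V1(1,2)] Qop_invariant[OF V2(1,2)] by simp_all
  have inv: "qinv_on V1 A" "qinv_on V2 A"
    using q S_resolvent_on_iff[OF V1(1,2)] S_resolvent_on_iff[OF V2(1,2)] unfolding A_def by simp_all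
  obtain C1 where C1: "V1 \<subseteq> A ` V1" "C1 > 0" "\<And>v. v \<in> V1 \<Longrightarrow> norm v \<le> C1 * norm (A v)"
    using inv(1) unfolding qinv_on_iff[OF V1(1) A(1,2)] by blast
  obtain C2 where C2: "V2 \<subseteq> A ` V2" "C2 > 0" "\<And>v. v \<in> V2 \<Longrightarrow> norm v \<le> C2 * norm (A v)"
    using inv(2) unfolding qinv_on_iff[OF V2(1) A(1,3)] by blast
  obtain B where B: "finite B" "independent B" "V1 = span B"
    using qfinite_dim_span[OF V1(3)] by blast
  obtain D where D: "\<And>v w. v \<in> V1 \<Longrightarrow> w \<in> V2 \<Longrightarrow> norm v + norm v \<le> D * norm (v + w)"
    using linear_bounded_on_span_mod[OF B(1,2) linear_id V2(3) subspace_if_qsubspace[OF V2(1)]] sum(1) B(3)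
    by auto
  have D': "norm v \<le> \<bar>D\<bar> * norm (v + w)" if "v \<in> V1" "w \<in> V2" for v w
  proof -
    have "D * norm (v + w) \<le> \<bar>D\<bar> * norm (v + w)"
      by (intro mult_right_mono) auto
    then show ?thesis
      using D[OF that] norm_ge_zero[of v] by linarith
  qed
  have U: "qsubspace (UNIV :: 'v set)" by (simp add: qsubspace_def)
  have dec: "\<exists>v w. x = v + w \<and> v \<in> V1 \<and> w \<in> V2" for x
    using sum(2) by blast
  have "x \<in> range A" for x
  proof -
    obtain v w where x: "x = v + w" "v \<in> V1" "w \<in> V2" using dec by blast
    obtain v' w' where "v = A v'" "w = A w'"
      using C1(1) C2(1) x by blast
    then have "x = A (v' + w')"
      using x by (simp add: blinfun.add_right)
    then show ?thesis by blast
  qed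
  moreover have "norm x \<le> (C1 * \<bar>D\<bar> + C2 * (1 + \<bar>D\<bar>) + 1) * norm (A x)" for x
  proof -
    obtain v w where x: "x = v + w" "v \<in> V1" "w \<in> V2" using dec by blast
    \<comment> \<open>The projection bound is applied to A v + A w, not to v + w: A preserves both
      summands, so these are the components of A x.\<close>
    have Ax: "A x = A v + A w" and Avw: "A v \<in> V1" "A w \<in> V2"
      using x A by (auto simp: blinfun.add_right)
    have v: "norm (A v) \<le> \<bar>D\<bar> * norm (A x)"
      using D'[OF Avw] Ax by simp
    have w: "norm (A w) \<le> (1 + \<bar>D\<bar>) * norm (A x)"
      using norm_triangle_ineq4[of "A x" "A v"] v Ax by (simp add: algebra_simps)
    have "norm x \<le> norm v + norm w"
      using x norm_triangle_ineq by blast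
    also have "\<dots> \<le> C1 * norm (A v) + C2 * norm (A w)"
      using C1(3)[OF x(2)] C2(3)[OF x(3)] by linarith
    also have "\<dots> \<le> C1 * (\<bar>D\<bar> * norm (A x)) + C2 * ((1 + \<bar>D\<bar>) * norm (A x))"
      using v w C1 C2 by (intro add_mono mult_left_mono) auto
    also have "\<dots> \<le> (C1 * \<bar>D\<bar> + C2 * (1 + \<bar>D\<bar>) + 1) * norm (A x)"
      by (simp add: algebra_simps)
    finally show ?thesis .
  qed
  moreover have "C1 * \<bar>D\<bar> + C2 * (1 + \<bar>D\<bar>) + 1 > 0"
    using C1(2) C2(2) by (intro add_nonneg_pos add_nonneg_nonneg mult_nonneg_nonneg) auto
  ultimately have "qinv_on UNIV A"
    unfolding qinv_on_iff[OF U A(1) subset_UNIV] by blast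
  then show "q \<in> \<rho>\<^sub>S T"
    using S_resolvent_on_iff[OF U subset_UNIV] A_def by blast
qed

section \<open>The residue theorem for systems of closed curves\<close>

text \<open>Each loop is tied to the base point a by a path c inside S and by its reverse, whose
  contributions cancel. The system of curves then integrates like one closed path, to which the
  residue theorem applies.\<close>

lemma closed_curves_join:
  assumes S: "open S" "connected S" "a \<in> S"
    and cs: "\<And>\<gamma>. \<gamma> \<in> set \<gamma>s \<Longrightarrow> valid_path \<gamma> \<and> pathfinish \<gamma> = pathstart \<gamma> \<and> path_image \<gamma> \<subseteq> S"
  shows "\<exists>\<Gamma>. valid_path \<Gamma> \<and> path_image \<Gamma> \<subseteq> S \<and> pathstart \<Gamma> = a \<and> pathfinish \<Gamma> = a \<and>
    (\<forall>f. f holomorphic_on S \<longrightarrow> contour_integral \<Gamma> f = (\<Sum>\<gamma>\<leftarrow>\<gamma>s. contour_integral \<gamma> f))"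
  using cs
proof (induction \<gamma>s)
  case Nil
  have "valid_path (linepath a a)" "path_image (linepath a a) \<subseteq> S"
    "pathstart (linepath a a) = a" "pathfinish (linepath a a) = a"
    using S(3) valid_path_linepath pathstart_linepath pathfinish_linepath by (auto simp: path_image_linepath)
  moreover have "contour_integral (linepath a a) f = 0" for f
    by (rule contour_integral_unique[OF has_contour_integral_trivial])
  ultimately show ?case
    by (intro exI[of _ "linepath a a"]) (simp only: list.map sum_list.Nil, blast)
next
  case (Cons \<gamma> \<gamma>s)
  obtain \<Gamma> where \<Gamma>: "valid_path \<Gamma>" "path_image \<Gamma> \<subseteq> S" "pathstart \<Gamma> = a" "pathfinish \<Gamma> = a"
    "\<And>f. f holomorphic_on S \<Longrightarrow> contour_integral \<Gamma> f = (\<Sum>\<gamma>\<leftarrow>\<gamma>s. contour_integral \<gamma> f)"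
    using Cons by auto
  have \<gamma>: "valid_path \<gamma>" "pathfinish \<gamma> = pathstart \<gamma>" "path_image \<gamma> \<subseteq> S"
    using Cons.prems by auto
  then have "pathstart \<gamma> \<in> S"
    using pathstart_in_path_image by blast
  then obtain c where "polynomial_function c" and c: "path_image c \<subseteq> S" "pathstart c = a" "pathfinish c = pathstart \<gamma>"
    using connected_open_polynomial_connected[OF S(1,2,3)] by blast
  then have vc: "valid_path c"
    by (simp add: valid_path_polynomial_function)
  define \<Delta> where "\<Delta> = \<Gamma> +++ c +++ \<gamma> +++ reversepath c"
  have "contour_integral \<Delta> f = (\<Sum>\<gamma>\<leftarrow>\<gamma> # \<gamma>s. contour_integral \<gamma> f)" if f: "f holomorphic_on S" for f
  proof -
    have int: "f contour_integrable_on g" if "valid_path g" "path_image g \<subseteq> S" for g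
      using contour_integrable_holomorphic_simple[OF f S(1) that] .
    have "f contour_integrable_on \<Gamma>" "f contour_integrable_on c" "f contour_integrable_on \<gamma>"
      "f contour_integrable_on (reversepath c)"
      using int \<Gamma> \<gamma> c vc by (auto simp: contour_integrable_reversepath)
    then show ?thesis
      using \<Gamma> \<gamma> c vc f unfolding \<Delta>_def by (simp add: contour_integral_reversepath)
  qed
  moreover have "valid_path \<Delta>" "path_image \<Delta> \<subseteq> S" "pathstart \<Delta> = a" "pathfinish \<Delta> = a"
    using \<Gamma> \<gamma> c vc unfolding \<Delta>_def by (auto intro!: valid_path_join simp: path_image_join)
  ultimately show ?case by blast
qed

lemma connected_Un_balls:
  fixes A :: "complex set"
  assumes "connected A" "A \<noteq> {}" "\<And>p. p \<in> F \<Longrightarrow> A \<inter> ball p (e p) \<noteq> {}"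
  shows "connected (A \<union> (\<Union>p\<in>F. ball p (e p)))"
proof -
  have "connected (\<Union>(insert A ((\<lambda>p. A \<union> ball p (e p)) ` F)))"
  proof (rule connected_Union)
    show "connected s" if "s \<in> insert A ((\<lambda>p. A \<union> ball p (e p)) ` F)" for s
      using that assms by (auto intro: connected_Un)
    show "\<Inter>(insert A ((\<lambda>p. A \<union> ball p (e p)) ` F)) \<noteq> {}"
      using assms(2) by auto
  qed
  also have "\<Union>(insert A ((\<lambda>p. A \<union> ball p (e p)) ` F)) = A \<union> (\<Union>p\<in>F. ball p (e p))"
    by auto
  finally show ?thesis .
qed

text \<open>D may be multiply connected, so the curves are joined inside a thin enlargement of D
  that is still connected after the poles are removed. The total winding number n is kept general
  because conjugated boundary curves have n = -1.\<close>

lemma residue_theorem_curves: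
  assumes D: "open D" "connected D" and pts: "finite pts" "pts \<subseteq> D"
    and cs: "\<And>\<gamma>. \<gamma> \<in> set \<gamma>s \<Longrightarrow> valid_path \<gamma> \<and> pathfinish \<gamma> = pathstart \<gamma> \<and> path_image \<gamma> \<subseteq> frontier D"
    and wD: "\<And>z. z \<in> D \<Longrightarrow> (\<Sum>\<gamma>\<leftarrow>\<gamma>s. winding_number \<gamma> z) = n"
    and wE: "\<And>z. z \<notin> closure D \<Longrightarrow> (\<Sum>\<gamma>\<leftarrow>\<gamma>s. winding_number \<gamma> z) = 0"
    and S: "open S" "D - pts \<subseteq> S" "frontier D \<subseteq> S" and f: "f holomorphic_on S"
  shows "(\<Sum>\<gamma>\<leftarrow>\<gamma>s. contour_integral \<gamma> f) = 2 * pi * \<i> * n * (\<Sum>p\<in>pts. residue f p)"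
proof (cases "D = {}")
  case True
  then have "\<gamma>s = []"
    using cs[of "hd \<gamma>s"] path_image_nonempty[of "hd \<gamma>s"] by (cases \<gamma>s) auto
  then show ?thesis
    using True pts by simp
next
  case False
  have frD: "frontier D \<inter> D = {}"
    using D(1) by (simp add: frontier_def interior_open Diff_Int_distrib2)
  have "open (S - pts)"
    using S(1) pts(1) by (simp add: open_Diff finite_imp_closed)
  then have "\<forall>p\<in>frontier D. \<exists>e>0. ball p e \<subseteq> S - pts"
    using S(3) pts(2) frD by (meson DiffI disjoint_iff open_contains_ball subsetD)
  then obtain e where e: "\<And>p. p \<in> frontier D \<Longrightarrow> e p > 0 \<and> ball p (e p) \<subseteq> S - pts"
    by metis
  \<comment> \<open>The balls cover the frontier, avoid the poles and each meet
    \<open>D - pts\<close>; adding them leaves the punctured domain open and connected.\<close>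
  define B where "B = (\<Union>p\<in>frontier D. ball p (e p))"
  have B: "B \<subseteq> S - pts" "frontier D \<subseteq> B" "open B"
    unfolding B_def using e by (auto intro!: UN_least)
  have conn: "connected (D - pts)"
    using D pts(1) by (intro connected_open_diff_countable) (auto intro: countable_finite)
  have D_ball: "D \<inter> ball p (e p) \<noteq> {} \<and> (D - pts) \<inter> ball p (e p) \<noteq> {}" if p: "p \<in> frontier D" for p
  proof -
    have "D \<inter> ball p (e p) \<noteq> {}"
      using p e[OF p] by (metis frontier_straddle centre_in_ball disjoint_iff mem_ball open_ball frontier_def Diff_iff closure_iff_nhds_not_empty Int_commute subset_refl)
    then show ?thesis
      using e[OF p] by blast
  qed
  have ne: "D - pts \<noteq> {}"
  proof
    assume "D - pts = {}"
    then have "finite D"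
      using pts by (metis Diff_eq_empty_iff finite_subset)
    then show False
      using finite_imp_not_open D(1) False by blast
  qed
  define S' where "S' = (D - pts) \<union> B"
  have S'S: "S' \<subseteq> S" "S' \<inter> pts = {}"
    using S(2) B by (auto simp: S'_def)
  have S'_open: "open S'"
    unfolding S'_def using D pts B by (auto intro!: open_Un open_Diff finite_imp_closed)
  have S'_conn: "connected S'"
    unfolding S'_def B_def using conn ne D_ball by (intro connected_Un_balls) auto
  obtain a where a: "a \<in> S'" using ne by (auto simp: S'_def)
  have "\<exists>\<Gamma>. valid_path \<Gamma> \<and> path_image \<Gamma> \<subseteq> S' \<and> pathstart \<Gamma> = a \<and> pathfinish \<Gamma> = a \<and>
    (\<forall>f. f holomorphic_on S' \<longrightarrow> contour_integral \<Gamma> f = (\<Sum>\<gamma>\<leftarrow>\<gamma>s. contour_integral \<gamma> f))"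
    using cs B(2) by (intro closed_curves_join S'_open S'_conn a) (auto simp: S'_def)
  then obtain \<Gamma> where \<Gamma>: "valid_path \<Gamma>" "path_image \<Gamma> \<subseteq> S'" "pathstart \<Gamma> = a" "pathfinish \<Gamma> = a"
    "\<And>f. f holomorphic_on S' \<Longrightarrow> contour_integral \<Gamma> f = (\<Sum>\<gamma>\<leftarrow>\<gamma>s. contour_integral \<gamma> f)"
    by blast
  \<comment> \<open>Winding numbers are integrals of 1/(w - z), which is holomorphic on S' for z off
    S', so they too are transferred from the curves to the joined path.\<close>
  have w: "winding_number \<Gamma> z = (\<Sum>\<gamma>\<leftarrow>\<gamma>s. winding_number \<gamma> z)" if z: "z \<notin> S'" for z
  proof -
    have "(\<lambda>w. 1 / (w - z)) holomorphic_on S'"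
      using z by (intro holomorphic_intros) auto
    then have "contour_integral \<Gamma> (\<lambda>w. 1 / (w - z)) = (\<Sum>\<gamma>\<leftarrow>\<gamma>s. contour_integral \<gamma> (\<lambda>w. 1 / (w - z)))"
      by (rule \<Gamma>(5))
    moreover have "contour_integral \<Gamma> (\<lambda>w. 1 / (w - z)) = 2 * pi * \<i> * winding_number \<Gamma> z"
      using \<Gamma> z by (subst winding_number_valid_path) auto
    moreover have "contour_integral \<gamma> (\<lambda>w. 1 / (w - z)) = 2 * pi * \<i> * winding_number \<gamma> z" if "\<gamma> \<in> set \<gamma>s" for \<gamma>
      using cs[OF that] z B(2) by (subst winding_number_valid_path) (auto simp: S'_def)
    then have "(\<Sum>\<gamma>\<leftarrow>\<gamma>s. contour_integral \<gamma> (\<lambda>w. 1 / (w - z))) = 2 * pi * \<i> * (\<Sum>\<gamma>\<leftarrow>\<gamma>s. winding_number \<gamma> z)"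
      unfolding sum_list_const_mult[symmetric] by (intro arg_cong[of _ _ sum_list] map_cong) auto
    ultimately show ?thesis by simp
  qed
  have "contour_integral \<Gamma> f = 2 * pi * \<i> * (\<Sum>p\<in>pts. winding_number \<Gamma> p * residue f p)"
  proof (rule Residue_theorem)
    have U: "S' \<union> pts = D \<union> B" using pts by (auto simp: S'_def)
    show "open (S' \<union> pts)" "connected (S' \<union> pts)"
      unfolding U using D B False D_ball unfolding B_def by (auto intro!: open_Un connected_Un_balls)
    have U': "S' \<union> pts - pts = S'" using S'S by auto
    show "f holomorphic_on S' \<union> pts - pts" "path_image \<Gamma> \<subseteq> S' \<union> pts - pts"
      unfolding U' using f S'S holomorphic_on_subset \<Gamma> by blast+
    show "\<forall>z. z \<notin> S' \<union> pts \<longrightarrow> winding_number \<Gamma> z = 0"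
    proof (intro allI impI)
      fix z assume z: "z \<notin> S' \<union> pts"
      then have "z \<notin> closure D"
        unfolding U closure_Un_frontier using B(2) by auto
      then show "winding_number \<Gamma> z = 0"
        using w wE z by simp
    qed
  qed (use \<Gamma> pts in auto)
  also have "(\<Sum>p\<in>pts. winding_number \<Gamma> p * residue f p) = (\<Sum>p\<in>pts. n * residue f p)"
  proof (intro sum.cong refl)
    fix p assume p: "p \<in> pts"
    then have "winding_number \<Gamma> p = n"
      using w[of p] wD[of p] pts S'S by blast
    then show "winding_number \<Gamma> p * residue f p = n * residue f p" by simp
  qed
  finally show ?thesis
    using \<Gamma>(5)[of f] f S'S holomorphic_on_subset by (auto simp: sum_distrib_left mult.assoc)
qed

text \<open>Boundedness forces f w * (w - p) to tend to 0, and this limit is the residue.\<close>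

lemma residue_eq_0_if_bounded:
  assumes "r > 0" "f holomorphic_on ball p r - {p}" "\<And>z. z \<in> ball p r - {p} \<Longrightarrow> norm (f z) \<le> M"
  shows "residue f p = 0"
proof (rule residue_simple')
  show "((\<lambda>w. f w * (w - p)) \<longlongrightarrow> 0) (at p)"
  proof (rule Lim_null_comparison)
    show "eventually (\<lambda>w. norm (f w * (w - p)) \<le> M * norm (w - p)) (at p)"
      unfolding eventually_at using assms
      by (intro exI[of _ r]) (auto simp: norm_mult dist_commute intro!: mult_right_mono)
    have "((\<lambda>w. M * norm (w - p)) \<longlongrightarrow> M * norm (p - p)) (at p)"
      by (intro tendsto_intros)
    then show "((\<lambda>w. M * norm (w - p)) \<longlongrightarrow> 0) (at p)" by simp
  qed
qed (use assms in auto)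

section \<open>The resolvent\<close>

lemma emb_commute: "emb z * emb w = emb w * emb z"
  by (metis emb_simps(4) mult.commute)

lemma emb_add_cnj: "emb (z + cnj z) = of_real (2 * Re z)"
  by (simp only: complex_add_cnj emb_simps(7))

lemma qsubspace_UNIV: "qsubspace UNIV"
  by (simp add: qsubspace_def)

lemma blinfun_inv_eqI:
  assumes "B o\<^sub>L A = id_blinfun" "A o\<^sub>L B = id_blinfun"
  shows "blinfun_inv A = B"
  unfolding blinfun_inv_def
proof (rule the_equality)
  fix C assume C: "C o\<^sub>L A = id_blinfun \<and> A o\<^sub>L C = id_blinfun"
  have "C = (B o\<^sub>L A) o\<^sub>L C"
    using assms by (simp add: blinfun_eqI)
  also have "\<dots> = B o\<^sub>L (A o\<^sub>L C)"
    by (rule blinfun_eqI) simp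
  also have "\<dots> = B"
    using C by (simp add: blinfun_eqI)
  finally show "C = B" .
qed (use assms in simp)

definition resolvent_set :: "('v::quat_hilbert \<Rightarrow>\<^sub>L 'v) \<Rightarrow> complex set" where
  "resolvent_set T = {z. emb z \<in> \<rho>\<^sub>S T}"

text \<open>By the factorisation of \<open>Qop\<close> this is the inverse of z - T, with z acting
  from the right. It commutes with right multiplication by C_i but in general not by all
  quaternions.\<close>

definition resolvent :: "('v::quat_hilbert \<Rightarrow>\<^sub>L 'v) \<Rightarrow> complex \<Rightarrow> 'v \<Rightarrow>\<^sub>L 'v" where
  "resolvent T z = blinfun_inv (Qop (emb z) T) o\<^sub>L (rmul (emb (cnj z)) - T)"

text \<open>The operator-valued form X dz: h goes to X times the complex scalar h, acting from the
  right. A complex derivative of an operator function is encoded as a real derivative of this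
  shape.\<close>

definition emul :: "('v::quat_hilbert \<Rightarrow>\<^sub>L 'v) \<Rightarrow> complex \<Rightarrow>\<^sub>L ('v \<Rightarrow>\<^sub>L 'v)" where
  "emul X = Blinfun (\<lambda>h. rmul (emb h) o\<^sub>L X)"

lemma emul_apply: "emul X h = rmul (emb h) o\<^sub>L X"
proof -
  have "bounded_linear (\<lambda>h. rmul (emb h) o\<^sub>L X)"
  proof (rule bounded_linear_intro[where K = "norm X"])
    show "norm (rmul (emb h) o\<^sub>L X) \<le> norm h * norm X" for h
    proof (rule norm_blinfun_bound)
      fix x
      have "norm (X x) * norm h \<le> norm X * norm x * norm h"
        by (intro mult_right_mono norm_blinfun) simp
      then show "norm ((rmul (emb h) o\<^sub>L X) x) \<le> norm h * norm X * norm x"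
        by (simp add: norm_scaleQ mult_ac)
    qed simp
  qed (auto intro!: blinfun_eqI simp: emb_simps scaleQ_simps blinfun.add_left blinfun.scaleR_left)
  then show ?thesis
    unfolding emul_def by (simp add: bounded_linear_Blinfun_apply)
qed

lemma emul_apply2 [simp]: "blinfun_apply (blinfun_apply (emul X) h) v = X v *\<^sub>Q emb h"
  by (simp add: emul_apply)

lemma norm_emul_apply_le: "norm (emul X h) \<le> norm X * norm h"
proof (rule norm_blinfun_bound)
  fix x
  have "norm (X x) * norm h \<le> norm X * norm x * norm h"
    by (intro mult_right_mono norm_blinfun) simp
  then show "norm (emul X h x) \<le> norm X * norm h * norm x"
    by (simp add: norm_scaleQ mult_ac)
qed simp

lemma bounded_linear_emul: "bounded_linear emul"
proof (rule bounded_linear_intro[where K = 1])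
  show "norm (emul X) \<le> norm X * 1" for X :: "'a::quat_hilbert \<Rightarrow>\<^sub>L 'a"
    by (rule norm_blinfun_bound) (use norm_emul_apply_le[of X] in auto)
qed (auto intro!: blinfun_eqI simp: scaleQ_simps blinfun.add_left blinfun.scaleR_left)

context
  fixes T :: "'v::quat_hilbert \<Rightarrow>\<^sub>L 'v"
  assumes T: "qlinear T"
begin

lemma T_scaleQ: "T (v *\<^sub>Q q) = T v *\<^sub>Q q"
  using T by (simp add: qlinear_def)

lemma open_resolvent_set: "open (resolvent_set T)"
proof -
  have "open (\<rho>\<^sub>S T)"
    by (rule open_S_resolvent_on[OF qsubspace_UNIV closed_UNIV T subset_UNIV])
  moreover have "continuous_on UNIV emb"
  proof (rule continuous_onI)
    fix x :: complex and e :: real assume "e > 0"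
    then show "\<exists>d>0. \<forall>x'\<in>UNIV. dist x' x < d \<longrightarrow> dist (emb x') (emb x) \<le> e"
      by (intro exI[of _ e]) (auto simp: dist_norm simp flip: emb_simps)
  qed
  ultimately have "open (emb -` \<rho>\<^sub>S T)"
    by (rule open_vimage)
  then show ?thesis
    by (simp add: resolvent_set_def vimage_def)
qed

text \<open>The inverse supplied by the resolvent set is identified with the definite description in
  \<open>blinfun_inv\<close>, which thereby inherits its quaternion-linearity.\<close>

lemma Qop_inverse:
  assumes "z \<in> resolvent_set T"
  shows "blinfun_inv (Qop (emb z) T) (Qop (emb z) T v) = v"
    "Qop (emb z) T (blinfun_inv (Qop (emb z) T) v) = v"
    "blinfun_inv (Qop (emb z) T) (v *\<^sub>Q q) = blinfun_inv (Qop (emb z) T) v *\<^sub>Q q"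
proof -
  let ?A = "Qop (emb z) T" let ?B = "blinfun_inv ?A"
  have "qinv_on UNIV ?A"
    using assms S_resolvent_on_iff[OF qsubspace_UNIV subset_UNIV, of "emb z" T] by (simp add: resolvent_set_def)
  then obtain R where R: "qbounded_on UNIV R" "\<And>v. R (?A v) = v \<and> ?A (R v) = v"
    unfolding qinv_on_def by blast
  obtain K where K: "\<And>v. norm (R v) \<le> K * norm v"
    using qbounded_onD(3)[OF R(1)] by blast
  have Rq: "R (v *\<^sub>Q q) = R v *\<^sub>Q q" for v q
    using R(1) by (simp add: qbounded_on_def)
  have "bounded_linear R"
  proof (rule bounded_linear_intro)
    show "R (x + y) = R x + R y" for x y
      using qbounded_onD(2)[OF R(1)] by simp
    show "R (r *\<^sub>R x) = r *\<^sub>R R x" for r x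
      using Rq[of x "of_real r"] by (simp add: scaleQ_of_real)
    show "norm (R x) \<le> norm x * K" for x
      using K[of x] by (simp add: mult.commute)
  qed
  then have a: "blinfun_apply (Blinfun R) = R"
    by (rule bounded_linear_Blinfun_apply)
  have "blinfun_inv ?A = Blinfun R"
    by (rule blinfun_inv_eqI) (auto intro!: blinfun_eqI simp: a R)
  then show "?B (?A v) = v" "?A (?B v) = v" "?B (v *\<^sub>Q q) = ?B v *\<^sub>Q q"
    by (simp_all add: a R Rq)
qed

lemma Qop_factor:
  "Qop (emb z) T v = (v *\<^sub>Q emb (cnj z) - T v) *\<^sub>Q emb z - T (v *\<^sub>Q emb (cnj z) - T v)"
proof -
  have "T v *\<^sub>Q emb z + T v *\<^sub>Q emb (cnj z) = T v *\<^sub>Q emb (z + cnj z)"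
    by (simp add: emb_simps scaleQ_add_right)
  then have "T v *\<^sub>Q emb z + T v *\<^sub>Q emb (cnj z) = (2 * Re z) *\<^sub>R T v"
    by (simp only: emb_add_cnj scaleQ_of_real)
  moreover have "v *\<^sub>Q emb (cnj z) *\<^sub>Q emb z = (norm z)\<^sup>2 *\<^sub>R v"
    by (simp only: scaleQ_scaleQ emb_cnj_mult scaleQ_of_real)
  ultimately show ?thesis
    by (simp add: Qop_apply emb_simps(9) blinfun.diff_right T_scaleQ scaleQ_simps(5) algebra_simps)
qed

lemma blinfun_inv_Qop_commute:
  assumes "z \<in> resolvent_set T"
  shows "blinfun_inv (Qop (emb z) T) (T v) = T (blinfun_inv (Qop (emb z) T) v)"
proof -
  let ?A = "Qop (emb z) T" let ?B = "blinfun_inv ?A"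
  have "T (?A w) = ?A (T w)" for w
    by (simp add: Qop_apply blinfun.diff_right blinfun.add_right blinfun.scaleR_right)
  then have "?B (T (?A (?B v))) = ?B (?A (T (?B v)))" by simp
  then show ?thesis
    by (simp add: Qop_inverse[OF assms])
qed

lemma resolvent_apply:
  "resolvent T z v = blinfun_inv (Qop (emb z) T) (v *\<^sub>Q emb (cnj z) - T v)"
  by (simp add: resolvent_def blinfun.diff_left)

lemma resolvent_scaleQ:
  assumes "z \<in> resolvent_set T"
  shows "resolvent T z (v *\<^sub>Q emb c) = resolvent T z v *\<^sub>Q emb c"
proof -
  have "v *\<^sub>Q emb c *\<^sub>Q emb (cnj z) - T (v *\<^sub>Q emb c) = (v *\<^sub>Q emb (cnj z) - T v) *\<^sub>Q emb c"
    by (simp add: scaleQ_simps T_scaleQ emb_commute)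
  then show ?thesis
    by (simp add: resolvent_apply Qop_inverse[OF assms])
qed

lemma resolvent_T:
  assumes "z \<in> resolvent_set T"
  shows "resolvent T z (T v) = T (resolvent T z v)"
  by (simp add: resolvent_apply blinfun_inv_Qop_commute[OF assms, symmetric] blinfun.diff_right T_scaleQ)

lemma resolvent_right:
  assumes "z \<in> resolvent_set T"
  shows "resolvent T z v *\<^sub>Q emb z - T (resolvent T z v) = v"
proof -
  let ?A = "Qop (emb z) T" let ?B = "blinfun_inv ?A"
  define w where "w = ?B v"
  have "resolvent T z v = w *\<^sub>Q emb (cnj z) - T w"
    by (simp add: resolvent_apply w_def blinfun.diff_right blinfun_inv_Qop_commute[OF assms] Qop_inverse[OF assms])
  then have "resolvent T z v *\<^sub>Q emb z - T (resolvent T z v) = ?A w"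
    by (simp add: Qop_factor)
  then show ?thesis
    by (simp add: w_def Qop_inverse[OF assms])
qed

lemma resolvent_left:
  assumes "z \<in> resolvent_set T"
  shows "resolvent T z (v *\<^sub>Q emb z - T v) = v"
  using resolvent_right[OF assms, of v] by (simp add: blinfun.diff_right resolvent_scaleQ[OF assms] resolvent_T[OF assms])

lemma resolvent_eqI:
  assumes "z \<in> resolvent_set T" "w *\<^sub>Q emb z - T w = v"
  shows "resolvent T z v = w"
  using resolvent_left[OF assms(1), of w] assms(2) by simp

section \<open>Resolvent identity, continuity and holomorphy\<close>

lemma resolvent_identity:
  assumes "z \<in> resolvent_set T" "w \<in> resolvent_set T"
  shows "resolvent T z v - resolvent T w v = resolvent T z (resolvent T w v) *\<^sub>Q emb (w - z)"
proof -
  define x where "x = resolvent T w v"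
  \<comment> \<open>v = (w - T) x is rewritten with z in place of w, and the resolvent at z is then
    applied.\<close>
  have "v = (x *\<^sub>Q emb z - T x) + x *\<^sub>Q emb (w - z)"
    using resolvent_right[OF assms(2), of v] by (simp add: x_def emb_simps scaleQ_simps)
  then have "resolvent T z v = x + resolvent T z x *\<^sub>Q emb (w - z)"
    by (metis resolvent_left resolvent_scaleQ assms(1) blinfun.add_right)
  then show ?thesis by (simp add: x_def)
qed

lemma resolvent_identity_blinfun:
  assumes "z \<in> resolvent_set T" "w \<in> resolvent_set T"
  shows "resolvent T z - resolvent T w = emul (resolvent T z o\<^sub>L resolvent T w) (w - z)"
  by (rule blinfun_eqI) (simp add: blinfun.diff_left resolvent_identity[OF assms])

lemma norm_resolvent_diff_le:
  assumes "z \<in> resolvent_set T" "w \<in> resolvent_set T"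
  shows "norm (resolvent T z - resolvent T w) \<le> norm (resolvent T z) * norm (resolvent T w) * norm (w - z)"
  unfolding resolvent_identity_blinfun[OF assms]
  by (rule order_trans[OF norm_emul_apply_le]) (intro mult_right_mono norm_blinfun_compose norm_ge_zero)

text \<open>The resolvent identity bounds the difference by a multiple of the unknown norm at w. The
  radius 1 / (2 (M + 1)) makes M * norm (w - z) at most 1/2, so half of that norm can be absorbed,
  leaving the bound 2 M; the summand 1 covers M = 0.\<close>

lemma isCont_resolvent:
  assumes z: "z \<in> resolvent_set T"
  shows "isCont (resolvent T) z"
proof -
  define M where "M = norm (resolvent T z)"
  have M: "M \<ge> 0" by (simp add: M_def)
  obtain d where d: "d > 0" "ball z d \<subseteq> resolvent_set T"
    using open_resolvent_set z open_contains_ball by blast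
  have *: "norm (resolvent T w - resolvent T z) \<le> 2 * M\<^sup>2 * norm (w - z)"
    if w: "dist w z < min d (1 / (2 * (M + 1)))" for w
  proof -
    have wr: "w \<in> resolvent_set T"
      using d(2) w by (auto simp: dist_commute)
    have n: "norm (resolvent T w - resolvent T z) \<le> norm (resolvent T w) * M * norm (w - z)"
      using norm_resolvent_diff_le[OF wr z] by (simp add: M_def norm_minus_commute)
    have "norm (w - z) * (2 * (M + 1)) \<le> 1"
      using w M by (simp add: dist_norm field_simps)
    then have "2 * (M * norm (w - z)) + 2 * norm (w - z) \<le> 1"
      by (simp add: algebra_simps)
    then have "M * norm (w - z) \<le> 1 / 2"
      using norm_ge_zero[of "w - z"] by linarith
    then have "norm (resolvent T w) * (M * norm (w - z)) \<le> norm (resolvent T w) * (1 / 2)"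
      by (intro mult_left_mono) auto
    moreover have "norm (resolvent T w) \<le> M + norm (resolvent T w - resolvent T z)"
      unfolding M_def using norm_triangle_sub[of "resolvent T w" "resolvent T z"] by simp
    ultimately have "norm (resolvent T w) \<le> 2 * M"
      using n by (simp add: mult.assoc)
    then have "norm (resolvent T w) * (M * norm (w - z)) \<le> 2 * M * (M * norm (w - z))"
      using M by (intro mult_right_mono) auto
    then show ?thesis
      using n by (simp add: power2_eq_square mult.assoc)
  qed
  have "((\<lambda>w. resolvent T w - resolvent T z) \<longlongrightarrow> 0) (at z)"
  proof (rule Lim_null_comparison)
    show "eventually (\<lambda>w. norm (resolvent T w - resolvent T z) \<le> 2 * M\<^sup>2 * norm (w - z)) (at z)"
      unfolding eventually_at using * d(1) M by (intro exI[of _ "min d (1 / (2 * (M + 1)))"]) auto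
    have "((\<lambda>w. 2 * M\<^sup>2 * norm (w - z)) \<longlongrightarrow> 2 * M\<^sup>2 * norm (z - z)) (at z)"
      by (intro tendsto_intros)
    then show "((\<lambda>w. 2 * M\<^sup>2 * norm (w - z)) \<longlongrightarrow> 0) (at z)" by simp
  qed
  then show ?thesis
    unfolding isCont_def using LIM_zero_iff by blast
qed

lemma continuous_on_resolvent: "continuous_on (resolvent_set T) (resolvent T)"
  by (intro continuous_at_imp_continuous_on ballI isCont_resolvent)

lemma has_derivative_resolvent:
  assumes z: "z \<in> resolvent_set T"
  shows "(resolvent T has_derivative emul (- (resolvent T z o\<^sub>L resolvent T z))) (at z)"
  unfolding has_derivative_at
proof (intro conjI blinfun.bounded_linear_right)
  let ?D = "emul (- (resolvent T z o\<^sub>L resolvent T z))"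
  have comm: "resolvent T z (resolvent T w v) = resolvent T w (resolvent T z v)" if "w \<in> resolvent_set T" for w v
  proof (cases "w = z")
    case False
    have "resolvent T z (resolvent T w v) *\<^sub>Q emb (w - z) = - (resolvent T w v - resolvent T z v)"
      using resolvent_identity[OF z that, of v] by simp
    also have "\<dots> = - (resolvent T w (resolvent T z v) *\<^sub>Q emb (z - w))"
      by (simp only: resolvent_identity[OF that z, of v])
    also have "\<dots> = resolvent T w (resolvent T z v) *\<^sub>Q emb (w - z)"
      by (simp add: emb_simps scaleQ_simps)
    finally have "resolvent T z (resolvent T w v) *\<^sub>Q emb (w - z) = resolvent T w (resolvent T z v) *\<^sub>Q emb (w - z)" .
    then have "(resolvent T z (resolvent T w v) - resolvent T w (resolvent T z v)) *\<^sub>Q emb (w - z) = 0"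
      by (simp add: scaleQ_simps)
    then have "norm (resolvent T z (resolvent T w v) - resolvent T w (resolvent T z v)) * norm (w - z) = 0"
      by (metis norm_scaleQ norm_emb norm_zero)
    then show ?thesis using False by simp
  qed simp
  show "((\<lambda>h. norm (resolvent T (z + h) - resolvent T z - ?D h) / norm h) \<longlongrightarrow> 0) (at 0)"
  proof (rule Lim_null_comparison)
    obtain d where d: "d > 0" "ball z d \<subseteq> resolvent_set T"
      using open_resolvent_set z open_contains_ball by blast
    have "norm (norm (resolvent T (z + h) - resolvent T z - ?D h) / norm h) \<le> norm (resolvent T (z + h) - resolvent T z) * norm (resolvent T z)"
      if h: "h \<noteq> 0" "dist h 0 < d" for h
    proof -
      have zh: "z + h \<in> resolvent_set T"
        using d(2) h by (auto simp: dist_norm)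
      \<comment> \<open>By the resolvent identity the remainder is a difference of resolvents times
        R(z) h, so its quotient by h vanishes by continuity alone.\<close>
      have "resolvent T (z + h) - resolvent T z - ?D h = emul ((resolvent T (z + h) - resolvent T z) o\<^sub>L resolvent T z) (- h)"
      proof (rule blinfun_eqI)
        fix v
        show "(resolvent T (z + h) - resolvent T z - ?D h) v = emul ((resolvent T (z + h) - resolvent T z) o\<^sub>L resolvent T z) (- h) v"
          using resolvent_identity[OF zh z, of v]
          by (simp add: blinfun.diff_left blinfun.minus_left emb_simps scaleQ_simps)
      qed
      then have "norm (resolvent T (z + h) - resolvent T z - ?D h) \<le> norm ((resolvent T (z + h) - resolvent T z) o\<^sub>L resolvent T z) * norm h"
        using norm_emul_apply_le by (metis norm_minus_cancel)
      then have "norm (resolvent T (z + h) - resolvent T z - ?D h) \<le> norm (resolvent T (z + h) - resolvent T z) * norm (resolvent T z) * norm h"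
        by (rule order_trans) (intro mult_right_mono norm_blinfun_compose norm_ge_zero)
      then show ?thesis
        using h by (simp add: field_simps)
    qed
    then show "eventually (\<lambda>h. norm (norm (resolvent T (z + h) - resolvent T z - ?D h) / norm h)
        \<le> norm (resolvent T (z + h) - resolvent T z) * norm (resolvent T z)) (at 0)"
      unfolding eventually_at using d(1) by blast
    have "((\<lambda>h. resolvent T (z + h)) \<longlongrightarrow> resolvent T z) (at 0)"
      using isCont_resolvent[OF z] unfolding isCont_def by (rule LIM_offset_zero)
    then have "((\<lambda>h. norm (resolvent T (z + h) - resolvent T z) * norm (resolvent T z)) \<longlongrightarrow> norm (resolvent T z - resolvent T z) * norm (resolvent T z)) (at 0)"
      by (intro tendsto_intros)
    then show "((\<lambda>h. norm (resolvent T (z + h) - resolvent T z) * norm (resolvent T z)) \<longlongrightarrow> 0) (at 0)" by simp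
  qed
qed

text \<open>A functional that is linear over C_i turns the right factor h of the derivative into
  complex multiplication by h, so real differentiability becomes complex differentiability.\<close>

lemma holomorphic_on_clin_resolvent:
  assumes "clin \<Psi>"
  shows "(\<lambda>z. \<Psi> (resolvent T z v)) holomorphic_on resolvent_set T"
  unfolding holomorphic_on_open[OF open_resolvent_set]
proof (intro ballI exI)
  fix z assume z: "z \<in> resolvent_set T"
  have lin: "bounded_linear (\<lambda>X :: 'v \<Rightarrow>\<^sub>L 'v. \<Psi> (X v))"
    using assms unfolding clin_def by (intro bounded_linear_compose[OF _ blinfun.bounded_linear_left]) (rule conjunct1)
  have "((\<lambda>z. \<Psi> (resolvent T z v)) has_derivative (\<lambda>h. \<Psi> (emul (- (resolvent T z o\<^sub>L resolvent T z)) h v))) (at z)"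
    by (rule bounded_linear.has_derivative[OF lin has_derivative_resolvent[OF z]])
  moreover have "\<Psi> (emul (- (resolvent T z o\<^sub>L resolvent T z)) h v) = \<Psi> (- resolvent T z (resolvent T z v)) * h" for h
    using assms by (simp add: clin_def blinfun.minus_left)
  ultimately show "((\<lambda>z. \<Psi> (resolvent T z v)) has_field_derivative \<Psi> (- resolvent T z (resolvent T z v))) (at z)"
    by (simp add: has_field_derivative_def)
qed

text \<open>A valid path may have an unbounded derivative, so the integrability of the resolvent along it
  is derived from a local primitive, \<open>F z = \<integral>\<^sub>0\<^sup>1 (z - p) R(p + t (z - p)) dt\<close>.\<close>

lemma local_primitive_resolvent:
  assumes B: "ball p d \<subseteq> resolvent_set T"
  shows "\<exists>F. \<forall>z\<in>ball p d. (F has_derivative emul (resolvent T z)) (at z)"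
proof (intro exI ballI)
  define s where "s z t = p + t *\<^sub>R (z - p)" for z :: complex and t :: real
  define f where "f z t = emul (resolvent T (s z t)) (z - p)" for z t
  \<comment> \<open>G has two readings: \<open>emul (G z t)\<close> is the derivative of f in z, and
    \<open>G z t\<close> is the derivative in t of t R(p + t (z - p)). Integrating over t collapses
    it to R(z), which is why the integral of f is a primitive.\<close>
  define G where "G z t = resolvent T (s z t) + t *\<^sub>R emul (- (resolvent T (s z t) o\<^sub>L resolvent T (s z t))) (z - p)" for z t
  fix z assume z: "z \<in> ball p d"
  have sr: "s z t \<in> resolvent_set T" if "z \<in> ball p d" "t \<in> cbox 0 1" for z t
  proof -
    have "norm (t *\<^sub>R (z - p)) \<le> 1 * norm (z - p)"
      unfolding norm_scaleR using that by (intro mult_right_mono) auto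
    then have "s z t \<in> ball p d"
      using that by (auto simp: s_def dist_norm norm_minus_commute)
    then show ?thesis using B by blast
  qed
  have ds: "((\<lambda>z. s z t) has_derivative (\<lambda>h. t *\<^sub>R h)) (at z within U)" for z t U
    unfolding s_def by (auto intro!: derivative_eq_intros)
  have dRs: "((\<lambda>z. resolvent T (s z t)) has_derivative (\<lambda>h. emul (- (resolvent T (s z t) o\<^sub>L resolvent T (s z t))) (t *\<^sub>R h)))
      (at z within U)" if "z \<in> ball p d" "t \<in> cbox 0 1" for z t U
    by (rule has_derivative_compose[OF ds has_derivative_resolvent[OF sr[OF that]]])
  have df: "((\<lambda>z. f z t) has_derivative emul (G z t)) (at z within U)"
    if zt: "z \<in> ball p d" "t \<in> cbox 0 1" for z t U
  proof -
    have "((\<lambda>z. emul (resolvent T (s z t))) has_derivative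
        (\<lambda>h. emul (emul (- (resolvent T (s z t) o\<^sub>L resolvent T (s z t))) (t *\<^sub>R h)))) (at z within U)"
      by (rule bounded_linear.has_derivative[OF bounded_linear_emul dRs[OF zt]])
    moreover have "((\<lambda>z. z - p) has_derivative (\<lambda>h. h)) (at z within U)"
      by (auto intro!: derivative_eq_intros)
    ultimately have "((\<lambda>z. f z t) has_derivative
        (\<lambda>h. emul (resolvent T (s z t)) h + emul (emul (- (resolvent T (s z t) o\<^sub>L resolvent T (s z t))) (t *\<^sub>R h)) (z - p))) (at z within U)"
      unfolding f_def by (rule bounded_bilinear.FDERIV[OF bounded_bilinear_blinfun_apply])
    moreover have "emul (resolvent T (s z t)) h + emul (emul (- (resolvent T (s z t) o\<^sub>L resolvent T (s z t))) (t *\<^sub>R h)) (z - p)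
        = emul (G z t) h" for h
      by (rule blinfun_eqI) (simp add: G_def blinfun.add_left blinfun.scaleR_left blinfun.minus_left
          emb_simps scaleQ_simps emb_commute[of h] algebra_simps)
    ultimately show ?thesis by simp
  qed
  have cs: "continuous_on (ball p d \<times> cbox 0 1) (\<lambda>(z, t). s z t)"
    unfolding s_def case_prod_unfold by (intro continuous_intros)
  have cR: "continuous_on (ball p d \<times> cbox 0 1) (\<lambda>(z, t). resolvent T (s z t))"
    unfolding case_prod_unfold
    by (rule continuous_on_compose2[OF continuous_on_resolvent cs[unfolded case_prod_unfold]]) (use sr in auto)
  have cG: "continuous_on (ball p d \<times> cbox 0 1) (\<lambda>(z, t). G z t)"
    using cR unfolding G_def case_prod_unfold
    by (intro continuous_intros bounded_linear.continuous_on[OF bounded_linear_emul]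
        bounded_bilinear.continuous_on[OF bounded_bilinear_blinfun_compose]) auto
  have cG1: "continuous_on (cbox 0 1) (G z)" if "z \<in> ball p d" for z
  proof -
    have "continuous_on (cbox 0 1) (\<lambda>t. case (z, t) of (z, t) \<Rightarrow> G z t)"
      by (rule continuous_on_compose2[OF cG continuous_on_Pair[OF continuous_on_const continuous_on_id]])
        (use that in auto)
    then show ?thesis by simp
  qed
  have cf: "f z integrable_on cbox 0 1" if "z \<in> ball p d" for z
  proof (rule integrable_continuous)
    have "continuous_on (cbox 0 1) (\<lambda>t. resolvent T (s z t))"
    proof -
      have "continuous_on (cbox 0 1) (\<lambda>t. case (z, t) of (z, t) \<Rightarrow> resolvent T (s z t))"
        by (rule continuous_on_compose2[OF cR continuous_on_Pair[OF continuous_on_const continuous_on_id]])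
          (use that in auto)
      then show ?thesis by simp
    qed
    then show "continuous_on (cbox 0 1) (f z)"
      unfolding f_def
      by (intro continuous_intros bounded_linear.continuous_on[OF bounded_linear_emul])
  qed
  have "((\<lambda>z. integral (cbox 0 1) (f z)) has_derivative integral (cbox 0 1) (\<lambda>t. emul (G z t))) (at z within ball p d)"
  proof (rule leibniz_rule)
    show "continuous_on (ball p d \<times> cbox 0 1) (\<lambda>(x, t). emul (G x t))"
      using bounded_linear.continuous_on[OF bounded_linear_emul cG] by (simp add: case_prod_unfold)
  qed (use df cf z in auto)
  then have "((\<lambda>z. integral (cbox 0 1) (f z)) has_derivative integral (cbox 0 1) (\<lambda>t. emul (G z t))) (at z)"
    using at_within_open[OF z] by simp
  moreover have "integral (cbox 0 1) (\<lambda>t. emul (G z t)) = emul (integral (cbox 0 1) (G z))"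
    using integral_linear[OF integrable_continuous[OF cG1[OF z]] bounded_linear_emul] by (simp add: o_def)
  moreover have "integral (cbox 0 1) (G z) = resolvent T z"
  proof -
    have "((G z) has_integral (1 *\<^sub>R resolvent T (s z 1) - 0 *\<^sub>R resolvent T (s z 0))) {0..1}"
    proof (rule fundamental_theorem_of_calculus)
      fix t :: real assume t: "t \<in> {0..1}"
      have "(s z has_derivative (\<lambda>h. h *\<^sub>R (z - p))) (at t within {0..1})"
        unfolding s_def[abs_def] by (auto intro!: derivative_eq_intros)
      then have "((\<lambda>t. resolvent T (s z t)) has_derivative
          (\<lambda>h. emul (- (resolvent T (s z t) o\<^sub>L resolvent T (s z t))) (h *\<^sub>R (z - p)))) (at t within {0..1})"
        by (rule has_derivative_compose) (use t z sr has_derivative_resolvent in auto)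
      then have "((\<lambda>t. t *\<^sub>R resolvent T (s z t)) has_derivative
          (\<lambda>h. t *\<^sub>R emul (- (resolvent T (s z t) o\<^sub>L resolvent T (s z t))) (h *\<^sub>R (z - p)) + h *\<^sub>R resolvent T (s z t))) (at t within {0..1})"
        by (intro has_derivative_scaleR has_derivative_ident)
      then show "((\<lambda>t. t *\<^sub>R resolvent T (s z t)) has_vector_derivative G z t) (at t within {0..1})"
        unfolding has_vector_derivative_def G_def
        by (simp add: blinfun.scaleR_right scaleR_add_right add.commute mult.commute)
    qed simp
    then show ?thesis
      by (simp add: integral_unique s_def)
  qed
  ultimately show "((\<lambda>z. integral (cbox 0 1) (f z)) has_derivative emul (resolvent T z)) (at z)"
    by simp
qed

text \<open>On a short interval the path stays in a disc with a primitive F, and the integrand is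
  the derivative of F along the path off a finite set. The fundamental theorem then yields
  integrability with no bound on the derivative of the path, and the short intervals are patched
  together.\<close>

lemma resolvent_integrable:
  assumes \<gamma>: "valid_path \<gamma>" "path_image \<gamma> \<subseteq> resolvent_set T"
  shows "(\<lambda>t. emul (resolvent T (\<gamma> t)) (vector_derivative \<gamma> (at t within {0..1}))) integrable_on {0..1}"
    (is "?f integrable_on _")
proof -
  obtain S where cont: "continuous_on {0..1} \<gamma>" and S: "finite S" "\<gamma> C1_differentiable_on ({0..1} - S)"
    using \<gamma>(1) unfolding valid_path_def piecewise_C1_differentiable_on_def by blast
  have "?f integrable_on cbox 0 1"
  proof (rule integrable_on_little_subintervals, intro ballI)
    fix x :: real assume x: "x \<in> cbox 0 1"
    then have "\<gamma> x \<in> resolvent_set T"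
      using \<gamma>(2) by (auto simp: path_image_def)
    then obtain d where d: "d > 0" "ball (\<gamma> x) d \<subseteq> resolvent_set T"
      using open_resolvent_set open_contains_ball by blast
    obtain F where F: "\<And>z. z \<in> ball (\<gamma> x) d \<Longrightarrow> (F has_derivative emul (resolvent T z)) (at z)"
      using local_primitive_resolvent[OF d(2)] by blast
    obtain e where e: "e > 0" "\<And>t. t \<in> {0..1} \<Longrightarrow> dist t x < e \<Longrightarrow> dist (\<gamma> t) (\<gamma> x) < d"
      using cont x d(1) unfolding continuous_on_iff by (metis box_real(2))
    have "?f integrable_on cbox u v"
      if uv: "x \<in> cbox u v" "cbox u v \<subseteq> ball x e" "cbox u v \<subseteq> cbox 0 1" for u v
    proof -
      have in_ball: "\<gamma> t \<in> ball (\<gamma> x) d" if "t \<in> {u..v}" for t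
        using e(2)[of t] that uv(2,3) by (auto simp: dist_commute subset_iff)
      have "(?f has_integral (F (\<gamma> v) - F (\<gamma> u))) {u..v}"
      proof (rule fundamental_theorem_of_calculus_interior_strong[OF S(1)])
        show "u \<le> v" using uv(1) by simp
        have "continuous_on (ball (\<gamma> x) d) F"
          using F by (intro continuous_at_imp_continuous_on ballI) (rule has_derivative_continuous)
        moreover have "continuous_on {u..v} \<gamma>"
          using cont uv(3) by (metis box_real(2) continuous_on_subset)
        ultimately show "continuous_on {u..v} (\<lambda>t. F (\<gamma> t))"
          by (rule continuous_on_compose2) (use in_ball in blast)
        fix t assume t: "t \<in> {u<..<v} - S"
        then have t01: "t \<in> {0..1}" "0 < t" "t < 1"
          using uv(3) \<open>u \<le> v\<close> by auto
        then have "\<gamma> differentiable at t"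
          using S(2) t by (simp add: C1_differentiable_on_eq)
        then have "(\<gamma> has_vector_derivative vector_derivative \<gamma> (at t)) (at t)"
          by (simp add: vector_derivative_works)
        moreover have "vector_derivative \<gamma> (at t within {0..1}) = vector_derivative \<gamma> (at t)"
          using t01 calculation by (intro vector_derivative_at_within_ivl) auto
        ultimately have g: "(\<gamma> has_vector_derivative vector_derivative \<gamma> (at t within {0..1})) (at t)"
          by simp
        have "(F has_derivative emul (resolvent T (\<gamma> t))) (at (\<gamma> t))"
          using F in_ball t by auto
        then have "((F \<circ> \<gamma>) has_vector_derivative ?f t) (at t)"
          using vector_derivative_diff_chain_within[of \<gamma> _ t UNIV F] g has_derivative_at_withinI by blast
        then show "((\<lambda>t. F (\<gamma> t)) has_vector_derivative ?f t) (at t)"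
          by (simp add: o_def)
      qed
      then show ?thesis by (auto simp: integrable_on_def)
    qed
    then show "\<exists>e>0. \<forall>u v. x \<in> cbox u v \<and> cbox u v \<subseteq> ball x e \<and> cbox u v \<subseteq> cbox 0 1 \<longrightarrow> ?f integrable_on cbox u v"
      using e(1) by blast
  qed
  then show ?thesis by simp
qed

end

section \<open>The Riesz projection\<close>

definition resolvent_integral :: "('v::quat_hilbert \<Rightarrow>\<^sub>L 'v) \<Rightarrow> (real \<Rightarrow> complex) \<Rightarrow> 'v \<Rightarrow>\<^sub>L 'v" where
  "resolvent_integral T \<gamma> = integral {0..1} (\<lambda>t. emul (resolvent T (\<gamma> t)) (vector_derivative \<gamma> (at t within {0..1})))"

abbreviation quat_j :: quat where "quat_j \<equiv> Quat 0 0 1 0"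

text \<open>Since j anticommutes with i, this fixes right quaternion-linear operators and reverses
  the sign of right multiplication by i: a complex conjugation on operators.\<close>

definition conj_j :: "('v::quat_hilbert \<Rightarrow>\<^sub>L 'v) \<Rightarrow> 'v \<Rightarrow>\<^sub>L 'v" where
  "conj_j X = rmul quat_j o\<^sub>L X o\<^sub>L rmul (- quat_j)"

lemma conj_j_apply: "conj_j X v = X (v *\<^sub>Q - quat_j) *\<^sub>Q quat_j"
  by (simp add: conj_j_def)

lemma bounded_linear_conj_j: "bounded_linear conj_j"
  unfolding conj_j_def[abs_def]
  by (intro bounded_linear_compose[OF bounded_bilinear.bounded_linear_left[OF bounded_bilinear_blinfun_compose]]
      bounded_bilinear.bounded_linear_right[OF bounded_bilinear_blinfun_compose])

lemma emb_j: "emb z * quat_j = quat_j * emb (cnj z)" "- quat_j * emb z * quat_j = emb (cnj z)"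
  "- (quat_j * quat_j) = 1"
  by (simp_all add: emb_def times_quat_def uminus_quat_def one_quat_def)

lemma clin_bounded: "clin \<Psi> \<Longrightarrow> bounded_linear \<Psi>"
  by (simp add: clin_def)

lemma clin_emb: "clin \<Psi> \<Longrightarrow> \<Psi> (x *\<^sub>Q emb z) = \<Psi> x * z"
  by (simp add: clin_def)

lemma clin_compose:
  assumes "clin \<Psi>" "\<And>v c. blinfun_apply A (v *\<^sub>Q emb c) = A v *\<^sub>Q emb c"
  shows "clin (\<lambda>v. \<Psi> (A v))"
  unfolding clin_def using assms
  by (auto simp: clin_emb intro!: bounded_linear_compose[OF clin_bounded blinfun.bounded_linear_right])

text \<open>Right multiplication by j conjugates the scalars of C_i, and the outer conjugation
  undoes this.\<close>

lemma clin_conj_j: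
  assumes "clin \<Psi>"
  shows "clin (\<lambda>v. cnj (\<Psi> (v *\<^sub>Q quat_j)))"
  unfolding clin_def
proof (intro conjI allI)
  show "bounded_linear (\<lambda>v. cnj (\<Psi> (v *\<^sub>Q quat_j)))"
    by (intro bounded_linear_compose[OF bounded_linear_cnj] bounded_linear_compose[OF clin_bounded[OF assms]]
        bounded_bilinear.bounded_linear_left[OF bounded_bilinear_scaleQ])
  show "cnj (\<Psi> (v *\<^sub>Q emb z *\<^sub>Q quat_j)) = cnj (\<Psi> (v *\<^sub>Q quat_j)) * z" for v z
  proof -
    have "v *\<^sub>Q emb z *\<^sub>Q quat_j = v *\<^sub>Q quat_j *\<^sub>Q emb (cnj z)"
      by (simp add: scaleQ_scaleQ emb_j(1))
    then show ?thesis
      by (simp add: clin_emb[OF assms])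
  qed
qed

lemma blinfun_eq_if_clin_eq:
  assumes "\<And>\<Psi> v. clin \<Psi> \<Longrightarrow> \<Psi> (blinfun_apply A v) = \<Psi> (blinfun_apply B v)"
  shows "A = B"
  by (rule blinfun_eqI, rule eq_if_cin_eq) (rule assms[OF clin_cin])

lemma emb_cnj_in_qclass: "emb (cnj z) \<in> qclass (emb z)"
  by (simp add: qclass_iff emb_simps)

lemma resolvent_set_cnj: "cnj z \<in> resolvent_set T \<longleftrightarrow> z \<in> resolvent_set T"
  by (simp add: resolvent_set_def S_resolvent_on_cong[OF emb_cnj_in_qclass])

context
  fixes T :: "'v::quat_hilbert \<Rightarrow>\<^sub>L 'v"
  assumes T: "qlinear T"
begin

text \<open>\<open>Qop\<close> is the same at z and its conjugate and its inverse is
  quaternion-linear, so only the factor cnj z - T changes, and there j exchanges the two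
  scalars.\<close>

lemma resolvent_cnj:
  assumes "z \<in> resolvent_set T"
  shows "resolvent T (cnj z) = conj_j (resolvent T z)"
proof (rule blinfun_eqI)
  fix v
  let ?B = "blinfun_inv (Qop (emb z) T)"
  have "(v *\<^sub>Q - quat_j *\<^sub>Q emb (cnj z) - T (v *\<^sub>Q - quat_j)) *\<^sub>Q quat_j = v *\<^sub>Q emb z - T v"
    unfolding T_scaleQ[OF T] scaleQ_simps(5) scaleQ_scaleQ emb_j(2)
    by (simp add: emb_j(3) scaleQ_one)
  then have "conj_j (resolvent T z) v = ?B (v *\<^sub>Q emb z - T v)"
    unfolding conj_j_apply resolvent_apply[OF T] by (simp add: Qop_inverse(3)[OF T assms, symmetric])
  then show "resolvent T (cnj z) v = conj_j (resolvent T z) v"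
    by (simp add: resolvent_apply[OF T] Qop_cong[OF emb_cnj_in_qclass])
qed

lemma conj_j_emul:
  assumes "z \<in> resolvent_set T"
  shows "conj_j (emul (resolvent T z) h) = emul (resolvent T (cnj z)) (cnj h)"
  by (rule blinfun_eqI) (simp add: resolvent_cnj[OF assms] conj_j_apply scaleQ_scaleQ emb_j(1))

lemma clin_resolvent_integral:
  assumes \<gamma>: "valid_path \<gamma>" "path_image \<gamma> \<subseteq> resolvent_set T" and \<Psi>: "clin \<Psi>"
  shows "\<Psi> (resolvent_integral T \<gamma> v) = contour_integral \<gamma> (\<lambda>z. \<Psi> (resolvent T z v))"
proof -
  have lin: "bounded_linear (\<lambda>X :: 'v \<Rightarrow>\<^sub>L 'v. \<Psi> (X v))"
    by (rule bounded_linear_compose[OF clin_bounded[OF \<Psi>] blinfun.bounded_linear_left])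
  have "((\<lambda>t. \<Psi> (emul (resolvent T (\<gamma> t)) (vector_derivative \<gamma> (at t within {0..1})) v))
      has_integral \<Psi> (resolvent_integral T \<gamma> v)) {0..1}"
    unfolding resolvent_integral_def using has_integral_linear[OF integrable_integral[OF resolvent_integrable[OF T \<gamma>]] lin]
    by (simp add: o_def)
  then have "((\<lambda>z. \<Psi> (resolvent T z v)) has_contour_integral \<Psi> (resolvent_integral T \<gamma> v)) \<gamma>"
    by (simp add: has_contour_integral_def clin_emb[OF \<Psi>])
  then show ?thesis
    by (rule contour_integral_unique[symmetric])
qed

text \<open>Evaluates the integral with the functional v to cnj (\<Psi> (v j)) at the vector -v j;
  both conjugations are absorbed by conjugating the path.\<close>

lemma clin_conj_j_resolvent_integral:
  assumes \<gamma>: "valid_path \<gamma>" "path_image \<gamma> \<subseteq> resolvent_set T" and \<Psi>: "clin \<Psi>"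
  shows "\<Psi> (conj_j (resolvent_integral T \<gamma>) v) = contour_integral (cnj \<circ> \<gamma>) (\<lambda>z. \<Psi> (resolvent T z v))"
proof -
  have "contour_integral (cnj \<circ> \<gamma>) (\<lambda>z. \<Psi> (resolvent T z v)) =
      cnj (contour_integral \<gamma> (\<lambda>z. cnj (\<Psi> (resolvent T (cnj z) v))))"
    using contour_integral_cnj[OF \<gamma>(1), of "\<lambda>z. \<Psi> (resolvent T z v)"] by (simp only: o_def)
  also have "contour_integral \<gamma> (\<lambda>z. cnj (\<Psi> (resolvent T (cnj z) v))) =
      contour_integral \<gamma> (\<lambda>z. cnj (\<Psi> (resolvent T z (v *\<^sub>Q - quat_j) *\<^sub>Q quat_j)))"
    by (rule contour_integral_cong) (use \<gamma>(2) in \<open>auto simp: resolvent_cnj conj_j_apply subset_iff\<close>)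
  also have "\<dots> = cnj (\<Psi> (resolvent_integral T \<gamma> (v *\<^sub>Q - quat_j) *\<^sub>Q quat_j))"
    by (rule clin_resolvent_integral[OF \<gamma> clin_conj_j[OF \<Psi>], symmetric])
  finally show ?thesis
    by (simp add: conj_j_apply o_def)
qed

text \<open>Reads off A and B in (z - T)^-1 h = A + B i. The coefficients are the real and imaginary
  parts of cnj z * h and of h; only real scalars, T and the inverse of \<open>Qop\<close> remain, so
  both parts are quaternion-linear.\<close>

lemma emul_resolvent_components:
  assumes "z \<in> resolvent_set T"
  shows "emul (resolvent T z) h f =
    blinfun_inv (Qop (emb z) T) ((Re z * Re h + Im z * Im h) *\<^sub>R f - Re h *\<^sub>R T f) +
    blinfun_inv (Qop (emb z) T) ((Re z * Im h - Im z * Re h) *\<^sub>R f - Im h *\<^sub>R T f) *\<^sub>Q emb \<i>"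
proof -
  let ?B = "blinfun_inv (Qop (emb z) T)"
  let ?a = "(Re z * Re h + Im z * Im h) *\<^sub>R f - Re h *\<^sub>R T f"
  let ?b = "(Re z * Im h - Im z * Re h) *\<^sub>R f - Im h *\<^sub>R T f"
  have d: "v *\<^sub>Q emb c = Re c *\<^sub>R v + Im c *\<^sub>R (v *\<^sub>Q emb \<i>)" for v :: 'v and c
  proof -
    have "emb c = Re c *\<^sub>R 1 + Im c *\<^sub>R emb \<i>"
      by (simp add: emb_def one_quat_def scaleR_quat_def plus_quat_def)
    then show ?thesis by (simp add: scaleQ_simps)
  qed
  have "emul (resolvent T z) h f = ?B (f *\<^sub>Q emb (cnj z) - T f) *\<^sub>Q emb h"
    by (simp add: resolvent_apply[OF T])
  also have "\<dots> = ?B ((f *\<^sub>Q emb (cnj z) - T f) *\<^sub>Q emb h)"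
    by (simp only: Qop_inverse(3)[OF T assms])
  also have "(f *\<^sub>Q emb (cnj z) - T f) *\<^sub>Q emb h = f *\<^sub>Q emb (cnj z * h) - T f *\<^sub>Q emb h"
    by (simp add: scaleQ_simps emb_simps)
  also have "f *\<^sub>Q emb (cnj z * h) - T f *\<^sub>Q emb h = ?a + ?b *\<^sub>Q emb \<i>"
    unfolding d[of _ "cnj z * h"] d[of _ h] by (simp add: scaleQ_simps algebra_simps)
  finally show ?thesis
    by (simp add: blinfun.add_right Qop_inverse(3)[OF T assms])
qed

end

context
  fixes T :: "'v::quat_hilbert \<Rightarrow>\<^sub>L 'v" and N :: "'v set" and I :: quat
  assumes T: "qlinear T" and N: "hilbert_basis N" and I: "I \<in> \<S>"
begin

text \<open>If \<open>X = A + B i\<close> with \<open>A\<close> and \<open>B\<close> right quaternion-linear, then \<open>conj_j X = A - B i\<close>, so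
  \<open>SL_of X = B - A I\<close>, where \<open>I\<close> acts through the left multiplication.\<close>

definition SL_of :: "('v \<Rightarrow>\<^sub>L 'v) \<Rightarrow> 'v \<Rightarrow>\<^sub>L 'v" where
  "SL_of X = - ((1/2) *\<^sub>R (rmul (emb \<i>) o\<^sub>L (X - conj_j X))) - (1/2) *\<^sub>R ((X + conj_j X) o\<^sub>L lmult N I)"

lemma bounded_linear_SL_of: "bounded_linear SL_of"
  unfolding SL_of_def[abs_def]
  by (intro bounded_linear_sub bounded_linear_minus bounded_linear_compose[OF bounded_linear_scaleR_right]
      bounded_linear_compose[OF bounded_bilinear.bounded_linear_left[OF bounded_bilinear_blinfun_compose]]
      bounded_linear_compose[OF bounded_bilinear.bounded_linear_right[OF bounded_bilinear_blinfun_compose]]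
      bounded_linear_add bounded_linear_conj_j bounded_linear_ident)

lemma lmult_I_sq: "lmult N I (lmult N I f) = - f"
proof -
  have "lmult N I o\<^sub>L lmult N I = lmult N ((-1) *\<^sub>R 1)"
    by (simp add: lmult_mult[OF N] imag_unit[OF I])
  then have "lmult N I o\<^sub>L lmult N I = - id_blinfun"
    unfolding lmult_scaleR[OF N] lmult_one[OF N] by simp
  then have "(lmult N I o\<^sub>L lmult N I) f = (- id_blinfun) f" by simp
  then show ?thesis by (simp add: blinfun.minus_left)
qed

text \<open>The factor -dq I acts as left multiplication by Im h - Re h I, and the S-resolvent
  brings in the conjugate of q. Collecting the terms in f and g = I f with I I = -1 gives B f - A g
  for the A and B of the complex integrand.\<close>

lemma SL_integrand:
  assumes z: "z \<in> resolvent_set T"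
  shows "SL_resolvent_op N T (slice_emb I z) o\<^sub>L lmult N (- slice_emb I h * I) = SL_of (emul (resolvent T z) h)"
proof (rule blinfun_eqI)
  fix f
  let ?B = "blinfun_inv (Qop (emb z) T)"
  define g where "g = lmult N I f"
  define u where "u = Im h *\<^sub>R f - Re h *\<^sub>R g"
  have cI: "qcnj (slice_emb I z) = slice_emb I (cnj z)"
    using imag_unit(1)[OF I]
    by (simp add: slice_emb_def qcnj_def of_real_quat times_quat_def plus_quat_def)
  have hI: "- slice_emb I h * I = slice_emb I (Complex (Im h) (- Re h))"
  proof -
    have "slice_emb I h = Re h *\<^sub>R 1 + Im h *\<^sub>R I"
      by (simp add: slice_emb_def of_real_def)
    then have "- slice_emb I h * I = - (Re h *\<^sub>R I) - Im h *\<^sub>R (I * I)"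
      by (simp add: algebra_simps)
    then show ?thesis
      by (simp add: imag_unit(3)[OF I] slice_emb_def of_real_def)
  qed
  have lu: "lmult N (- slice_emb I h * I) f = u"
    unfolding hI lmult_slice_emb[OF N]
    by (simp add: u_def g_def blinfun.add_left blinfun.diff_left blinfun.scaleR_left blinfun.minus_left)
  have Lu: "lmult N I u = Im h *\<^sub>R g + Re h *\<^sub>R f"
    unfolding u_def by (simp add: blinfun.diff_right blinfun.scaleR_right g_def lmult_I_sq)
  define aa where "aa f = ?B ((Re z * Re h + Im z * Im h) *\<^sub>R f - Re h *\<^sub>R T f)" for f
  define bb where "bb f = ?B ((Re z * Im h - Im z * Re h) *\<^sub>R f - Im h *\<^sub>R T f)" for f
  have "(SL_resolvent_op N T (slice_emb I z) o\<^sub>L lmult N (- slice_emb I h * I)) f =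
      - ?B (T u - (Re z *\<^sub>R u - Im z *\<^sub>R lmult N I u))"
    by (simp add: SL_resolvent_op_def lu[unfolded mult_minus_left] cI lmult_slice_emb[OF N] Qop_slice_emb[OF I]
        blinfun.minus_left blinfun.diff_left blinfun.add_left blinfun.scaleR_left)
  also have "\<dots> = ?B (- (T u - (Re z *\<^sub>R u - Im z *\<^sub>R lmult N I u)))"
    by (simp only: blinfun.minus_right)
  also have "- (T u - (Re z *\<^sub>R u - Im z *\<^sub>R lmult N I u)) =
      ((Re z * Im h - Im z * Re h) *\<^sub>R f - Im h *\<^sub>R T f) - ((Re z * Re h + Im z * Im h) *\<^sub>R g - Re h *\<^sub>R T g)"
    unfolding Lu by (simp add: u_def blinfun.diff_right blinfun.scaleR_right algebra_simps)
  also have "?B \<dots> = bb f - aa g"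
    unfolding aa_def bb_def by (rule blinfun.diff_right)
  finally have 1: "(SL_resolvent_op N T (slice_emb I z) o\<^sub>L lmult N (- slice_emb I h * I)) f = bb f - aa g" .
  have e: "emul (resolvent T z) h f = aa f + bb f *\<^sub>Q emb \<i>" for f
    unfolding aa_def bb_def by (rule emul_resolvent_components[OF T z])
  \<comment> \<open>Conjugating both z and h keeps the first component and changes the sign of the
    second.\<close>
  have ce: "conj_j (emul (resolvent T z) h) f = aa f - bb f *\<^sub>Q emb \<i>" for f
  proof -
    have "?B ((Re z * - Im h - - Im z * Re h) *\<^sub>R f - - Im h *\<^sub>R T f) = - bb f"
      unfolding bb_def blinfun.minus_right[symmetric] by (simp add: algebra_simps)
    then show ?thesis
      unfolding conj_j_emul[OF T z] using emul_resolvent_components[OF T, of "cnj z" "cnj h" f] z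
      by (simp add: resolvent_set_cnj Qop_cong[OF emb_cnj_in_qclass] aa_def scaleQ_simps)
  qed
  have ii: "emb \<i> * emb \<i> = -1"
    by (simp add: emb_def times_quat_def one_quat_def uminus_quat_def)
  have "SL_of (emul (resolvent T z) h) f = bb f - aa g"
    unfolding SL_of_def
    by (simp add: blinfun.diff_left blinfun.add_left blinfun.minus_left blinfun.scaleR_left e ce
        flip: g_def del: emul_apply2)
      (simp add: scaleQ_simps(1-13) ii flip: scaleR_2 scaleR_add_left)
  then show "(SL_resolvent_op N T (slice_emb I z) o\<^sub>L lmult N (- slice_emb I h * I)) f = SL_of (emul (resolvent T z) h) f"
    using 1 by simp
qed

lemma SL_path_integral_eq:
  assumes \<gamma>: "valid_path \<gamma>" "path_image \<gamma> \<subseteq> resolvent_set T"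
  shows "SL_path_integral N T I \<gamma> = SL_of (resolvent_integral T \<gamma>)"
proof -
  have "SL_path_integral N T I \<gamma> =
      integral {0..1} (\<lambda>t. SL_of (emul (resolvent T (\<gamma> t)) (vector_derivative \<gamma> (at t within {0..1}))))"
    unfolding SL_path_integral_def
    by (intro integral_cong SL_integrand) (use \<gamma>(2) in \<open>auto simp: path_image_def\<close>)
  also have "\<dots> = SL_of (resolvent_integral T \<gamma>)"
    unfolding resolvent_integral_def using integral_linear[OF resolvent_integrable[OF T \<gamma>] bounded_linear_SL_of] by (simp add: o_def)
  finally show ?thesis .
qed

end

section \<open>The residue formula for P at the upper half-plane representative of [q] and its
  conjugate\<close>

definition slice_point :: "quat \<Rightarrow> complex" where
  "slice_point q = Complex (qRe q) (norm (q - of_real (qRe q)))"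

lemma slice_point_simps: "Re (slice_point q) = qRe q" "norm (slice_point q) = norm q"
proof -
  show 1: "Re (slice_point q) = qRe q" by (simp add: slice_point_def)
  have "(norm q)\<^sup>2 = (qRe q)\<^sup>2 + (norm (q - of_real (qRe q)))\<^sup>2"
    unfolding norm_quat_sq by (simp add: minus_quat_def of_real_quat)
  then show "norm (slice_point q) = norm q"
    by (intro power2_eq_imp_eq[of "norm (slice_point q)"]) (simp_all add: cmod_power2 slice_point_def)
qed

lemma mem_slice_point_pair: "z \<in> {slice_point q, cnj (slice_point q)} \<longleftrightarrow> Re z = qRe q \<and> norm z = norm q"
proof
  assume "Re z = qRe q \<and> norm z = norm q"
  then have "Re z = Re (slice_point q)" "(Im z)\<^sup>2 = (Im (slice_point q))\<^sup>2"
    using slice_point_simps[of q] cmod_power2[of z] cmod_power2[of "slice_point q"] by auto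
  then show "z \<in> {slice_point q, cnj (slice_point q)}"
    by (auto simp: complex_eq_iff power2_eq_iff)
qed (auto simp: slice_point_simps)

lemma slice_emb_in_qclass: "I \<in> \<S> \<Longrightarrow> slice_emb I z \<in> qclass q \<longleftrightarrow> z \<in> {slice_point q, cnj (slice_point q)}"
  unfolding mem_slice_point_pair by (simp add: qclass_iff slice_emb_simps)

lemma emb_in_qclass: "emb z \<in> qclass q \<longleftrightarrow> z \<in> {slice_point q, cnj (slice_point q)}"
  using slice_emb_in_qclass[OF imag_units_i] by (simp add: slice_emb_i)

lemma slice_emb_in_S_resolvent: "I \<in> \<S> \<Longrightarrow> slice_emb I z \<in> \<rho>\<^sub>S T \<longleftrightarrow> z \<in> resolvent_set T"
  unfolding resolvent_set_def mem_Collect_eq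
  by (rule S_resolvent_on_cong) (simp add: qclass_iff slice_emb_simps emb_simps)

text \<open>The weak form of P = sum of Res (z - T)^-1. The curves, I and N leave the argument here:
  the rest rests on this formula and on linearity of P. With \<open>pts\<close> a set, a real q
  contributes a single pole.\<close>

definition riesz_formula :: "('v::quat_hilbert \<Rightarrow>\<^sub>L 'v) \<Rightarrow> complex set \<Rightarrow> ('v \<Rightarrow>\<^sub>L 'v) \<Rightarrow> bool" where
  "riesz_formula T pts P \<longleftrightarrow> finite pts \<and> (\<forall>p\<in>pts. \<exists>r>0. ball p r - {p} \<subseteq> resolvent_set T) \<and>
     (\<forall>\<Psi> v. clin \<Psi> \<longrightarrow> \<Psi> (P v) = (\<Sum>p\<in>pts. residue (\<lambda>z. \<Psi> (resolvent T z v)) p))"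

lemma riesz_formulaD:
  "riesz_formula T pts P \<Longrightarrow> clin \<Psi> \<Longrightarrow> \<Psi> (P v) = (\<Sum>p\<in>pts. residue (\<lambda>z. \<Psi> (resolvent T z v)) p)"
  by (simp add: riesz_formula_def)

lemma cnj_mem_closure:
  assumes D: "\<And>z. z \<in> D \<Longrightarrow> cnj z \<in> D" and "z \<in> closure D"
  shows "cnj z \<in> closure D"
proof -
  obtain s where s: "\<And>n. s n \<in> D" "s \<longlonglongrightarrow> z"
    using assms(2) unfolding closure_sequential by blast
  have "(\<lambda>n. cnj (s n)) \<longlonglongrightarrow> cnj z"
    by (intro tendsto_intros s)
  then show ?thesis
    unfolding closure_sequential using s D by (intro exI[of _ "\<lambda>n. cnj (s n)"]) auto
qed

text \<open>Composing a functional with A gives another admissible functional, so A can be moved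
  through the residues. Serves for T, for right multiplication by C_i and for the resolvent
  itself.\<close>

lemma riesz_formula_commute:
  fixes P A :: "'v::quat_hilbert \<Rightarrow>\<^sub>L 'v"
  assumes P: "riesz_formula T pts P"
    and A: "\<And>v c. blinfun_apply A (v *\<^sub>Q emb c) = A v *\<^sub>Q emb c" "\<And>z v. z \<in> resolvent_set T \<Longrightarrow> resolvent T z (A v) = A (resolvent T z v)"
  shows "P (blinfun_apply A v) = A (P v)"
proof (rule eq_if_cin_eq)
  fix u :: 'v
  let ?\<Psi> = "cin u"
  have "?\<Psi> (P (A v)) = (\<Sum>p\<in>pts. residue (\<lambda>z. ?\<Psi> (resolvent T z (A v))) p)"
    by (rule riesz_formulaD[OF P clin_cin])
  also have "\<dots> = (\<Sum>p\<in>pts. residue (\<lambda>z. ?\<Psi> (A (resolvent T z v))) p)"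
  proof (rule sum.cong[OF refl], rule residue_cong[OF _ refl])
    fix p assume "p \<in> pts"
    then obtain r where "r > 0" "ball p r - {p} \<subseteq> resolvent_set T"
      using P unfolding riesz_formula_def by blast
    then show "eventually (\<lambda>z. ?\<Psi> (resolvent T z (A v)) = ?\<Psi> (A (resolvent T z v))) (at p)"
      unfolding eventually_at using A(2) by (intro exI[of _ r]) (auto simp: dist_commute subset_iff)
  qed
  also have "\<dots> = ?\<Psi> (A (P v))"
    by (rule riesz_formulaD[OF P clin_compose[OF clin_cin A(1)], symmetric])
  finally show "?\<Psi> (P (A v)) = ?\<Psi> (A (P v))" .
qed

lemma quat_decomp: "\<exists>c d. q = emb c + emb d * quat_j"
  by (intro exI[of _ "Complex (qRe q) (qI q)"] exI[of _ "Complex (qJ q) (qK q)"])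
    (simp add: emb_def times_quat_def plus_quat_def)

theorem riesz_projection_formula:
  fixes T :: "'v::quat_hilbert \<Rightarrow>\<^sub>L 'v"
  assumes T: "qlinear T" and N: "hilbert_basis N" and P: "riesz_projection N T (qclass q) P"
  shows "riesz_formula T {slice_point q, cnj (slice_point q)} P" "qlinear P"
proof -
  define pts where "pts = {slice_point q, cnj (slice_point q)}"
  obtain U I \<gamma>s where U: "riesz_domain T (qclass q) U" and I: "I \<in> \<S>" and
    bc: "boundary_curves (slice I U) \<gamma>s" and P_eq: "P = (1 / (2 * pi)) *\<^sub>R (\<Sum>\<gamma>\<leftarrow>\<gamma>s. SL_path_integral N T I \<gamma>)"
    using P unfolding riesz_projection_def by blast
  define D where "D = slice I U"
  have D: "open D" "connected D"
    using U I by (auto simp: riesz_domain_def s_domain_def D_def)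
  have frD: "frontier D \<subseteq> resolvent_set T"
    using U I slice_emb_in_S_resolvent[OF I, of _ T] unfolding riesz_domain_def D_def by blast
  have Us: "U \<inter> \<sigma>\<^sub>S T = qclass q"
    using U by (simp add: riesz_domain_def)
  have ptsD: "pts \<subseteq> D"
    using Us slice_emb_in_qclass[OF I] unfolding D_def slice_def pts_def by blast
  have Dr: "D - pts \<subseteq> resolvent_set T"
  proof
    fix z assume z: "z \<in> D - pts"
    then have "slice_emb I z \<in> U" "slice_emb I z \<notin> qclass q"
      unfolding D_def slice_def pts_def slice_emb_in_qclass[OF I] by auto
    then have "slice_emb I z \<notin> \<sigma>\<^sub>S T"
      using Us by blast
    then show "z \<in> resolvent_set T"
      using slice_emb_in_S_resolvent[OF I, of z T] by (simp add: S_spectrum_on_def)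
  qed
  have Dcnj: "cnj z \<in> D" if "z \<in> D" for z
  proof -
    have "slice_emb I (cnj z) \<in> qclass (slice_emb I z)"
      by (simp add: qclass_iff slice_emb_simps[OF I])
    then show ?thesis
      using U that unfolding riesz_domain_def axially_symmetric_def D_def slice_def by blast
  qed
  have clcnj: "cnj z \<in> closure D" if "z \<in> closure D" for z
    by (rule cnj_mem_closure[OF Dcnj that])
  have frD_eq: "frontier D = closure D - D"
    using D(1) by (simp add: frontier_def interior_open)
  have cs: "valid_path \<gamma> \<and> pathfinish \<gamma> = pathstart \<gamma> \<and> path_image \<gamma> \<subseteq> frontier D" if "\<gamma> \<in> set \<gamma>s" for \<gamma>
    using bc that unfolding boundary_curves_def D_def by auto
  have w: "\<And>z. z \<in> D \<Longrightarrow> (\<Sum>\<gamma>\<leftarrow>\<gamma>s. winding_number \<gamma> z) = 1"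
    "\<And>z. z \<notin> closure D \<Longrightarrow> (\<Sum>\<gamma>\<leftarrow>\<gamma>s. winding_number \<gamma> z) = 0"
    using bc unfolding boundary_curves_def D_def by auto
  have pr: "path_image \<gamma> \<subseteq> resolvent_set T" if "\<gamma> \<in> set \<gamma>s" for \<gamma>
    using cs[OF that] frD by blast
  \<comment> \<open>This is A + B i, summed over all boundary curves.\<close>
  define X where "X = (\<Sum>\<gamma>\<leftarrow>\<gamma>s. resolvent_integral T \<gamma>)"
  have lin_sum: "f X = (\<Sum>\<gamma>\<leftarrow>\<gamma>s. f (resolvent_integral T \<gamma>))" if "bounded_linear f" for f :: "('v \<Rightarrow>\<^sub>L 'v) \<Rightarrow> 'b::real_normed_vector"
    unfolding X_def by (induction \<gamma>s) (simp_all add: linear_simps(1)[OF that] linear_simps(3)[OF that])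
  have ev: "bounded_linear (\<lambda>X :: 'v \<Rightarrow>\<^sub>L 'v. \<Psi> (X v))" if "clin \<Psi>" for \<Psi> :: "'v \<Rightarrow> complex" and v
    by (rule bounded_linear_compose[OF clin_bounded[OF that] blinfun.bounded_linear_left])
  have X: "\<Psi> (X v) = complex_of_real (2 * pi) * \<i> * (\<Sum>p\<in>pts. residue (\<lambda>z. \<Psi> (resolvent T z v)) p)" if \<Psi>: "clin \<Psi>" for \<Psi> :: "'v \<Rightarrow> complex" and v
  proof -
    have "\<Psi> (X v) = (\<Sum>\<gamma>\<leftarrow>\<gamma>s. \<Psi> (resolvent_integral T \<gamma> v))"
      by (rule lin_sum[OF ev[OF \<Psi>]])
    also have "\<dots> = (\<Sum>\<gamma>\<leftarrow>\<gamma>s. contour_integral \<gamma> (\<lambda>z. \<Psi> (resolvent T z v)))"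
      using clin_resolvent_integral[OF T _ _ \<Psi>] cs pr by (intro arg_cong[of _ _ sum_list] map_cong) auto
    also have "\<dots> = complex_of_real (2 * pi) * \<i> * 1 * (\<Sum>p\<in>pts. residue (\<lambda>z. \<Psi> (resolvent T z v)) p)"
      by (rule residue_theorem_curves[OF D _ ptsD cs w open_resolvent_set[OF T] Dr frD holomorphic_on_clin_resolvent[OF T \<Psi>]])
        (auto simp: pts_def)
    finally show ?thesis by simp
  qed
  text \<open>Complex conjugation maps \<open>D\<close> onto itself and reverses the orientation of its boundary.\<close>
  have cX: "\<Psi> (conj_j X v) = - \<Psi> (X v)" if \<Psi>: "clin \<Psi>" for \<Psi> :: "'v \<Rightarrow> complex" and v
  proof -
    have "\<Psi> (conj_j X v) = (\<Sum>\<gamma>\<leftarrow>\<gamma>s. \<Psi> (conj_j (resolvent_integral T \<gamma>) v))"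
      by (rule lin_sum[OF bounded_linear_compose[OF ev[OF \<Psi>] bounded_linear_conj_j]])
    also have "\<dots> = (\<Sum>\<gamma>\<leftarrow>map ((\<circ>) cnj) \<gamma>s. contour_integral \<gamma> (\<lambda>z. \<Psi> (resolvent T z v)))"
      unfolding map_map using clin_conj_j_resolvent_integral[OF T _ _ \<Psi>] cs pr by (intro arg_cong[of _ _ sum_list] map_cong) auto
    also have "\<dots> = complex_of_real (2 * pi) * \<i> * (-1) * (\<Sum>p\<in>pts. residue (\<lambda>z. \<Psi> (resolvent T z v)) p)"
    proof (rule residue_theorem_curves[OF D _ ptsD _ _ _ open_resolvent_set[OF T] Dr frD holomorphic_on_clin_resolvent[OF T \<Psi>]])
      have wn: "(\<Sum>\<gamma>\<leftarrow>map ((\<circ>) cnj) \<gamma>s. winding_number \<gamma> z) = - cnj (\<Sum>\<gamma>\<leftarrow>\<gamma>s. winding_number \<gamma> (cnj z))"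
        if z: "z \<notin> frontier D" for z
      proof -
        have "cnj z \<notin> frontier D"
          using z clcnj[of "cnj z"] Dcnj[of z] unfolding frD_eq by auto
        then have "winding_number (cnj \<circ> \<gamma>) z = - cnj (winding_number \<gamma> (cnj z))" if "\<gamma> \<in> set \<gamma>s" for \<gamma>
          using winding_number_cnj[of \<gamma> "cnj z"] cs[OF that] valid_path_imp_path by auto
        then have "(\<Sum>\<gamma>\<leftarrow>map ((\<circ>) cnj) \<gamma>s. winding_number \<gamma> z) = (\<Sum>\<gamma>\<leftarrow>\<gamma>s. - cnj (winding_number \<gamma> (cnj z)))"
          unfolding map_map by (intro arg_cong[of _ _ sum_list] map_cong) auto
        also have "\<dots> = - cnj (\<Sum>\<gamma>\<leftarrow>\<gamma>s. winding_number \<gamma> (cnj z))"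
          by (induction \<gamma>s) auto
        finally show ?thesis .
      qed
      show "(\<Sum>\<gamma>\<leftarrow>map ((\<circ>) cnj) \<gamma>s. winding_number \<gamma> z) = - 1" if "z \<in> D" for z
        using wn[of z] w(1)[OF Dcnj[OF that]] that by (simp add: frD_eq)
      show "(\<Sum>\<gamma>\<leftarrow>map ((\<circ>) cnj) \<gamma>s. winding_number \<gamma> z) = 0" if "z \<notin> closure D" for z
        using wn[of z] w(2)[of "cnj z"] clcnj[of "cnj z"] that by (auto simp: frD_eq)
      show "valid_path \<gamma> \<and> pathfinish \<gamma> = pathstart \<gamma> \<and> path_image \<gamma> \<subseteq> frontier D"
        if "\<gamma> \<in> set (map ((\<circ>) cnj) \<gamma>s)" for \<gamma>
      proof -
        have "\<gamma> \<in> (\<circ>) cnj ` set \<gamma>s"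
          using that by (simp only: set_map)
        then obtain \<delta> where \<delta>: "\<delta> \<in> set \<gamma>s" "\<gamma> = cnj \<circ> \<delta>"
          by (elim imageE)
        have "cnj z \<in> frontier D" if "z \<in> frontier D" for z
          using that clcnj[of z] Dcnj[of "cnj z"] unfolding frD_eq by auto
        then have "path_image \<gamma> \<subseteq> frontier D"
          using cs[OF \<delta>(1)] unfolding \<delta>(2) path_image_compose by blast
        then show ?thesis
          using cs[OF \<delta>(1)] by (simp add: \<delta>(2) valid_path_cnj pathstart_compose pathfinish_compose)
      qed
    qed (auto simp: pts_def)
    also have "\<dots> = - \<Psi> (X v)"
      by (simp add: X[OF \<Psi>])
    finally show ?thesis .
  qed
  \<comment> \<open>Since \<open>conj_j\<close> sends A + B i to A - B i, this says A = 0.\<close>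
  have conjX: "conj_j X = - X"
    by (rule blinfun_eq_if_clin_eq) (simp add: cX blinfun.minus_left linear_simps(4)[OF clin_bounded])
  have "P = (1 / (2 * pi)) *\<^sub>R SL_of N I X"
    unfolding P_eq lin_sum[OF bounded_linear_SL_of[OF T N I]]
    using SL_path_integral_eq[OF T N I] cs pr
    by (intro arg_cong[of _ _ "scaleR (1 / (2 * pi))"] arg_cong[of _ _ sum_list] map_cong) auto
  \<comment> \<open>With A = 0 the term with \<open>lmult\<close> drops out, leaving P = -X i / (2
    pi), in which neither N nor I occurs.\<close>
  then have P_X: "P v = - ((1 / (2 * pi)) *\<^sub>R (X v *\<^sub>Q emb \<i>))" for v
    unfolding SL_of_def[OF T N I] conjX
    by (simp add: blinfun.diff_left blinfun.minus_left blinfun.scaleR_left blinfun.add_left scaleQ_simps(1-13) flip: scaleR_2)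
  show rf: "riesz_formula T {slice_point q, cnj (slice_point q)} P"
    unfolding riesz_formula_def pts_def[symmetric]
  proof (intro conjI ballI allI impI)
    show "finite pts" by (simp add: pts_def)
    show "\<exists>r>0. ball p r - {p} \<subseteq> resolvent_set T" if "p \<in> pts" for p
    proof -
      have "open (D - (pts - {p}))"
        using D by (auto intro!: open_Diff finite_imp_closed simp: pts_def)
      moreover have "p \<in> D - (pts - {p})"
        using that ptsD by auto
      ultimately obtain r where "r > 0" "ball p r \<subseteq> D - (pts - {p})"
        by (rule openE)
      then show ?thesis
        using Dr by (intro exI[of _ r]) blast
    qed
    fix \<Psi> :: "'v \<Rightarrow> complex" and v assume \<Psi>: "clin \<Psi>"
    have "\<Psi> (P v) = - ((1 / (2 * pi)) *\<^sub>R (\<Psi> (X v) * \<i>))"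
      by (simp add: P_X linear_simps(4,5)[OF clin_bounded[OF \<Psi>]] clin_emb[OF \<Psi>])
    then show "\<Psi> (P v) = (\<Sum>p\<in>pts. residue (\<lambda>z. \<Psi> (resolvent T z v)) p)"
      unfolding X[OF \<Psi>] by (simp add: scaleR_conv_of_real field_simps)
  qed
  have Pc: "P (v *\<^sub>Q emb c) = P v *\<^sub>Q emb c" for v c
    using riesz_formula_commute[OF rf, of "rmul (emb c)"] resolvent_scaleQ[OF T]
    by (simp add: scaleQ_scaleQ emb_commute)
  \<comment> \<open>X anticommutes with right multiplication by j, as A = 0, and so does i; the two
    signs cancel in X i. Together with C_i this covers all quaternions.\<close>
  have Pj: "P (v *\<^sub>Q quat_j) = P v *\<^sub>Q quat_j" for v
  proof -
    have jj: "quat_j * quat_j = -1"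
      by (simp add: times_quat_def one_quat_def uminus_quat_def)
    have "conj_j X (v *\<^sub>Q quat_j) = (- X) (v *\<^sub>Q quat_j)"
      using conjX by simp
    then have "X v *\<^sub>Q quat_j = - X (v *\<^sub>Q quat_j)"
      by (simp add: conj_j_apply scaleQ_simps blinfun.minus_left jj)
    then have "X (v *\<^sub>Q quat_j) *\<^sub>Q emb \<i> = - (X v *\<^sub>Q quat_j *\<^sub>Q emb \<i>)"
      by (metis add.inverse_inverse scaleQ_simps(3))
    also have "\<dots> = X v *\<^sub>Q emb \<i> *\<^sub>Q quat_j"
      using emb_j(1)[of \<i>] by (simp add: scaleQ_simps emb_simps)
    finally show ?thesis
      by (simp add: P_X scaleQ_simps)
  qed
  show "qlinear P"
    unfolding qlinear_def
  proof (intro allI)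
    fix v r
    obtain c d where r: "r = emb c + emb d * quat_j"
      using quat_decomp by blast
    have "P (v *\<^sub>Q r) = P (v *\<^sub>Q emb c) + P (v *\<^sub>Q emb d *\<^sub>Q quat_j)"
      by (simp add: r scaleQ_add_right scaleQ_scaleQ blinfun.add_right)
    also have "\<dots> = P v *\<^sub>Q r"
      unfolding Pj Pc r by (simp add: scaleQ_add_right scaleQ_scaleQ)
    finally show "P (v *\<^sub>Q r) = P v *\<^sub>Q r" .
  qed
qed

section \<open>Principal parts\<close>

text \<open>By Cauchy's formula on an annulus, \<open>g w + Res\<^sub>z\<^sub>=\<^sub>p g z / (z - w)\<close> is the integral of
  \<open>g z / (z - w)\<close> over the outer circle: subtracting the principal part at \<open>p\<close> leaves a bounded function.\<close>

lemma principal_part_bound: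
  assumes g: "g holomorphic_on ball p (4 * e) - {p}" and B: "\<And>z. norm (z - p) = 2 * e \<Longrightarrow> norm (g z) \<le> B"
    and w: "norm (w - p) < e" "w \<noteq> p"
  shows "norm (g w + residue (\<lambda>z. g z / (z - w)) p) \<le> 2 * B"
proof -
  have e: "e > 0"
    using w by (metis norm_ge_zero order.strict_trans1)
  define f where "f z = g z / (z - w)" for z
  let ?S = "ball p (4 * e)" and ?\<gamma> = "circlepath p (2 * e)"
  have wS: "w \<in> ?S - {p}"
    using w e by (simp add: dist_norm norm_minus_commute)
  have "f holomorphic_on ?S - {p, w}"
    unfolding f_def by (intro holomorphic_on_divide holomorphic_on_subset[OF g] holomorphic_intros) auto
  moreover have "path_image ?\<gamma> \<subseteq> ?S - {p, w}"
    using e w by (auto simp: sphere_def dist_norm norm_minus_commute)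
  moreover have "\<forall>z. z \<notin> ?S \<longrightarrow> winding_number ?\<gamma> z = 0"
    using e by (auto intro!: winding_number_zero_outside[of ?\<gamma> "cball p (2 * e)"] simp: sphere_def)
  ultimately have "contour_integral ?\<gamma> f = 2 * pi * \<i> * (\<Sum>x\<in>{p, w}. winding_number ?\<gamma> x * residue f x)"
    by (intro Residue_theorem) auto
  moreover have "winding_number ?\<gamma> p = 1" "winding_number ?\<gamma> w = 1"
    using e w by (auto intro!: winding_number_circlepath simp: norm_minus_commute)
  moreover have "residue f w = g w"
    unfolding f_def
    by (rule residue_simple[of "?S - {p}"]) (use wS g in auto)
  ultimately have I: "contour_integral ?\<gamma> f = 2 * pi * \<i> * (g w + residue f p)"
    using w by (simp add: add.commute)
  have "f contour_integrable_on ?\<gamma>"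
    by (rule contour_integrable_holomorphic_simple[OF \<open>f holomorphic_on ?S - {p, w}\<close>])
      (use \<open>path_image ?\<gamma> \<subseteq> ?S - {p, w}\<close> in \<open>auto simp: open_Diff finite_imp_closed\<close>)
  then have "(f has_contour_integral (2 * pi * \<i> * (g w + residue f p))) ?\<gamma>"
    using I has_contour_integral_integral by metis
  \<comment> \<open>On the circle of radius 2 e the distance to w is at least e, as w is within e of
    p. Bound B / e times length 4 pi e gives 2 pi * 2 B.\<close>
  moreover have "norm (f z) \<le> B / e" if "norm (z - p) = 2 * e" for z
  proof -
    have "norm (z - p) \<le> norm (z - w) + norm (w - p)"
      using norm_triangle_ineq[of "z - w" "w - p"] by simp
    then have "norm (z - w) \<ge> e"
      using that w by simp
    then show ?thesis
      unfolding f_def norm_divide using B[OF that] e by (intro frac_le) (auto intro: order_trans[OF norm_ge_zero])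
  qed
  moreover have "B \<ge> 0"
    using e by (intro order_trans[OF norm_ge_zero B[of "p + of_real (2 * e)"]]) (simp add: norm_mult)
  then have "B / e \<ge> 0"
    using e by simp
  ultimately have "norm (2 * pi * \<i> * (g w + residue f p)) \<le> B / e * (2 * pi * (2 * e))"
    using e by (intro has_contour_integral_bound_circlepath) auto
  then have "2 * pi * norm (g w + residue f p) \<le> 2 * pi * (2 * B)"
    using e by (simp add: norm_mult)
  then show ?thesis
    unfolding f_def[symmetric] by simp
qed

text \<open>Here w is near another pole p', hence more than 3 e away from p. The circle of radius 2
  e encloses p only, and the same length estimate bounds the residue by itself.\<close>

lemma remote_principal_part_bound:
  assumes g: "g holomorphic_on ball p (4 * e) - {p}" and B: "\<And>z. norm (z - p) = 2 * e \<Longrightarrow> norm (g z) \<le> B"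
    and w: "norm (w - p') < e" "4 * e \<le> norm (p - p')"
  shows "norm (residue (\<lambda>z. g z / (z - w)) p) \<le> 2 * B"
proof -
  have e: "e > 0"
    using w by (metis norm_ge_zero order.strict_trans1)
  define f where "f z = g z / (z - w)" for z
  have far: "norm (z - w) \<ge> e" if "norm (z - p) \<le> 2 * e" for z
  proof -
    have "norm (p - p') \<le> norm (z - p) + norm (z - w) + norm (w - p')"
      using norm_triangle_ineq[of "p - z" "z - p'"] norm_triangle_ineq[of "z - w" "w - p'"]
      by (simp add: norm_minus_commute)
    then show ?thesis using that w by linarith
  qed
  have "f holomorphic_on ball p (3 * e) - {p}"
    unfolding f_def
  proof (intro holomorphic_on_divide holomorphic_on_subset[OF g] holomorphic_intros)
    show "z - w \<noteq> 0" if "z \<in> ball p (3 * e) - {p}" for z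
    proof
      assume "z - w = 0"
      then have "norm (p - p') \<le> norm (p - z) + norm (w - p')"
        using norm_triangle_ineq[of "p - z" "z - p'"] by simp
      then show False
        using that w by (simp add: dist_norm)
    qed
  qed (use e in auto)
  then have "(f has_contour_integral 2 * pi * \<i> * residue f p) (circlepath p (2 * e))"
    using e by (intro base_residue[of "ball p (3 * e)"]) auto
  moreover have "norm (f z) \<le> B / e" if "norm (z - p) = 2 * e" for z
    unfolding f_def norm_divide using B[OF that] e far[of z] that
    by (intro frac_le) (auto intro: order_trans[OF norm_ge_zero])
  moreover have "B \<ge> 0"
    using e by (intro order_trans[OF norm_ge_zero B[of "p + of_real (2 * e)"]]) (simp add: norm_mult)
  then have "B / e \<ge> 0"
    using e by simp
  ultimately have "norm (2 * pi * \<i> * residue f p) \<le> B / e * (2 * pi * (2 * e))"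
    using e by (intro has_contour_integral_bound_circlepath) auto
  then have "2 * pi * norm (residue f p) \<le> 2 * pi * (2 * B)"
    using e by (simp add: norm_mult)
  then show ?thesis
    unfolding f_def[symmetric] by simp
qed

section \<open>Eigenvalues of finite type\<close>

text \<open>Bounded singularities have no residue. This is how vectors are shown to lie in the
  kernel of P: those of V2, those of the form v - P v, and eigenvectors belonging to other
  eigenvalues.\<close>

lemma riesz_formula_eq_0:
  fixes T P :: "'v::quat_hilbert \<Rightarrow>\<^sub>L 'v"
  assumes T: "qlinear T" and P: "riesz_formula T pts P"
    and bdd: "\<And>p. p \<in> pts \<Longrightarrow> \<exists>r>0. \<exists>M. \<forall>z\<in>ball p r - {p}. z \<in> resolvent_set T \<longrightarrow> norm (resolvent T z v) \<le> M"
  shows "P v = 0"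
proof (rule eq_if_cin_eq)
  fix u :: 'v
  have "residue (\<lambda>z. cin u (resolvent T z v)) p = 0" if p: "p \<in> pts" for p
  proof -
    obtain r M where r: "r > 0" "\<And>z. z \<in> ball p r - {p} \<Longrightarrow> z \<in> resolvent_set T \<Longrightarrow> norm (resolvent T z v) \<le> M"
      using bdd[OF p] by blast
    obtain r' where r': "r' > 0" "ball p r' - {p} \<subseteq> resolvent_set T"
      using P p unfolding riesz_formula_def by blast
    show ?thesis
    proof (rule residue_eq_0_if_bounded[of "min r r'" _ _ "norm u * M"])
      show "(\<lambda>z. cin u (resolvent T z v)) holomorphic_on ball p (min r r') - {p}"
        by (rule holomorphic_on_subset[OF holomorphic_on_clin_resolvent[OF T clin_cin]]) (use r' in auto)
      show "norm (cin u (resolvent T z v)) \<le> norm u * M" if z: "z \<in> ball p (min r r') - {p}" for z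
      proof -
        have "norm (resolvent T z v) \<le> M"
          using r(2)[of z] r'(2) z by auto
        then show ?thesis
          using norm_cin_le[of u "resolvent T z v"] by (meson mult_left_mono norm_ge_zero order_trans)
      qed
    qed (use r r' in auto)
  qed
  then have "cin u (P v) = 0"
    unfolding riesz_formulaD[OF P clin_cin] by simp
  then show "cin u (P v) = cin u 0"
    by (simp add: cin_def zero_complex.code)
qed

lemma qfinite_dim_image:
  assumes "qlinear A" "qfinite_dim W"
  shows "qfinite_dim (A ` W)"
proof -
  obtain B where B: "finite B" "W = qspan B"
    using assms(2) unfolding qfinite_dim_def by blast
  have lin: "linear A"
    by (simp add: linearI blinfun.add_right blinfun.scaleR_right)
  have "A ` W = span (A ` (\<lambda>(b, u). b *\<^sub>Q u) ` (B \<times> Basis))"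
    unfolding B(2) qspan_eq_span[OF B(1)] linear_span_image[OF lin] ..
  also have "A ` (\<lambda>(b, u). b *\<^sub>Q u) ` (B \<times> Basis) = (\<lambda>(b, u). b *\<^sub>Q u) ` (A ` B \<times> Basis)"
    using assms(1) by (force simp: qlinear_def image_iff)
  also have "span \<dots> = qspan (A ` B)"
    using B(1) by (simp add: qspan_eq_span)
  finally show ?thesis
    unfolding qfinite_dim_def using B(1) by blast
qed

lemma ex_sum_decomp:
  assumes "{v + w | v w. v \<in> V1 \<and> w \<in> V2} = UNIV"
  shows "\<exists>v w. x = v + w \<and> v \<in> V1 \<and> w \<in> V2"
  using UNIV_I[of x] unfolding assms[symmetric] mem_Collect_eq .

text \<open>The resolvent of T maps V2 into itself, and on V2 the operator \<open>Qop\<close> at p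
  is bounded below. Passing from p to z costs an error norm w * norm (p - z), which is absorbed when
  z is close to p.\<close>

lemma resolvent_bounded_near:
  fixes T :: "'v::quat_hilbert \<Rightarrow>\<^sub>L 'v"
  assumes T: "qlinear T" and V1: "qsubspace V1" "T ` V1 \<subseteq> V1" and V2: "qsubspace V2" "T ` V2 \<subseteq> V2"
    and sum: "V1 \<inter> V2 = {0}" "{v + w | v w. v \<in> V1 \<and> w \<in> V2} = UNIV"
    and p: "emb p \<in> S_resolvent_on V2 T"
  shows "\<exists>r>0. \<exists>M. \<forall>z\<in>ball p r. \<forall>v\<in>V2. z \<in> resolvent_set T \<longrightarrow> norm (resolvent T z v) \<le> M * norm v"
proof -
  have "qinv_on V2 (Qop (emb p) T)"
    using p S_resolvent_on_iff[OF V2] by blast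
  then obtain C where C: "C > 0" "\<And>v. v \<in> V2 \<Longrightarrow> norm v \<le> C * norm (Qop (emb p) T v)"
    using qinv_on_iff[OF V2(1) qlinear_Qop[OF T] Qop_invariant[OF V2]] by blast
  \<comment> \<open>L bounds the norm of the factor cnj p - T; the 1 makes it positive. The radius 1
    / (2 C L) below turns the error term into at most half of norm w.\<close>
  define L where "L = norm p + norm T + 1"
  have L: "L > 0" by (simp add: L_def add_nonneg_pos)
  have "norm (resolvent T z v) \<le> 2 * C * L * norm v" if z: "norm (p - z) < 1 / (2 * C * L)" "z \<in> resolvent_set T" and v: "v \<in> V2" for z v
  proof -
    define w where "w = resolvent T z v"
    have wz: "w *\<^sub>Q emb z - T w = v"
      unfolding w_def by (rule resolvent_right[OF T z(2)])
    obtain w1 w2 where w12: "w = w1 + w2" "w1 \<in> V1" "w2 \<in> V2"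
      using ex_sum_decomp[OF sum(2), of w] by (elim exE conjE)
    \<comment> \<open>The V1 component of (z - T) w = v \<in> V2 must vanish, so w1 is killed by z -
      T and is zero.\<close>
    have "w1 *\<^sub>Q emb z - T w1 = v - (w2 *\<^sub>Q emb z - T w2)"
      unfolding wz[symmetric] by (simp add: w12(1) blinfun.add_right scaleQ_simps)
    moreover have "w1 *\<^sub>Q emb z - T w1 \<in> V1"
      using w12(2) V1 by (intro qsubspace_simps(6,3)) auto
    moreover have "v - (w2 *\<^sub>Q emb z - T w2) \<in> V2"
      using v w12(3) V2 by (intro qsubspace_simps(6) qsubspace_simps(3)) auto
    ultimately have "w1 *\<^sub>Q emb z - T w1 \<in> V1 \<inter> V2"
      by simp
    then have "w1 *\<^sub>Q emb z - T w1 = 0"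
      unfolding sum(1) by simp
    then have "w1 = 0"
      using resolvent_left[OF T z(2), of w1] by (simp add: blinfun.zero_right)
    then have w: "w \<in> V2"
      using w12 by simp
    define x where "x = v + w *\<^sub>Q emb (p - z)"
    have x: "x = w *\<^sub>Q emb p - T w"
      using wz by (simp add: x_def emb_simps scaleQ_simps algebra_simps)
    have "Qop (emb p) T w = Qop (emb (cnj p)) T w"
      by (simp add: Qop_cong[OF emb_cnj_in_qclass])
    also have "\<dots> = x *\<^sub>Q emb (cnj p) - T x"
      unfolding Qop_factor[OF T] x by simp
    also have "norm \<dots> \<le> norm x * norm p + norm T * norm x"
      using norm_triangle_ineq4[of "x *\<^sub>Q emb (cnj p)" "T x"] norm_blinfun[of T x]
      by (simp add: norm_scaleQ)
    also have "\<dots> \<le> L * norm x"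
      by (simp add: L_def algebra_simps)
    also have "\<dots> \<le> L * (norm v + norm w * norm (p - z))"
      using L norm_triangle_ineq[of v "w *\<^sub>Q emb (p - z)"] by (simp add: x_def norm_scaleQ)
    finally have "C * norm (Qop (emb p) T w) \<le> C * (L * (norm v + norm w * norm (p - z)))"
      using C(1) by simp
    then have "norm w \<le> C * (L * (norm v + norm w * norm (p - z)))"
      using C(2)[OF w] by linarith
    also have "\<dots> = C * L * norm v + norm w * (C * L * norm (p - z))"
      by (simp add: algebra_simps)
    also have "\<dots> \<le> C * L * norm v + norm w * (1 / 2)"
    proof -
      have "C * L * norm (p - z) \<le> 1 / 2"
        using z(1) C(1) L by (simp add: field_simps)
      then show ?thesis by (intro add_left_mono mult_left_mono) auto
    qed
    finally show ?thesis
      unfolding w_def[symmetric] by simp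
  qed
  moreover have "1 / (2 * C * L) > 0"
    using C L by simp
  ultimately show ?thesis
    by (intro exI[of _ "1 / (2 * C * L)"] conjI exI[of _ "2 * C * L"]) (auto simp: dist_norm)
qed

lemma finite_type_eigenvalueE:
  fixes T :: "'v::quat_hilbert \<Rightarrow>\<^sub>L 'v"
  assumes "finite_type_eigenvalue T q"
  obtains V1 V2 where "qsubspace V1" "T ` V1 \<subseteq> V1" "qfinite_dim V1" "qsubspace V2" "T ` V2 \<subseteq> V2" "closed V2"
    "V1 \<inter> V2 = {0}" "{v + w | v w. v \<in> V1 \<and> w \<in> V2} = UNIV"
    "S_spectrum_on V1 T \<inter> S_spectrum_on V2 T = {}" "S_spectrum_on V1 T = qclass q"
  using assms unfolding finite_type_eigenvalue_def by (elim conjE exE) (rule that; assumption)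

lemma finite_type_imp_finite_dim_range:
  fixes T P :: "'v::quat_hilbert \<Rightarrow>\<^sub>L 'v"
  assumes T: "qlinear T" and P: "riesz_formula T {slice_point q, cnj (slice_point q)} P" "qlinear P"
    and ft: "finite_type_eigenvalue T q"
  shows "qfinite_dim (range P)"
proof -
  obtain V1 V2 where V1: "qsubspace V1" "T ` V1 \<subseteq> V1" "qfinite_dim V1" and V2: "qsubspace V2" "T ` V2 \<subseteq> V2"
    and sum: "V1 \<inter> V2 = {0}" "{v + w | v w. v \<in> V1 \<and> w \<in> V2} = UNIV"
    and sp: "S_spectrum_on V1 T \<inter> S_spectrum_on V2 T = {}" "S_spectrum_on V1 T = qclass q"
    by (rule finite_type_eigenvalueE[OF ft])
  have P0: "P v = 0" if v: "v \<in> V2" for v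
  proof (rule riesz_formula_eq_0[OF T P(1)])
    fix p assume "p \<in> {slice_point q, cnj (slice_point q)}"
    then have "emb p \<in> S_resolvent_on V2 T"
      using sp emb_in_qclass[of p q] unfolding S_spectrum_on_def by blast
    then obtain r M where "r > 0" "\<forall>z\<in>ball p r. \<forall>v\<in>V2. z \<in> resolvent_set T \<longrightarrow> norm (resolvent T z v) \<le> M * norm v"
      using resolvent_bounded_near[OF T V1(1,2) V2 sum] by blast
    then show "\<exists>r>0. \<exists>M. \<forall>z\<in>ball p r - {p}. z \<in> resolvent_set T \<longrightarrow> norm (resolvent T z v) \<le> M"
      using v by (intro exI[of _ r] conjI exI[of _ "M * norm v"]) auto
  qed
  have "range P = P ` V1"
  proof
    show "range P \<subseteq> P ` V1"
    proof
      fix y assume "y \<in> range P"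
      then obtain x where y: "y = P x" by blast
      obtain v w where "x = v + w" "v \<in> V1" "w \<in> V2"
        using ex_sum_decomp[OF sum(2), of x] by (elim exE conjE)
      then show "y \<in> P ` V1"
        using P0 y by (simp add: blinfun.add_right)
    qed
  qed auto
  then show ?thesis
    using qfinite_dim_image[OF P(2) V1(3)] by simp
qed

text \<open>The resolvent set of T on V2 is itself the isolating neighbourhood: it is open and
  contains q, and a point of the spectrum lying in it must be in the spectrum on V1, which is [q].
  The argument does not involve P.\<close>

lemma finite_type_imp_isolated:
  fixes T :: "'v::quat_hilbert \<Rightarrow>\<^sub>L 'v"
  assumes T: "qlinear T" and E: "spectrum_representatives T E" "q \<in> E" and ft: "finite_type_eigenvalue T q"
  shows "q isolated_in E"
proof -
  obtain V1 V2 where V1: "qsubspace V1" "T ` V1 \<subseteq> V1" "qfinite_dim V1" and V2: "qsubspace V2" "T ` V2 \<subseteq> V2" "closed V2"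
    and sum: "V1 \<inter> V2 = {0}" "{v + w | v w. v \<in> V1 \<and> w \<in> V2} = UNIV"
    and sp: "S_spectrum_on V1 T \<inter> S_spectrum_on V2 T = {}" "S_spectrum_on V1 T = qclass q"
    by (rule finite_type_eigenvalueE[OF ft])
  have op: "open (S_resolvent_on V2 T)"
    by (rule open_S_resolvent_on[OF V2(1,3) T V2(2)])
  have qr: "q \<in> S_resolvent_on V2 T"
    using sp qclass_self[of q] unfolding S_spectrum_on_def by blast
  have uniq: "s = q" if s: "s \<in> S_resolvent_on V2 T" "s \<in> E" for s
  proof -
    have sq: "s \<in> \<sigma>\<^sub>S T" "q \<in> \<sigma>\<^sub>S T"
      using E s(2) unfolding spectrum_representatives_def by blast+
    then have "s \<notin> S_resolvent_on V1 T"
      using S_resolvent_direct_sum[OF T V1 V2(1,2,3) sum] s(1) by (auto simp: S_spectrum_on_def)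
    then have "s \<in> qclass q"
      unfolding sp(2)[symmetric] by (simp add: S_spectrum_on_def)
    moreover have "\<exists>!e. e \<in> E \<and> e \<in> qclass q"
      using E(1) sq(2) unfolding spectrum_representatives_def by blast
    ultimately show ?thesis
      using s(2) E(2) qclass_self[of q] by blast
  qed
  have "S_resolvent_on V2 T \<inter> E = {q}"
  proof (intro equalityI subsetI)
    show "s \<in> {q}" if "s \<in> S_resolvent_on V2 T \<inter> E" for s
      using uniq that by simp
  qed (use qr E(2) in simp)
  then show ?thesis
    unfolding isolated_in_def using op E(2) by (intro conjI exI[of _ "S_resolvent_on V2 T"])
qed

text \<open>Insert the functional v to \<Psi> (R(w) v) in the residue formula and use R(w) R(z) =
  (R(w) - R(z)) / (z - w). The term with R(w) is regular at the poles, so R(w) P v contributes just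
  minus the residues of R(z) v / (z - w).\<close>

lemma clin_resolvent_complement:
  fixes T P :: "'v::quat_hilbert \<Rightarrow>\<^sub>L 'v"
  assumes T: "qlinear T" and P: "riesz_formula T pts P" and \<Psi>: "clin \<Psi>" and w: "w \<in> resolvent_set T" "w \<notin> pts"
  shows "\<Psi> (resolvent T w (v - P v)) =
    \<Psi> (resolvent T w v) + (\<Sum>p\<in>pts. residue (\<lambda>z. \<Psi> (resolvent T z v) / (z - w)) p)"
proof -
  define g where "g z = \<Psi> (resolvent T z v)" for z
  have "\<Psi> (resolvent T w (P v)) = (\<Sum>p\<in>pts. residue (\<lambda>z. \<Psi> (resolvent T w (resolvent T z v))) p)"
    by (rule riesz_formulaD[OF P clin_compose[OF \<Psi> resolvent_scaleQ[OF T w(1)]]])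
  also have "\<dots> = (\<Sum>p\<in>pts. - residue (\<lambda>z. g z / (z - w)) p)"
  proof (rule sum.cong[OF refl])
    fix p assume p: "p \<in> pts"
    then obtain r where r: "r > 0" "ball p r - {p} \<subseteq> resolvent_set T"
      using P unfolding riesz_formula_def by blast
    define d where "d = min r (norm (w - p))"
    have d: "d > 0" using r p w by (auto simp: d_def)
    have dw: "z \<in> resolvent_set T \<and> z \<noteq> w" if "z \<in> ball p d - {p}" for z
      using that r(2) by (auto simp: d_def dist_norm norm_minus_commute)
    have "residue (\<lambda>z. \<Psi> (resolvent T w (resolvent T z v))) p = residue (\<lambda>z. (-1) * (g z / (z - w)) + g w / (z - w)) p"
    proof (rule residue_cong[OF _ refl])
      have "\<Psi> (resolvent T w (resolvent T z v)) = (-1) * (g z / (z - w)) + g w / (z - w)" if "z \<in> ball p d - {p}" for z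
      proof -
        have "g w - g z = \<Psi> (resolvent T w v - resolvent T z v)"
          unfolding g_def by (simp add: linear_simps(2)[OF clin_bounded[OF \<Psi>]])
        also have "\<dots> = \<Psi> (resolvent T w (resolvent T z v)) * (z - w)"
          using dw[OF that] by (simp add: resolvent_identity[OF T w(1)] clin_emb[OF \<Psi>])
        finally have "\<Psi> (resolvent T w (resolvent T z v)) = (g w - g z) / (z - w)"
          using dw[OF that] by (simp add: nonzero_eq_divide_eq)
        then show ?thesis
          by (simp add: diff_divide_distrib)
      qed
      then show "eventually (\<lambda>z. \<Psi> (resolvent T w (resolvent T z v)) = (-1) * (g z / (z - w)) + g w / (z - w)) (at p)"
        unfolding eventually_at using d by (intro exI[of _ d]) (auto simp: dist_commute)
    qed
    also have "\<dots> = residue (\<lambda>z. (-1) * (g z / (z - w))) p + residue (\<lambda>z. g w / (z - w)) p"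
    proof (rule residue_add)
      have "g holomorphic_on ball p d - {p}"
        unfolding g_def by (rule holomorphic_on_subset[OF holomorphic_on_clin_resolvent[OF T \<Psi>]]) (use dw in blast)
      then show "(\<lambda>z. (-1) * (g z / (z - w))) holomorphic_on ball p d - {p}"
        using dw by (intro holomorphic_intros) auto
      show "(\<lambda>z. g w / (z - w)) holomorphic_on ball p d - {p}"
        using dw by (intro holomorphic_intros) auto
    qed (use d in auto)
    also have "residue (\<lambda>z. g w / (z - w)) p = 0"
      using w(2) p by (intro residue_holo[of "- {w}"] holomorphic_intros) auto
    also have "residue (\<lambda>z. (-1) * (g z / (z - w))) p = - residue (\<lambda>z. g z / (z - w)) p"
    proof (subst residue_lmul[of "ball p d"])
      have "g holomorphic_on ball p d - {p}"
        unfolding g_def by (rule holomorphic_on_subset[OF holomorphic_on_clin_resolvent[OF T \<Psi>]]) (use dw in blast)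
      then show "(\<lambda>z. g z / (z - w)) holomorphic_on ball p d - {p}"
        using dw by (intro holomorphic_intros) auto
    qed (use d in auto)
    finally show "residue (\<lambda>z. \<Psi> (resolvent T w (resolvent T z v))) p = - residue (\<lambda>z. g z / (z - w)) p"
      by simp
  qed
  also have "\<dots> = - (\<Sum>p\<in>pts. residue (\<lambda>z. g z / (z - w)) p)"
    by (rule sum_negf)
  finally have "\<Psi> (resolvent T w (P v)) = - (\<Sum>p\<in>pts. residue (\<lambda>z. g z / (z - w)) p)" .
  moreover have "\<Psi> (resolvent T w (v - P v)) = g w - \<Psi> (resolvent T w (P v))"
    unfolding g_def blinfun.diff_right by (rule linear_simps(2)[OF clin_bounded[OF \<Psi>]])
  ultimately show ?thesis
    unfolding g_def by simp
qed

text \<open>The factor 4 leaves room for w within e of one pole and circles of radius 2 e about all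
  poles.\<close>

lemma riesz_formula_radius:
  assumes P: "riesz_formula T pts P"
  obtains e where "e > 0" "\<And>p. p \<in> pts \<Longrightarrow> ball p (4 * e) - {p} \<subseteq> resolvent_set T"
    "\<And>p p'. p \<in> pts \<Longrightarrow> p' \<in> pts \<Longrightarrow> p \<noteq> p' \<Longrightarrow> 4 * e \<le> norm (p - p')"
proof -
  have fin: "finite pts" using P by (simp add: riesz_formula_def)
  have "\<forall>p\<in>pts. \<exists>r>0. ball p r - {p} \<subseteq> resolvent_set T"
    using P by (simp add: riesz_formula_def)
  then obtain r where r: "\<And>p. p \<in> pts \<Longrightarrow> r p > 0" "\<And>p. p \<in> pts \<Longrightarrow> ball p (r p) - {p} \<subseteq> resolvent_set T"
    by metis
  \<comment> \<open>The 1 keeps the set nonempty, so that its minimum is meaningful even for empty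
    \<open>pts\<close>.\<close>
  define S where "S = insert 1 (r ` pts \<union> {norm (p - p') | p p'. p \<in> pts \<and> p' \<in> pts \<and> p \<noteq> p'})"
  have "{norm (p - p') | p p'. p \<in> pts \<and> p' \<in> pts \<and> p \<noteq> p'} \<subseteq> (\<lambda>(p, p'). norm (p - p')) ` (pts \<times> pts)"
    by auto
  then have S: "finite S"
    unfolding S_def using fin by (meson finite_SigmaI finite_UnI finite_imageI finite_insert finite_subset)
  have pos: "\<forall>x\<in>S. x > 0"
    unfolding S_def using r(1) by auto
  define e where "e = Min S / 4"
  have e_le: "4 * e \<le> x" if "x \<in> S" for x
    using S that by (simp add: e_def)
  have "e > 0"
    unfolding e_def using pos S by (simp add: S_def)
  moreover have "ball p (4 * e) - {p} \<subseteq> resolvent_set T" if "p \<in> pts" for p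
  proof -
    have "4 * e \<le> r p"
      using that by (intro e_le) (simp add: S_def)
    then have "ball p (4 * e) \<subseteq> ball p (r p)"
      by (rule subset_ball)
    then show ?thesis
      using r(2)[OF that] by blast
  qed
  moreover have "4 * e \<le> norm (p - p')" if "p \<in> pts" "p' \<in> pts" "p \<noteq> p'" for p p'
    using that by (intro e_le) (auto simp: S_def)
  ultimately show ?thesis
    using that by blast
qed

text \<open>On the compact union of the circles the resolvent is bounded by B. For w near p, the
  function with its principal part at p removed and the principal part at every other pole each
  contribute at most 2 B, whence M = card pts * 2 B, independent of w and v.\<close>

lemma resolvent_complement_bounded:
  fixes T P :: "'v::quat_hilbert \<Rightarrow>\<^sub>L 'v"
  assumes T: "qlinear T" and P: "riesz_formula T pts P"
  obtains e M where "e > 0" "M \<ge> 0" "\<And>p. p \<in> pts \<Longrightarrow> ball p e - {p} \<subseteq> resolvent_set T"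
    "\<And>p w v. p \<in> pts \<Longrightarrow> w \<in> ball p e - {p} \<Longrightarrow> norm (resolvent T w (v - P v)) \<le> M * norm v"
proof -
  obtain e where e: "e > 0" "\<And>p. p \<in> pts \<Longrightarrow> ball p (4 * e) - {p} \<subseteq> resolvent_set T"
    and sep: "\<And>p p'. p \<in> pts \<Longrightarrow> p' \<in> pts \<Longrightarrow> p \<noteq> p' \<Longrightarrow> 4 * e \<le> norm (p - p')"
    using riesz_formula_radius[OF P] by metis
  have fin: "finite pts" using P by (simp add: riesz_formula_def)
  define K where "K = (\<Union>p\<in>pts. sphere p (2 * e))"
  have "compact K"
    unfolding K_def using fin by (intro compact_UN) auto
  moreover have "sphere p (2 * e) \<subseteq> ball p (4 * e) - {p}" for p
    using e(1) by auto
  then have K: "K \<subseteq> resolvent_set T"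
    unfolding K_def using e(2) by blast
  then have "continuous_on K (resolvent T)"
    by (rule continuous_on_subset[OF continuous_on_resolvent[OF T]])
  ultimately have "bounded (resolvent T ` K)"
    by (intro compact_imp_bounded compact_continuous_image)
  then obtain B where B: "B > 0" "\<And>z. z \<in> K \<Longrightarrow> norm (resolvent T z) \<le> B"
    unfolding bounded_pos by blast
  have rs: "ball p e - {p} \<subseteq> resolvent_set T" if "p \<in> pts" for p
    using e(2)[OF that] e(1) by (auto simp: subset_iff)
  have bound: "norm (resolvent T w (v - P v)) \<le> (real (card pts) * (2 * B)) * norm v" if p: "p \<in> pts" and w: "w \<in> ball p e - {p}" for p w v
  proof -
    have wp: "w \<notin> pts"
    proof
      assume "w \<in> pts"
      then have "4 * e \<le> norm (p - w)"
        using sep[of p w] p w by auto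
      then show False
        using w e(1) by (simp add: dist_norm)
    qed
    have wr: "w \<in> resolvent_set T" using rs p w by blast
    have "norm (cin u (resolvent T w (v - P v))) \<le> norm u * ((real (card pts) * (2 * B)) * norm v)" for u
    proof -
      define g where "g z = cin u (resolvent T z v)" for z
      define b where "b = norm u * (B * norm v)"
      have hol: "g holomorphic_on ball p' (4 * e) - {p'}" if "p' \<in> pts" for p'
        unfolding g_def by (rule holomorphic_on_subset[OF holomorphic_on_clin_resolvent[OF T clin_cin] e(2)[OF that]])
      have gb: "norm (g z) \<le> b" if "norm (z - p') = 2 * e" "p' \<in> pts" for z p'
      proof -
        have "z \<in> K"
          using that by (auto simp: K_def dist_norm norm_minus_commute)
        then have "norm (resolvent T z v) \<le> B * norm v"
          using B(2)[of z] norm_blinfun[of "resolvent T z" v] by (meson mult_right_mono norm_ge_zero order_trans)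
        then show ?thesis
          unfolding g_def b_def using norm_cin_le[of u "resolvent T z v"] by (meson mult_left_mono norm_ge_zero order_trans)
      qed
      have wn: "norm (w - p) < e" "w \<noteq> p"
        using w by (auto simp: dist_norm norm_minus_commute)
      have "cin u (resolvent T w (v - P v)) = g w + (\<Sum>p'\<in>pts. residue (\<lambda>z. g z / (z - w)) p')"
        unfolding g_def by (rule clin_resolvent_complement[OF T P clin_cin wr wp])
      also have "\<dots> = (g w + residue (\<lambda>z. g z / (z - w)) p) + (\<Sum>p'\<in>pts - {p}. residue (\<lambda>z. g z / (z - w)) p')"
        using sum.remove[OF fin p, of "\<lambda>p'. residue (\<lambda>z. g z / (z - w)) p'"] by simp
      also have "norm \<dots> \<le> 2 * b + (\<Sum>p'\<in>pts - {p}. 2 * b)"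
      proof (rule order_trans[OF norm_triangle_ineq add_mono])
        show "norm (g w + residue (\<lambda>z. g z / (z - w)) p) \<le> 2 * b"
          by (rule principal_part_bound[OF hol[OF p] gb wn]) (use p in auto)
        have "norm (residue (\<lambda>z. g z / (z - w)) p') \<le> 2 * b" if p': "p' \<in> pts - {p}" for p'
          by (rule remote_principal_part_bound[OF hol gb[of _ p'] wn(1)]) (use p p' sep in auto)
        then show "norm (\<Sum>p'\<in>pts - {p}. residue (\<lambda>z. g z / (z - w)) p') \<le> (\<Sum>p'\<in>pts - {p}. 2 * b)"
          by (rule sum_norm_le)
      qed
      also have "\<dots> = (real (card (pts - {p})) + 1) * (2 * b)"
        by (simp only: sum_constant distrib_right mult_1 add.commute)
      also have "real (card (pts - {p})) + 1 = real (card pts)"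
        using card_Suc_Diff1[OF fin p] by linarith
      finally show ?thesis
        by (simp add: b_def mult_ac)
    qed
    then show ?thesis
      using B(1) by (intro norm_le_if_cin_le) auto
  qed
  show ?thesis
    using that[OF e(1) _ rs bound] B(1) by simp
qed

text \<open>On u the resolvent is the scalar 1 / (z - w), bounded away from w. As P is the identity
  on its range, no nonzero u of this kind can belong to it.\<close>

lemma eigenvector_not_in_range:
  fixes T P :: "'v::quat_hilbert \<Rightarrow>\<^sub>L 'v"
  assumes T: "qlinear T" and P: "riesz_formula T pts P" and u: "T u = u *\<^sub>Q emb w" and w: "w \<notin> pts"
  shows "P u = 0"
proof (rule riesz_formula_eq_0[OF T P])
  fix p assume p: "p \<in> pts"
  \<comment> \<open>Half the distance keeps z at least r away from w.\<close>
  define r where "r = norm (p - w) / 2"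
  have r: "r > 0" using p w by (auto simp: r_def)
  have "norm (resolvent T z u) \<le> norm u * (1 / r)" if z: "z \<in> ball p r - {p}" "z \<in> resolvent_set T" for z
  proof -
    have zw: "norm (z - w) \<ge> r"
      using z(1) norm_triangle_ineq[of "p - z" "z - w"] by (simp add: r_def dist_norm)
    have "resolvent T z u = u *\<^sub>Q emb (1 / (z - w))"
    proof (rule resolvent_eqI[OF T z(2)])
      have "u *\<^sub>Q emb (1 / (z - w)) *\<^sub>Q emb z - T (u *\<^sub>Q emb (1 / (z - w))) =
          u *\<^sub>Q emb (1 / (z - w) * z - w * (1 / (z - w)))"
        by (simp only: T_scaleQ[OF T] u scaleQ_scaleQ emb_simps scaleQ_simps(6))
      also have "1 / (z - w) * z - w * (1 / (z - w)) = (z - w) / (z - w)"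
        by (simp flip: diff_divide_distrib)
      also have "\<dots> = 1"
        using zw r by (intro divide_self) auto
      finally show "u *\<^sub>Q emb (1 / (z - w)) *\<^sub>Q emb z - T (u *\<^sub>Q emb (1 / (z - w))) = u"
        by (simp add: emb_simps scaleQ_one)
    qed
    then have "norm (resolvent T z u) = norm u * (1 / norm (z - w))"
      by (simp add: norm_scaleQ norm_divide)
    also have "\<dots> \<le> norm u * (1 / r)"
      using zw r by (intro mult_left_mono frac_le) auto
    finally show ?thesis .
  qed
  then show "\<exists>r>0. \<exists>M. \<forall>z\<in>ball p r - {p}. z \<in> resolvent_set T \<longrightarrow> norm (resolvent T z u) \<le> M"
    using r by blast
qed

lemma finite_dim_range_imp_finite_type:
  fixes T P :: "'v::quat_hilbert \<Rightarrow>\<^sub>L 'v"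
  assumes T: "qlinear T" and P: "riesz_formula T {slice_point q, cnj (slice_point q)} P" "qlinear P"
    and fd: "qfinite_dim (range P)" and q: "q \<in> \<sigma>\<^sub>p\<^sub>S T"
  shows "finite_type_eigenvalue T q"
proof -
  define p where "p = slice_point q"
  define pts where "pts = {p, cnj p}"
  have Ppts: "riesz_formula T pts P" using P(1) by (simp add: pts_def p_def)
  obtain e M where e: "e > 0" "M \<ge> 0" "\<And>p. p \<in> pts \<Longrightarrow> ball p e - {p} \<subseteq> resolvent_set T"
    and M: "\<And>p w v. p \<in> pts \<Longrightarrow> w \<in> ball p e - {p} \<Longrightarrow> norm (resolvent T w (v - P v)) \<le> M * norm v"
    using resolvent_complement_bounded[OF T Ppts] by metis
  have PT: "P (T v) = T (P v)" for v
    by (rule riesz_formula_commute[OF Ppts]) (use T_scaleQ[OF T] resolvent_T[OF T] in auto)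
  have resolvent_comm: "resolvent T z (resolvent T w v) = resolvent T w (resolvent T z v)" if "z \<in> resolvent_set T" "w \<in> resolvent_set T" for z w v
  proof (rule resolvent_eqI[OF T that(1)])
    show "resolvent T w (resolvent T z v) *\<^sub>Q emb z - T (resolvent T w (resolvent T z v)) = resolvent T w v"
      using resolvent_right[OF T that(1), of v] resolvent_scaleQ[OF T that(2)] resolvent_T[OF T that(2)]
      by (metis blinfun.diff_right)
  qed
  \<comment> \<open>Makes the kernel of P invariant under the resolvent, so that inverses on V2 can
    be built from it.\<close>
  have PR: "P (resolvent T w v) = resolvent T w (P v)" if "w \<in> resolvent_set T" for w v
    by (rule riesz_formula_commute[OF Ppts]) (use resolvent_scaleQ[OF T that] resolvent_comm that in auto)
  have PP: "P (P v) = P v" for v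
  proof -
    \<comment> \<open>The resolvent of v - P v is bounded near both poles, so all its residues
      vanish.\<close>
    have "P (v - P v) = 0"
      by (rule riesz_formula_eq_0[OF T Ppts]) (use e(1) M in blast)
    then show ?thesis by (simp add: blinfun.diff_right)
  qed
  define V1 where "V1 = range P"
  define V2 where "V2 = {v. P v = 0}"
  have V1_eq: "V1 = {v. P v = v}"
    unfolding V1_def using PP by (auto intro: range_eqI[OF sym])
  have V1: "qsubspace V1" "closed V1" "T ` V1 \<subseteq> V1"
    using P(2) unfolding V1_eq
    by (auto simp: qsubspace_def qlinear_def blinfun.zero_right blinfun.add_right PT
        intro!: closed_Collect_eq continuous_intros)
  have V2: "qsubspace V2" "closed V2" "T ` V2 \<subseteq> V2"
    using P(2) unfolding V2_def
    by (auto simp: qsubspace_def qlinear_def blinfun.zero_right blinfun.add_right PT scaleQ_simps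
        intro!: closed_Collect_eq continuous_intros)
  have int: "V1 \<inter> V2 = {0}"
    unfolding V1_eq V2_def by (auto simp: blinfun.zero_right)
  have "x \<in> {v + w | v w. v \<in> V1 \<and> w \<in> V2}" for x
    unfolding V1_def V2_def
    by (intro CollectI exI[of _ "P x"] exI[of _ "x - P x"]) (simp add: blinfun.diff_right PP)
  then have sum: "{v + w | v w. v \<in> V1 \<and> w \<in> V2} = UNIV"
    by (intro equalityI subsetI UNIV_I)
  have q_V2: "q \<in> S_resolvent_on V2 T"
  proof -
    \<comment> \<open>p itself is not a regular point, so \<open>Qop\<close> at p is inverted by
      perturbation from a nearby w. On V2 the inverse at w is R(cnj w) R(w), of norm at most M
      squared for every such w; hence C can be fixed before w is chosen.\<close>
    define C where "C = M\<^sup>2 + 1"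
    have C: "C > 0" by (simp add: C_def add_nonneg_pos)
    have pq: "emb p \<in> qclass q"
      using emb_in_qclass[of p q] by (simp add: p_def)
    have "eventually (\<lambda>s. norm (Qop s T - Qop (emb p) T) < 1 / C) (at (emb p))"
      using tendsto_norm_Qop_diff[of T "emb p"] C by (simp add: order_tendsto_iff)
    then obtain d where d: "d > 0" "\<And>s. s \<noteq> emb p \<Longrightarrow> dist s (emb p) < d \<Longrightarrow> norm (Qop s T - Qop (emb p) T) < 1 / C"
      unfolding eventually_at by blast
    define t where "t = min d e / 2"
    have t: "0 < t" "t < d" "t < e" using d(1) e(1) by (auto simp: t_def)
    \<comment> \<open>A real shift moves the conjugate point by the same t and makes
      \<open>emb w - emb p\<close> real.\<close>
    define w where "w = p + of_real t"
    have w_ball: "w \<in> ball p e - {p}" "cnj w \<in> ball (cnj p) e - {cnj p}"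
      using t by (auto simp: w_def dist_norm)
    have wr: "w \<in> resolvent_set T" "cnj w \<in> resolvent_set T"
      using w_ball e(3) unfolding pts_def by blast+
    have "emb w - emb p = of_real t"
      by (simp add: w_def emb_simps)
    then have "dist (emb w) (emb p) < d" "emb w \<noteq> emb p"
      using t by (auto simp: dist_norm)
    then have "norm (Qop (emb w) T - Qop (emb p) T) < 1 / C"
      by (intro d(2))
    then have small: "C * norm (Qop (emb p) T - Qop (emb w) T) < 1"
      using C by (simp add: norm_minus_commute pos_less_divide_eq mult.commute)
    have RV2: "resolvent T z v \<in> V2" if "z \<in> resolvent_set T" "v \<in> V2" for z v
      using that PR by (simp add: V2_def blinfun.zero_right)
    have QR: "Qop (emb w) T (resolvent T (cnj w) (resolvent T w v)) = v" for v
      using resolvent_right[OF T wr(2), of "resolvent T w v"] resolvent_right[OF T wr(1), of v] by (simp add: Qop_factor[OF T])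
    have RQ: "resolvent T (cnj w) (resolvent T w (Qop (emb w) T v)) = v" for v
      using resolvent_left[OF T wr(1), of "v *\<^sub>Q emb (cnj w) - T v"] resolvent_left[OF T wr(2), of v]
      by (simp add: Qop_factor[OF T])
    have bw: "norm v \<le> C * norm (Qop (emb w) T v)" if v: "v \<in> V2" for v
    proof -
      define x where "x = Qop (emb w) T v"
      have x: "x \<in> V2"
        unfolding x_def using Qop_invariant[OF V2(1,3)] v by blast
      have y: "resolvent T w x \<in> V2" by (rule RV2[OF wr(1) x])
      have "norm v = norm (resolvent T (cnj w) (resolvent T w x))"
        unfolding x_def RQ ..
      \<comment> \<open>For v in V2 one has v - P v = v, so M bounds the resolvent itself
        there.\<close>
      also have "\<dots> \<le> M * norm (resolvent T w x)"
        using M[of "cnj p" "cnj w" "resolvent T w x"] w_ball y by (simp add: pts_def V2_def)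
      also have "\<dots> \<le> M * (M * norm x)"
        using M[of p w x] w_ball x e(2) by (intro mult_left_mono) (simp_all add: pts_def V2_def)
      also have "\<dots> \<le> C * norm x"
        by (simp add: C_def power2_eq_square algebra_simps)
      finally show ?thesis by (simp add: x_def)
    qed
    have inv: "qinv_on V2 (Qop (emb w) T)"
      unfolding qinv_on_iff[OF V2(1) qlinear_Qop[OF T] Qop_invariant[OF V2(1,3)]]
    proof
      show "V2 \<subseteq> Qop (emb w) T ` V2"
      proof
        fix v assume "v \<in> V2"
        then show "v \<in> Qop (emb w) T ` V2"
          using QR[of v] RV2 wr by (intro image_eqI[of _ _ "resolvent T (cnj w) (resolvent T w v)"]) auto
      qed
    qed (use C bw in blast)
    have "qinv_on V2 (Qop (emb p) T)"
      by (rule qinv_on_perturb[OF V2(1,2) qlinear_Qop[OF T] Qop_invariant[OF V2(1,3)]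
            qlinear_Qop[OF T] Qop_invariant[OF V2(1,3)] C bw inv small])
    then show ?thesis
      using S_resolvent_on_iff[OF V2(1,3), of q] by (simp add: Qop_cong[OF pq])
  qed
  \<comment> \<open>V1 is finite-dimensional, so injectivity suffices. The factorisation of
    \<open>Qop\<close> splits a kernel vector into two eigenvector problems, first y with eigenvalue
    z, then v with eigenvalue cnj z; neither lies in \<open>pts\<close>, so both vectors
    vanish.\<close>
  have s1: "s \<in> S_resolvent_on V1 T" if s: "s \<notin> qclass q" for s
  proof -
    have "qinv_on V1 (Qop s T)"
    proof (rule qinv_on_finite_dim[OF V1(1) fd[folded V1_def] qlinear_Qop[OF T] Qop_invariant[OF V1(1,3)]])
      fix v assume v: "v \<in> V1" "Qop s T v = 0"
      define z where "z = slice_point s"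
      have zs: "emb z \<in> qclass s"
        using emb_in_qclass[of z s] by (simp add: z_def)
      have zq: "z \<notin> pts" "cnj z \<notin> pts"
        using s unfolding pts_def p_def mem_slice_point_pair by (simp_all add: qclass_iff z_def slice_point_simps)
      have eig: "u = 0" if "u \<in> V1" "T u = u *\<^sub>Q emb c" "c \<notin> pts" for u c
        using eigenvector_not_in_range[OF T Ppts that(2,3)] that(1) by (simp add: V1_eq)
      define y where "y = v *\<^sub>Q emb (cnj z) - T v"
      have "y *\<^sub>Q emb z - T y = 0"
        using v(2) Qop_factor[OF T, of z v] by (simp add: y_def Qop_cong[OF zs])
      moreover have "y \<in> V1"
        unfolding y_def using v(1) V1 by (intro qsubspace_simps(6) qsubspace_simps(3)) auto
      ultimately have "y = 0"
        using zq(1) by (intro eig[of y z]) auto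
      then show "v = 0"
        using zq(2) v(1) by (intro eig[of v "cnj z"]) (auto simp: y_def)
    qed
    then show ?thesis
      using S_resolvent_on_iff[OF V1(1,3), of s] by simp
  qed
  \<comment> \<open>If q were regular on V1 as well as on V2, both components of a kernel vector of
    \<open>Qop q T\<close> would vanish, against q being in the point spectrum.\<close>
  have q_V1: "q \<notin> S_resolvent_on V1 T"
  proof
    assume "q \<in> S_resolvent_on V1 T"
    then have N1: "{v \<in> V1. Qop q T v = 0} = {0}"
      by (simp add: S_resolvent_on_def)
    have N2: "{v \<in> V2. Qop q T v = 0} = {0}"
      using q_V2 by (simp add: S_resolvent_on_def)
    have "v = 0" if v: "Qop q T v = 0" for v
    proof -
      have "Qop q T (P v) = P (Qop q T v)"
        by (simp add: Qop_apply blinfun.diff_right blinfun.add_right blinfun.scaleR_right flip: PT)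
      then have QP: "Qop q T (P v) = 0"
        using v by (simp add: blinfun.zero_right)
      have "v - P v \<in> {v \<in> V2. Qop q T v = 0}"
        using v QP by (simp add: V2_def blinfun.diff_right PP)
      moreover have "P v \<in> {v \<in> V1. Qop q T v = 0}"
        using QP by (simp add: V1_def)
      ultimately show ?thesis
        unfolding N1 N2 by simp
    qed
    then have "{v. Qop q T v = 0} = {0}"
      by (auto simp: blinfun.zero_right)
    then show False
      using q by (simp add: point_S_spectrum_def)
  qed
  have sp1: "S_spectrum_on V1 T = qclass q"
  proof (intro equalityI subsetI)
    show "s \<in> qclass q" if "s \<in> S_spectrum_on V1 T" for s
      using s1[of s] that by (auto simp: S_spectrum_on_def)
    show "s \<in> S_spectrum_on V1 T" if "s \<in> qclass q" for s
      using q_V1 S_resolvent_on_cong[OF that, of V1 T] by (simp add: S_spectrum_on_def)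
  qed
  have sp12: "S_spectrum_on V1 T \<inter> S_spectrum_on V2 T = {}"
    unfolding sp1 using q_V2 S_resolvent_on_cong[of _ q V2 T] by (auto simp: S_spectrum_on_def)
  have "q \<in> \<sigma>\<^sub>S T"
    using q by (auto simp: S_spectrum_on_def S_resolvent_on_def point_S_spectrum_def)
  then show ?thesis
    unfolding finite_type_eigenvalue_def
    using V1 V2 int sum fd[folded V1_def] sp1 sp12
    by (intro conjI exI[of _ V1] exI[of _ V2])
qed

text \<open>A neighbourhood defining the Riesz projection need not exist, so the equivalence ranges
  over every P related to [q]. Isolation of q, whose proof does not involve P, is asserted
  separately.\<close>

theorem theorem3p10:
  fixes T :: "'v::quat_hilbert \<Rightarrow>\<^sub>L 'v" and N :: "'v set" and q :: quat and E :: "quat set"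
  assumes "separable_space (euclidean :: 'v topology)"
    and "\<not> qfinite_dim (UNIV :: 'v set)"
    and "hilbert_basis N"
    and "qlinear T"
    and "q \<in> \<sigma>\<^sub>p\<^sub>S T"
    and "spectrum_representatives T E" and "q \<in> E"
  shows "(finite_type_eigenvalue T q \<longrightarrow> q isolated_in E) \<and>
    (\<forall>P. riesz_projection N T (qclass q) P \<longrightarrow>
       (finite_type_eigenvalue T q \<longleftrightarrow>
          q isolated_in E \<and> qfinite_dim (range (blinfun_apply P))))"
proof (intro conjI impI allI)
  show iso: "q isolated_in E" if "finite_type_eigenvalue T q"
    by (rule finite_type_imp_isolated[OF assms(4,6,7) that])
  fix P assume "riesz_projection N T (qclass q) P"
  note P = riesz_projection_formula[OF assms(4,3) this]
  show "finite_type_eigenvalue T q \<longleftrightarrow> q isolated_in E \<and> qfinite_dim (range (blinfun_apply P))"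
    using iso finite_type_imp_finite_dim_range[OF assms(4) P]
      finite_dim_range_imp_finite_type[OF assms(4) P _ assms(5)] by blast
qed

end
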